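(* Let $b_n\in\mathbb R$ with $b_1=1$ and $|b_n|\le1$, let $M_U(s)=\sum_{n\le U}b_nn^{-s}$, $Y_U(s)=\zeta(s)M_U(s)M_U(1-s)$, and let $\beta_U(s)=\aleph(s)\Lambda_U(s)$, where $\Lambda_U$ is Lavrik's analytic half of $Y_U$ (defined in the context). Let $U\asymp T^\theta$, $\log U=\theta\log T+O(1)$, $0<\theta<1/4$, and $x=1-2\delta\asymp1/\log T$. Suppose that $$\aleph(s)Y_U(s)=c\operatorname{Re}\beta_U(s)\qquad(\operatorname{Re}s=\tfrac12),\qquad c>0,$$ that the horizontal errors are $o(T)$, i.e. the net horizontal argument increments of $\beta_U$ in the rectangle $\delta\le\operatorname{Re}s\le\tfrac12$, $T\le\operatorname{Im}s\le2T$, and the corresponding auxiliary boundary increments, contribute $o(T)$ (to the rectangle inequality described in the context), and that, uniformly in this moving range, $$\frac1T\int_T^{2T}|\beta_U(\delta+it)|^2\,dt\le\frac{\gamma}{x\log U}(1+o(1)),$$ where $\gamma>0$ is a constant. Then $$A(T,2T)\ge\frac{T\log U}{\pi e c^2\gamma}(1+o(1)),\qquad \kappa_0\ge\frac{2\theta}{e c^2\gamma}.$$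
   Context: $\kappa_0=\liminf_{T\to\infty}N_0(T)/N(T)$, where $N(T)$ is the number of non-trivial zeros of $\zeta(s)$ with imaginary part in $(0,T]$, counted with multiplicity, and $N_0(T)$ counts those with real part $\tfrac12$. $A(T,2T)$ is the number of distinct ordinates $t\in[T,2T]$ at which $\zeta(\tfrac12+it)$ has a zero of odd multiplicity. Write $\zeta(s)=\chi(s)\zeta(1-s)$ with $\chi(s)=\pi^{s-1/2}\Gamma((1-s)/2)/\Gamma(s/2)$, and $\aleph(s)=\chi(s)^{-1/2}$, with the branch chosen continuously in the region under consideration; on $\operatorname{Re}s=\tfrac12$ one has $|\aleph(s)|=1$ and $\aleph(s)Y_U(s)\in\mathbb R$. Lavrik's analytic half. Expand $Y_U(s)=\sum_{\xi>0}a_\xi\xi^{-s}$ for $\operatorname{Re}s>1$, where $\xi$ runs over positive rationals and $a_\xi=\sum b_\ell b_m/m$, the sum being over $n\ge1$ and $\ell,m\le U$ with $n\ell/m=\xi$. For the dyadic block $T\le\operatorname{Im}s\le2T$ put $\rho=\exp\{i(\pi/2-1/T)\}$ and $F(s,X)=\Gamma(s/2,X^2)/\Gamma(s/2)$ (upper incomplete gamma function). Then $$\Lambda_U(s)=\sum_{\xi>0}a_\xi\xi^{-s}F\big(s,(\pi\rho)^{1/2}\xi\big)+\frac{\pi^{1/2}(\pi\rho)^{(s-1)/2}M_U(0)M_U(1)}{\Gamma(s/2)(s-1)}.$$ (With this function the critical-line identity holds with $c=2$; the constant $c$ is kept as a parameter recording the normalisation.) Horizontal errors. A net argument increment is the increment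 of a continuously chosen argument along a segment. The horizontal contributions are those entering Littlewood's rectangle argument, which is applied to $\beta_U$ in the rectangle $\delta\le\operatorname{Re}s\le\tfrac12$, $T\le\operatorname{Im}s\le2T$, and, as auxiliary steps, to $\zeta$ and $M_U$ in the rectangle $\tfrac12\le\operatorname{Re}s\le3$, $T\le\operatorname{Im}s\le2T$, in order to obtain $$\frac{\pi x}{2}A(T,2T)\ge-\int_T^{2T}\log|\beta_U(\delta+it)|\,dt-T\log c-o(T),$$ the hypothesis being that these increments contribute only $o(T)$. *)

theory Defs
  imports "HOL-Complex_Analysis.Complex_Analysis" "HOL-Library.Landau_Symbols"
begin

text \<open>
  The Riemann zeta function: the analytic continuation of its Dirichlet series to the plane
  without the point 1. The value at the pole is fixed only to make the description unique.
\<close>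

definition zeta :: "complex \<Rightarrow> complex" where
  "zeta = (THE f. f holomorphic_on (- {1}) \<and> f 1 = 0 \<and>
             (\<forall>s. Re s > 1 \<longrightarrow> f s = (\<Sum>n. of_nat (Suc n) powr (- s))))"

definition chi :: "complex \<Rightarrow> complex" where
  "chi s = of_real pi powr (s - 1 / 2) * Gamma ((1 - s) / 2) / Gamma (s / 2)"

text \<open>
  A continuous branch of \<open>chi powr (-1/2)\<close>. In the open upper half-plane \<open>chi\<close> has neither zeros
  nor poles, so there are exactly two branches there, differing by a global sign.
\<close>

definition aleph_branch :: "(complex \<Rightarrow> complex) \<Rightarrow> bool" where
  "aleph_branch A \<longleftrightarrow>
     continuous_on {s. Im s > 0} A \<and> (\<forall>s. Im s > 0 \<longrightarrow> (A s)\<^sup>2 = 1 / chi s)"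

definition mollifier :: "(nat \<Rightarrow> real) \<Rightarrow> real \<Rightarrow> complex \<Rightarrow> complex" where
  "mollifier b U s = (\<Sum>n | 1 \<le> n \<and> real n \<le> U. of_real (b n) * of_nat n powr (- s))"

definition Y_fun :: "(nat \<Rightarrow> real) \<Rightarrow> real \<Rightarrow> complex \<Rightarrow> complex" where
  "Y_fun b U s = zeta s * mollifier b U s * mollifier b U (1 - s)"

text \<open>
  The Dirichlet coefficients of \<open>Y_fun\<close> over the positive rationals. The index set is finite,
  since \<open>n\<close> is determined by \<open>l\<close>, \<open>m\<close> and \<open>\<xi>\<close>.
\<close>

definition Y_coeff :: "(nat \<Rightarrow> real) \<Rightarrow> real \<Rightarrow> rat \<Rightarrow> real" where
  "Y_coeff b U \<xi> =
     (\<Sum>(n, l, m) \<in> {(n, l, m). 1 \<le> n \<and> 1 \<le> l \<and> real l \<le> U \<and> 1 \<le> m \<and> real m \<le> U \<and>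
                               of_nat (n * l) / of_nat m = \<xi>}. b l * b m / real m)"

text \<open>
  The upper incomplete Gamma function, with the path of integration from \<open>z\<close> to infinity taken
  parallel to the positive real axis and principal powers, for \<open>z\<close> off the non-positive real axis.
\<close>

definition upper_Gamma :: "complex \<Rightarrow> complex \<Rightarrow> complex" where
  "upper_Gamma a z =
     integral {0..} (\<lambda>u. (z + of_real u) powr (a - 1) * exp (- (z + of_real u)))"

definition Lavrik_F :: "complex \<Rightarrow> complex \<Rightarrow> complex" where
  "Lavrik_F s X = upper_Gamma (s / 2) (X\<^sup>2) / Gamma (s / 2)"

definition rho :: "real \<Rightarrow> complex" where
  "rho T = exp (\<i> * of_real (pi / 2 - 1 / T))"

text \<open>Lavrik's analytic half of \<open>Y_fun b U\<close> for the dyadic block \<open>T \<le> Im s \<le> 2 * T\<close>.\<close>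

definition Lavrik_half :: "(nat \<Rightarrow> real) \<Rightarrow> real \<Rightarrow> real \<Rightarrow> complex \<Rightarrow> complex" where
  "Lavrik_half b U T s =
     (\<Sum>\<^sub>\<infinity>\<xi>\<in>{0<..}. of_real (Y_coeff b U \<xi>) * of_rat \<xi> powr (- s) *
         Lavrik_F s ((of_real pi * rho T) powr (1 / 2) * of_rat \<xi>)) +
     of_real pi powr (1 / 2) * (of_real pi * rho T) powr ((s - 1) / 2) *
       mollifier b U 0 * mollifier b U 1 / (Gamma (s / 2) * (s - 1))"

definition beta ::
    "(complex \<Rightarrow> complex) \<Rightarrow> (nat \<Rightarrow> real) \<Rightarrow> real \<Rightarrow> real \<Rightarrow> complex \<Rightarrow> complex" where
  "beta A b U T s = A s * Lavrik_half b U T s"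

text \<open>
  The increment, from \<open>p\<close> to \<open>q\<close>, of a continuously chosen argument of \<open>f\<close> along the segment.
  It is well defined when \<open>f\<close> is continuous and has no zero on the segment.
\<close>

definition arg_increment :: "(complex \<Rightarrow> complex) \<Rightarrow> complex \<Rightarrow> complex \<Rightarrow> real" where
  "arg_increment f p q =
     (THE d. \<exists>\<phi> :: real \<Rightarrow> real. continuous_on {0..1} \<phi> \<and>
        (\<forall>u\<in>{0..1}. f (linepath p q u) =
            of_real (norm (f (linepath p q u))) * cis (\<phi> u)) \<and>
        d = \<phi> 1 - \<phi> 0)"

text \<open>
  The horizontal term in Littlewood's lemma for a rectangle \<open>a \<le> Re s \<le> b\<close> with a horizontal side
  at height \<open>h\<close>: the argument is continued from the right-hand edge.
\<close>

definition horizontal_term :: "(complex \<Rightarrow> complex) \<Rightarrow> real \<Rightarrow> real \<Rightarrow> real \<Rightarrow> real" where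
  "horizontal_term f a b h =
     integral {a..b} (\<lambda>\<sigma>. arg_increment f (Complex b h) (Complex \<sigma> h))"

text \<open>
  The two horizontal sides of the rectangle \<open>a \<le> Re s \<le> b\<close>, \<open>T \<le> Im s \<le> 2 * T\<close> together. They are
  approached from inside the rectangle, which gives the usual meaning to the argument increments
  if \<open>f\<close> has zeros on these sides, and changes nothing if it has none.
\<close>

definition horizontal_contribution ::
    "(complex \<Rightarrow> complex) \<Rightarrow> real \<Rightarrow> real \<Rightarrow> real \<Rightarrow> real" where
  "horizontal_contribution f a b T =
     Lim (at_right 0) (\<lambda>\<eta>. horizontal_term f a b (2 * T - \<eta>) - horizontal_term f a b (T + \<eta>))"

definition A_count :: "real \<Rightarrow> real \<Rightarrow> nat" where
  "A_count T1 T2 =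
     card {t. T1 \<le> t \<and> t \<le> T2 \<and> zeta (Complex (1 / 2) t) = 0 \<and>
              odd (zorder zeta (Complex (1 / 2) t))}"

definition nontrivial_zeros :: "complex set" where
  "nontrivial_zeros = {s. zeta s = 0 \<and> 0 < Re s \<and> Re s < 1}"

definition N_count :: "real \<Rightarrow> real" where
  "N_count T =
     (\<Sum>s | s \<in> nontrivial_zeros \<and> 0 < Im s \<and> Im s \<le> T. of_int (zorder zeta s))"

definition N0_count :: "real \<Rightarrow> real" where
  "N0_count T =
     (\<Sum>s | s \<in> nontrivial_zeros \<and> 0 < Im s \<and> Im s \<le> T \<and> Re s = 1 / 2.
        of_int (zorder zeta s))"

definition kappa0 :: ereal where
  "kappa0 = Liminf at_top (\<lambda>T. ereal (N0_count T / N_count T))"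

text \<open>The real parts \<open>\<delta>\<close> with \<open>k\<^sub>1 / ln T \<le> x \<le> k\<^sub>2 / ln T\<close>, where \<open>x = 1 - 2 * \<delta>\<close>.\<close>

definition delta_range :: "real \<Rightarrow> real \<Rightarrow> real \<Rightarrow> real set" where
  "delta_range k1 k2 T = {\<delta>. k1 / ln T \<le> 1 - 2 * \<delta> \<and> 1 - 2 * \<delta> \<le> k2 / ln T}"

end

theory Submission imports Defs begin

text \<open>
  Littlewood's lemma is applied to \<open>\<beta>\<close> on \<open>\<delta> \<le> Re s \<le> 1/2\<close>. The horizontal sides are negligible by
  hypothesis, and the left edge is controlled by the mean square and the concavity of the logarithm.
  On the right edge \<open>|\<beta>| \<ge> |zeta| |M|\<^sup>2 / c\<close>, and Littlewood's lemma for \<open>zeta\<close> and \<open>M\<close> on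
  \<open>1/2 \<le> Re s \<le> 3\<close> bounds the mean logarithm of the right-hand side from below. What remains is the
  increment of the argument of \<open>\<beta>\<close> on the critical line. There \<open>Re \<beta>\<close> is a nonnegative multiple of the
  real function \<open>A zeta\<close>, which changes sign only at odd zeros of \<open>zeta\<close>, so this increment, less
  \<open>\<pi>\<close> for each zero of \<open>\<beta>\<close> on the line, is at most \<open>\<pi>\<close> times the number of odd zeros plus one.

  For \<open>kappa0\<close> the dyadic bounds are summed and compared with \<open>N(T) \<le> T log T / (2 \<pi>) + O(T)\<close>, which
  comes from the argument principle on \<open>1/2 \<le> Re s \<le> 3\<close>.
\<close>

section \<open>Analytic continuation of the zeta function\<close>

text \<open>Up to o(T), half the width x of the rectangle times pi times the count is at least
  \<open>T / 2 * ln (x * ln (U T) / (\<gamma> * c\<^sup>2))\<close>: the mean square gives the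
  logarithm on the left edge, and the normalisation costs \<open>T * ln c\<close> on the right edge.
  After division by x the best choice makes the logarithm equal to 1, and the factor
  \<open>exp 1\<close> in the conclusion comes from there. Two obstacles shape the rest.
  \<open>beta\<close> may vanish on the critical line and on the horizontal sides, so Littlewood's
  lemma is proved with zeros allowed on the whole boundary. And \<open>zeta\<close> is given only by
  a definite description, so its continuation, its growth and the symmetry of its zeros must all be
  derived; the symmetry is drawn from the critical-line hypothesis by reflection. For
  \<open>kappa0\<close> only the leading coefficient of the zero count matters and any O(T) loss is
  harmless. An exponential bound for \<open>zeta\<close> and a one-sided estimate of
  \<open>Digamma\<close> therefore take the place of convexity bounds and Stirling's
  formula.\<close>

text \<open>Without the term of the integer 1 the series decays like \<open>2 powr (- Re s)\<close>
  as Re s grows; this decay is what makes the shifted series in \<open>landau_identity\<close>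
  converge.\<close>

definition zeta_tail :: "complex \<Rightarrow> complex" where
  "zeta_tail s = (\<Sum>n. of_nat (n + 2) powr (- s))"

lemma norm_of_nat_powr: "norm (of_nat (n + 2) powr (- s) :: complex) = real (n + 2) powr (- Re s)"
  by (metis Re_complex_of_real norm_powr_real_powr of_nat_0_le_iff of_real_of_nat_eq uminus_complex.simps(1) Reals_of_nat)

lemma summable_nat_powr: "s > 1 \<Longrightarrow> summable (\<lambda>n. real (n + 2) powr (- s))"
  using summable_ignore_initial_segment[of "\<lambda>n. real n powr (-s)" 2]
  by (simp add: summable_real_powr_iff)

lemma two_powr_minus: "2 powr (- real k) = (1 / 2 :: real) ^ k"
  by (simp add: powr_minus powr_realpow power_one_over inverse_eq_divide)

lemma nat_powr_le:
  assumes "r \<le> s"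
  shows "real (n + 2) powr (- s) \<le> real (n + 2) powr (- r) * 2 powr (r - s)"
proof -
  have "real (n + 2) powr (- s) = real (n + 2) powr (- r) * real (n + 2) powr (r - s)"
    by (simp flip: powr_add)
  also have "real (n + 2) powr (r - s) \<le> 2 powr (r - s)"
    using assms by (intro powr_mono2') auto
  finally show ?thesis by (simp add: mult_left_mono)
qed

lemma summable_zeta_tail:
  assumes "Re s > 1"
  shows "summable (\<lambda>n. norm (of_nat (n + 2) powr (- s) :: complex))"
  using summable_nat_powr[OF assms] by (simp only: norm_of_nat_powr)

lemma norm_zeta_tail_le:
  assumes "1 < r" "r \<le> Re s"
  shows "norm (zeta_tail s) \<le> (\<Sum>n. real (n + 2) powr (- r)) * 2 powr (r - Re s)"
proof -
  have "norm (zeta_tail s) \<le> (\<Sum>n. real (n + 2) powr (- Re s))"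
    unfolding zeta_tail_def
    using summable_norm[OF summable_zeta_tail[of s]] assms by (simp only: norm_of_nat_powr)
  also have "\<dots> \<le> (\<Sum>n. real (n + 2) powr (- r) * 2 powr (r - Re s))"
    using assms nat_powr_le by (intro suminf_le summable_mult2 summable_nat_powr) auto
  also have "\<dots> = (\<Sum>n. real (n + 2) powr (- r)) * 2 powr (r - Re s)"
    using assms by (intro suminf_mult2[symmetric] summable_nat_powr)
  finally show ?thesis .
qed

lemma zeta_tail_holomorphic: "zeta_tail holomorphic_on {s. Re s > 1}"
proof (rule holomorphic_uniform_sequence[where f = "\<lambda>N s. \<Sum>n<N. of_nat (n + 2) powr (- s)"])
  show "open {s. Re s > 1}" by (rule open_halfspace_Re_gt)
  show "(\<lambda>s. \<Sum>n<N. of_nat (n + 2) powr (- s)) holomorphic_on {s. Re s > 1}" for N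
    by (intro holomorphic_intros)
  fix x :: complex assume x: "x \<in> {s. Re s > 1}"
  define r where "r = (1 + Re x) / 2"
  define d where "d = (Re x - 1) / 2"
  have r: "1 < r" "0 < d" using x by (auto simp: r_def d_def)
  have ge: "r \<le> Re y" if "y \<in> cball x d" for y
  proof -
    have "\<bar>Re (x - y)\<bar> \<le> d" using that abs_Re_le_cmod[of "x - y"] by (simp add: dist_norm)
    then have "Re x - Re y \<le> (Re x - 1) / 2" unfolding d_def abs_le_iff by simp
    then show ?thesis by (simp add: r_def)
  qed
  have "uniform_limit (cball x d) (\<lambda>N s. \<Sum>n<N. of_nat (n + 2) powr (- s))
          (\<lambda>s. \<Sum>n. of_nat (n + 2) powr (- s)) sequentially"
  proof (rule Weierstrass_m_test)
    show "summable (\<lambda>n. real (n + 2) powr (- r))" using r by (intro summable_nat_powr)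
    show "norm (of_nat (n + 2) powr (- y) :: complex) \<le> real (n + 2) powr (- r)"
      if "y \<in> cball x d" for n y
      using ge[OF that] unfolding norm_of_nat_powr by (intro powr_mono) auto
  qed
  moreover have "cball x d \<subseteq> {s. Re s > 1}" using ge r by fastforce
  ultimately show "\<exists>d>0. cball x d \<subseteq> {s. Re s > 1} \<and>
      uniform_limit (cball x d) (\<lambda>N s. \<Sum>n<N. of_nat (n + 2) powr (- s)) zeta_tail sequentially"
    using r by (auto simp: zeta_tail_def[abs_def])
qed

section \<open>Landau's relation between the values of the tail at s, s + 1, s + 2, ..\<close>

text \<open>This is the binomial series of 1 - 1/2 to the power - R. It dominates the Landau series
  below, which is why bounds of the form \<open>2 powr norm (s - 1)\<close> come out.\<close>

lemma pochhammer_half_sums: "(\<lambda>k. pochhammer R k / fact k * (1 / 2) ^ k :: real) sums (2 powr R)"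
proof -
  have "(\<lambda>n. ((- R) gchoose n) * (- 1 / 2) ^ n) sums (1 + (- 1 / 2)) powr (- R)"
    by (rule gen_binomial_real) auto
  moreover have "((- R) gchoose n) * (- 1 / 2) ^ n = pochhammer R n / fact n * (1 / 2) ^ n" for n
    by (simp add: gbinomial_pochhammer power_mult_distrib[symmetric] flip: power_mult_distrib
          mult.assoc divide_inverse)
  moreover have "(1 + (- 1 / 2)) powr (- R) = 2 powr R"
    by (simp add: powr_minus powr_divide field_simps)
  ultimately show ?thesis by simp
qed

lemma norm_pochhammer_le: "norm (pochhammer (s :: complex) k) \<le> pochhammer (norm s) k"
proof (induction k)
  case (Suc k)
  have "norm (s + of_nat k) \<le> norm s + real k"
    by (metis norm_of_nat norm_triangle_ineq)
  moreover have "0 \<le> pochhammer (norm s) k" using Suc norm_ge_zero order_trans by blast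
  ultimately show ?case using Suc by (auto simp: pochhammer_Suc norm_mult intro!: mult_mono)
qed auto

lemma pochhammer_nonneg': "0 \<le> x \<Longrightarrow> 0 \<le> pochhammer (x :: real) k"
  by (induction k) (auto simp: pochhammer_Suc)

lemma pochhammer_mono: "0 \<le> x \<Longrightarrow> x \<le> y \<Longrightarrow> pochhammer (x :: real) k \<le> pochhammer y k"
proof (induction k)
  case (Suc k)
  then show ?case
    by (auto simp: pochhammer_Suc intro!: mult_mono pochhammer_nonneg' add_nonneg_nonneg)
qed auto

text \<open>Expand \<open>(n + 1) powr (1 - s)\<close> by the binomial series about n + 2, drop the
  term k = 0 and sum over n. The differences telescope to 1, and exchanging the sums turns the
  powers of n + 2 into values of \<open>zeta_tail\<close>.\<close>

lemma landau_identity: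
  assumes s: "Re s > 1"
  shows "(\<lambda>k. pochhammer (s - 1) (Suc k) / fact (Suc k) * zeta_tail (s + of_nat k)) sums 1"
proof -
  define a where "a = (\<lambda>n k. pochhammer (s - 1) (Suc k) / fact (Suc k) *
                       (of_nat (n + 2) powr (- (s + of_nat k)) :: complex))"
  define R where "R = norm (s - 1)"
  have inner: "(\<lambda>k. a n k) sums (of_nat (n + 1) powr (1 - s) - of_nat (n + 2) powr (1 - s))" for n
  proof -
    have "(\<lambda>k. ((1 - s) gchoose k) * of_real (- 1) ^ k * of_real (real (n + 2)) powr ((1 - s) - of_nat k))
            sums of_real (- 1 + real (n + 2)) powr (1 - s)"
      by (rule gen_binomial_complex') auto
    then have "(\<lambda>k. pochhammer (s - 1) k / fact k * of_nat (n + 2) powr (1 - s - of_nat k))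
            sums of_nat (n + 1) powr (1 - s)"
      by (simp add: gbinomial_pochhammer flip: power_mult_distrib mult.assoc)
        (simp add: add_ac mult_ac)
    from sums_split_initial_segment[OF this, of 1] show ?thesis
      by (simp add: a_def[abs_def] diff_diff_eq2 add_ac minus_diff_eq diff_diff_eq)
  qed
  have tele: "(\<lambda>n. of_nat (n + 1) powr (1 - s) - of_nat (n + 2) powr (1 - s)) sums (1 :: complex)"
  proof -
    have lim: "(\<lambda>n. of_nat (n + 1) powr (1 - s)) \<longlonglongrightarrow> (0 :: complex)"
    proof (rule tendsto_norm_zero_cancel)
      have "(\<lambda>n. real (n + 1) powr (1 - Re s)) \<longlonglongrightarrow> 0"
        using s by real_asymp
      moreover have "norm (of_nat (n + 1) powr (1 - s) :: complex) = real (n + 1) powr (1 - Re s)" for n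
        by (metis (no_types) Reals_of_nat norm_powr_real_powr of_nat_0_le_iff Re_complex_of_real of_real_of_nat_eq minus_complex.simps(1) one_complex.simps(1))
      ultimately show "(\<lambda>n. norm (of_nat (n + 1) powr (1 - s) :: complex)) \<longlonglongrightarrow> 0" by simp
    qed
    have "(\<lambda>n. of_nat (n + 1) powr (1 - s) - of_nat (Suc n + 1) powr (1 - s))
             sums (of_nat (0 + 1) powr (1 - s) - (0 :: complex))"
      by (rule telescope_sums'[OF lim])
    then show ?thesis by simp
  qed
  \<comment> \<open>The majorant is a function of n times a function of k, so absolute summability
    over pairs reduces to two single series.\<close>
  have na: "norm (a n k) \<le> real (n + 2) powr (- Re s) * (pochhammer R (Suc k) / fact (Suc k) * (1/2) ^ k)" for n k
  proof -
    have "norm (a n k) = norm (pochhammer (s - 1) (Suc k)) / fact (Suc k) * real (n + 2) powr (- (Re s + real k))"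
      unfolding a_def norm_mult norm_of_nat_powr norm_divide by (simp del: fact_Suc)
    also have "\<dots> \<le> pochhammer R (Suc k) / fact (Suc k) * (real (n + 2) powr (- Re s) * 2 powr (Re s - (Re s + real k)))"
      unfolding R_def
      by (intro mult_mono divide_right_mono norm_pochhammer_le nat_powr_le divide_nonneg_nonneg pochhammer_nonneg') auto
    also have "2 powr (Re s - (Re s + real k)) = (1/2 :: real) ^ k"
      using two_powr_minus[of k] by simp
    finally show ?thesis by (simp add: mult_ac)
  qed
  have abs: "(\<lambda>x. norm (case x of (n, k) \<Rightarrow> a n k)) summable_on (UNIV \<times> UNIV)"
  proof (rule summable_on_comparison_test[where f = "\<lambda>(n, k). real (n + 2) powr (- Re s) * (pochhammer R (Suc k) / fact (Suc k) * (1/2) ^ k)"])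
    have sk: "summable (\<lambda>k. pochhammer R (Suc k) / fact (Suc k) * (1/2) ^ k)"
    proof -
      have "summable (\<lambda>k. 2 * (pochhammer R (Suc k) / fact (Suc k) * (1/2) ^ Suc k))"
        using sums_summable[OF pochhammer_half_sums[of R]] by (intro summable_mult) (subst summable_Suc_iff)
      moreover have "2 * (pochhammer R (Suc k) / fact (Suc k) * (1/2) ^ Suc k) =
          pochhammer R (Suc k) / fact (Suc k) * (1/2 :: real) ^ k" for k
        by (simp del: fact_Suc)
      ultimately show ?thesis by (simp only:)
    qed
    define S where "S = (\<Sum>k. pochhammer R (Suc k) / fact (Suc k) * (1/2 :: real) ^ k)"
    have R0: "R \<ge> 0" by (simp add: R_def)
    show "(\<lambda>(n, k). real (n + 2) powr (- Re s) * (pochhammer R (Suc k) / fact (Suc k) * (1/2) ^ k)) summable_on UNIV \<times> UNIV"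
    proof (rule summable_on_SigmaI[where g = "\<lambda>n. real (n + 2) powr (- Re s) * S"])
      show "((\<lambda>k. case (n, k) of (n, k) \<Rightarrow> real (n + 2) powr (- Re s) * (pochhammer R (Suc k) / fact (Suc k) * (1/2) ^ k)) has_sum
             real (n + 2) powr (- Re s) * S) UNIV" for n
      proof -
        have "(\<lambda>k. real (n + 2) powr (- Re s) * (pochhammer R (Suc k) / fact (Suc k) * (1/2) ^ k))
            sums (real (n + 2) powr (- Re s) * S)"
          unfolding S_def by (intro sums_mult summable_sums sk)
        then show ?thesis unfolding prod.case
          by (rule sums_nonneg_imp_has_sum)
            (use R0 in \<open>intro mult_nonneg_nonneg divide_nonneg_nonneg pochhammer_nonneg', auto\<close>)
      qed
      show "(\<lambda>n. real (n + 2) powr (- Re s) * S) summable_on UNIV"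
        using summable_nat_powr[OF s] by (intro summable_on_cmult_left summable_nonneg_imp_summable_on) auto
    qed (use R0 in \<open>auto intro!: mult_nonneg_nonneg divide_nonneg_nonneg pochhammer_nonneg' simp del: fact_Suc\<close>)
  qed (use na in auto)
  then have sm: "(\<lambda>(n, k). a n k) summable_on (UNIV \<times> UNIV)"
    by (rule Infinite_Sum.abs_summable_summable)
  have sm': "(\<lambda>x. norm (case x of (k, n) \<Rightarrow> a n k)) summable_on (UNIV \<times> UNIV)"
    using abs summable_on_reindex[of prod.swap "UNIV \<times> UNIV" "\<lambda>x. norm (case x of (n, k) \<Rightarrow> a n k)"]
    by (simp add: case_prod_unfold o_def product_swap)
  have an: "(\<lambda>k. norm (a n k)) summable_on UNIV" for n
    using abs unfolding Infinite_Sum.abs_summable_on_Sigma_iff by auto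
  have ak: "(\<lambda>n. norm (a n k)) summable_on UNIV" for k
    using sm' unfolding Infinite_Sum.abs_summable_on_Sigma_iff by auto
  have in1: "infsum (\<lambda>k. a n k) UNIV = of_nat (n + 1) powr (1 - s) - of_nat (n + 2) powr (1 - s)" for n
    using has_sum_imp_sums[OF has_sum_infsum[OF Infinite_Sum.abs_summable_summable[OF an[of n]]]] inner[of n]
    by (rule sums_unique2)
  have in2: "infsum (\<lambda>n. a n k) UNIV = pochhammer (s - 1) (Suc k) / fact (Suc k) * zeta_tail (s + of_nat k)" for k
  proof -
    have "(\<lambda>n. a n k) sums infsum (\<lambda>n. a n k) UNIV"
      by (rule has_sum_imp_sums[OF has_sum_infsum[OF Infinite_Sum.abs_summable_summable[OF ak[of k]]]])
    moreover have "(\<lambda>n. a n k) sums (pochhammer (s - 1) (Suc k) / fact (Suc k) * zeta_tail (s + of_nat k))"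
      unfolding a_def zeta_tail_def using s
      by (intro sums_mult summable_sums summable_norm_cancel[OF summable_zeta_tail]) auto
    ultimately show ?thesis by (rule sums_unique2)
  qed
  have "infsum (\<lambda>n. infsum (\<lambda>k. a n k) UNIV) UNIV = 1"
  proof -
    have "(\<lambda>n. infsum (\<lambda>k. a n k) UNIV) summable_on UNIV"
      using sm summable_on_Sigma_banach by fastforce
    then have "(\<lambda>n. infsum (\<lambda>k. a n k) UNIV) sums infsum (\<lambda>n. infsum (\<lambda>k. a n k) UNIV) UNIV"
      by (meson has_sum_imp_sums has_sum_infsum)
    then show ?thesis using tele unfolding in1 by (rule sums_unique2)
  qed
  then have "infsum (\<lambda>k. infsum (\<lambda>n. a n k) UNIV) UNIV = 1"
    using infsum_swap_banach[OF sm] by simp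
  moreover have "(\<lambda>k. infsum (\<lambda>n. a n k) UNIV) summable_on UNIV"
    using Infinite_Sum.abs_summable_summable[OF sm'] summable_on_Sigma_banach[of "\<lambda>k n. a n k" UNIV "\<lambda>_. UNIV"] by simp
  ultimately have "(\<lambda>k. infsum (\<lambda>n. a n k) UNIV) sums 1"
    by (metis has_sum_imp_sums has_sum_infsum)
  then show ?thesis unfolding in2 .
qed

text \<open>
  Read from right to left, \<open>landau_identity\<close> expresses \<open>(s - 1) * zeta_tail s\<close> through values at
  \<open>s + 1, s + 2, \<dots>\<close>; iterating it continues the function one unit strip at a time.
\<close>

definition landau_coeff :: "nat \<Rightarrow> complex \<Rightarrow> complex" where
  "landau_coeff k s = pochhammer (s - 1) (Suc k) / fact (k + 2)"

definition landau_step :: "(complex \<Rightarrow> complex) \<Rightarrow> complex \<Rightarrow> complex" where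
  "landau_step f s = 1 - (\<Sum>k. landau_coeff k s * f (s + of_nat (k + 1)))"

text \<open>The last factor s + k of \<open>pochhammer (s - 1) (k + 2)\<close> is the factor that
  \<open>(s - 1) * zeta_tail s\<close> carries at s + k + 1. So the term k = 0 of
  \<open>landau_identity\<close> is the value at s, and the remaining terms form the series of
  \<open>landau_step\<close>.\<close>

lemma landau_step_zeta_tail:
  assumes s: "Re s > 1"
  shows "landau_step (\<lambda>s. (s - 1) * zeta_tail s) s = (s - 1) * zeta_tail s"
proof -
  have "landau_coeff k s * ((s + of_nat (k + 1) - 1) * zeta_tail (s + of_nat (k + 1))) =
        pochhammer (s - 1) (Suc (Suc k)) / fact (Suc (Suc k)) * zeta_tail (s + of_nat (Suc k))" for k
  proof -
    have "pochhammer (s - 1) (Suc (Suc k)) = pochhammer (s - 1) (Suc k) * (s + of_nat (k + 1) - 1)"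
      by (subst pochhammer_Suc) (simp add: algebra_simps)
    then show ?thesis by (simp add: landau_coeff_def del: fact_Suc)
  qed
  moreover have "(\<lambda>k. pochhammer (s - 1) (Suc (Suc k)) / fact (Suc (Suc k)) * zeta_tail (s + of_nat (Suc k)))
      sums (1 - (s - 1) * zeta_tail s)"
    using sums_split_initial_segment[OF landau_identity[OF s], of 1] by simp
  ultimately show ?thesis
    by (simp add: landau_step_def sums_iff)
qed

text \<open>R controls the Pochhammer symbol uniformly in s, while r keeps the shifted argument
  inside the region of convergence and leaves a power of 1/2 for the binomial majorant.\<close>

lemma norm_landau_term_le:
  assumes R: "norm (s - 1) \<le> R" and r: "1 < r" "r \<le> Re s + real (k + 1)"
  shows "norm (landau_coeff k s * ((s + of_nat (k + 1) - 1) * zeta_tail (s + of_nat (k + 1))))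
           \<le> (\<Sum>n. real (n + 2) powr (- r)) * 2 powr (r - Re s + 1) *
              (pochhammer R (k + 2) / fact (k + 2) * (1 / 2) ^ (k + 2))"
proof -
  define K where "K = (\<Sum>n. real (n + 2) powr (- r))"
  have R0: "0 \<le> R" using R norm_ge_zero order_trans by blast
  have "pochhammer (s - 1) (k + 2) = pochhammer (s - 1) (Suc k) * (s + of_nat (k + 1) - 1)"
    by (simp add: pochhammer_Suc numeral_2_eq_2 algebra_simps)
  then have "landau_coeff k s * ((s + of_nat (k + 1) - 1) * zeta_tail (s + of_nat (k + 1))) =
      pochhammer (s - 1) (k + 2) / fact (k + 2) * zeta_tail (s + of_nat (k + 1))"
    by (simp add: landau_coeff_def del: fact_Suc)
  also have "norm \<dots> = norm (pochhammer (s - 1) (k + 2)) / fact (k + 2) * norm (zeta_tail (s + of_nat (k + 1)))"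
    by (simp add: norm_mult norm_divide del: fact_Suc)
  also have "\<dots> \<le> pochhammer R (k + 2) / fact (k + 2) * (K * 2 powr (r - Re (s + of_nat (k + 1))))"
    unfolding K_def using r R R0
    by (intro mult_mono divide_right_mono norm_zeta_tail_le order_trans[OF norm_pochhammer_le]
        pochhammer_mono divide_nonneg_nonneg pochhammer_nonneg') auto
  also have "2 powr (r - Re (s + of_nat (k + 1))) = 2 powr (r - Re s + 1) * 2 powr (- real (k + 2))"
    by (simp flip: powr_add add: algebra_simps)
  also have "2 powr (- real (k + 2)) = (1 / 2 :: real) ^ (k + 2)"
    by (rule two_powr_minus)
  finally show ?thesis by (simp add: K_def mult_ac)
qed

lemma summable_pochhammer_half: "summable (\<lambda>k. pochhammer R (k + 2) / fact (k + 2) * (1 / 2 :: real) ^ (k + 2))"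
  using summable_ignore_initial_segment[OF sums_summable[OF pochhammer_half_sums[of R]], of 2] .

text \<open>On a disc only finitely many shifts s + k + 1 leave the half-plane of absolute
  convergence. For those terms holomorphy of f is enough; from k = N + 1 on, the real part of the
  shift exceeds 2 and the explicit tail supplies a uniform majorant.\<close>

lemma landau_step_holomorphic:
  assumes f: "f holomorphic_on {s. Re s > 1 - real N}"
    and eq: "\<And>s. Re s > 1 \<Longrightarrow> f s = (s - 1) * zeta_tail s"
  shows "landau_step f holomorphic_on {s. Re s > - real N}"
  unfolding landau_step_def
proof (intro holomorphic_intros, rule holomorphic_uniform_sequence)
  let ?S = "{s. Re s > - real N}"
  show "open ?S" by (rule open_halfspace_Re_gt)
  show "(\<lambda>s. \<Sum>k<n. landau_coeff k s * f (s + of_nat (k + 1))) holomorphic_on ?S" for n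
    unfolding landau_coeff_def
    by (intro holomorphic_intros holomorphic_on_compose_gen[OF _ f, unfolded o_def]) auto
  fix x assume x: "x \<in> ?S"
  define d where "d = (Re x + real N) / 2"
  define R where "R = norm (x - 1) + d"
  have d: "d > 0" using x by (simp add: d_def)
  have ge: "Re x - d \<le> Re y" if "y \<in> cball x d" for y
    using that abs_Re_le_cmod[of "x - y"] by (auto simp: dist_norm)
  have sub: "cball x d \<subseteq> ?S"
  proof
    fix y assume "y \<in> cball x d"
    from ge[OF this] x show "y \<in> ?S" by (simp add: d_def field_simps)
  qed
  define K where "K = (\<Sum>n. real (n + 2) powr (- 2)) * 2 powr (3 + real N)"
  have "uniform_limit (cball x d) (\<lambda>n s. \<Sum>k<n. landau_coeff k s * f (s + of_nat (k + 1)))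
          (\<lambda>s. \<Sum>k. landau_coeff k s * f (s + of_nat (k + 1))) sequentially"
  proof (rule Weierstrass_m_test_ev)
    show "summable (\<lambda>k. K * (pochhammer R (k + 2) / fact (k + 2) * (1 / 2) ^ (k + 2)))"
      by (intro summable_mult summable_pochhammer_half)
    have "norm (landau_coeff k y * f (y + of_nat (k + 1))) \<le>
        K * (pochhammer R (k + 2) / fact (k + 2) * (1 / 2) ^ (k + 2))"
      if "k \<ge> N + 1" "y \<in> cball x d" for k y
    proof -
      have y: "Re y > - real N" using sub that by auto
      have R: "norm (y - 1) \<le> R"
        using that(2) norm_triangle_ineq[of "x - 1" "y - x"] by (simp add: R_def dist_norm norm_minus_commute)
      have "f (y + of_nat (k + 1)) = (y + of_nat (k + 1) - 1) * zeta_tail (y + of_nat (k + 1))"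
        using y that by (intro eq) simp
      moreover have "norm (landau_coeff k y * ((y + of_nat (k + 1) - 1) * zeta_tail (y + of_nat (k + 1)))) \<le>
          (\<Sum>n. real (n + 2) powr (- 2)) * 2 powr (2 - Re y + 1) *
              (pochhammer R (k + 2) / fact (k + 2) * (1 / 2) ^ (k + 2))"
        using y that R by (intro norm_landau_term_le) auto
      moreover have "\<dots> \<le> K * (pochhammer R (k + 2) / fact (k + 2) * (1 / 2) ^ (k + 2))"
        unfolding K_def using y order_trans[OF norm_ge_zero R]
        by (intro mult_right_mono mult_left_mono powr_mono suminf_nonneg summable_nat_powr
            mult_nonneg_nonneg divide_nonneg_nonneg pochhammer_nonneg') auto
      ultimately show ?thesis by simp
    qed
    then show "\<forall>\<^sub>F k in sequentially. \<forall>y\<in>cball x d. norm (landau_coeff k y * f (y + of_nat (k + 1))) \<le>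
        K * (pochhammer R (k + 2) / fact (k + 2) * (1 / 2) ^ (k + 2))"
      unfolding eventually_sequentially by blast
  qed
  then show "\<exists>d>0. cball x d \<subseteq> ?S \<and> uniform_limit (cball x d)
      (\<lambda>n s. \<Sum>k<n. landau_coeff k s * f (s + of_nat (k + 1)))
          (\<lambda>s. \<Sum>k. landau_coeff k s * f (s + of_nat (k + 1))) sequentially"
    using d sub by blast
qed

section \<open>Continuation to the plane and identification with \<open>zeta\<close>\<close>

lemma zeta_tail_continuation_halfplane:
  "\<exists>f. f holomorphic_on {s. Re s > 1 - real N} \<and> (\<forall>s. Re s > 1 \<longrightarrow> f s = (s - 1) * zeta_tail s)"
proof (induction N)
  case 0
  show ?case
    by (intro exI[of _ "\<lambda>s. (s - 1) * zeta_tail s"] conjI holomorphic_intros)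
      (auto intro!: zeta_tail_holomorphic)
next
  case (Suc N)
  then obtain f where f: "f holomorphic_on {s. Re s > 1 - real N}"
    "\<And>s. Re s > 1 \<Longrightarrow> f s = (s - 1) * zeta_tail s" by blast
  have "landau_step f s = (s - 1) * zeta_tail s" if "Re s > 1" for s
  proof -
    have "landau_step f s = landau_step (\<lambda>s. (s - 1) * zeta_tail s) s"
      unfolding landau_step_def using that by (subst f(2)) auto
    then show ?thesis using landau_step_zeta_tail[OF that] by simp
  qed
  then show ?case
    using landau_step_holomorphic[OF f] by (intro exI[of _ "landau_step f"]) simp
qed

lemma halfplane_eqI:
  assumes "f holomorphic_on {s. Re s > a}" "g holomorphic_on {s. Re s > a}"
    and "\<And>s. Re s > 1 \<Longrightarrow> f s = g s" and "Re s > a"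
  shows "f s = g s"
proof (rule analytic_continuation_open[of "{s. Re s > max a 1}" "{s. Re s > a}" f g])
  show "open {s. max a 1 < Re s}" by (rule open_halfspace_Re_gt)
  show "{s. max a 1 < Re s} \<noteq> {}"
    by (auto intro!: exI[of _ "of_real (max a 1 + 1)"])
qed (use assms in \<open>auto simp: open_halfspace_Re_gt intro: convex_connected convex_halfspace_Re_gt\<close>)

lemma zeta_tail_continuation:
  obtains E where "E holomorphic_on UNIV" "\<And>s. Re s > 1 \<Longrightarrow> E s = (s - 1) * zeta_tail s"
proof -
  from zeta_tail_continuation_halfplane obtain F where
    F: "\<And>N. F N holomorphic_on {s. Re s > 1 - real N}"
       "\<And>N s. Re s > 1 \<Longrightarrow> F N s = (s - 1) * zeta_tail s"
    by metis
  \<comment> \<open>The index is large enough for s to lie in the half-plane of that continuation.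
    By the identity theorem any admissible index gives the same value, so E inherits holomorphy from
    every \<open>F N\<close>.\<close>
  define E where "E s = F (nat \<lceil>2 - Re s\<rceil>) s" for s
  have eq: "E s = F N s" if "Re s > 1 - real N" for N s
  proof -
    define M where "M = nat \<lceil>2 - Re s\<rceil>"
    have M: "Re s > 1 - real M" unfolding M_def by linarith
    have "F (min M N) s = F L s" if "L = M \<or> L = N" for L
    proof (rule halfplane_eqI[where f = "F (min M N)" and g = "F L" and a = "1 - real (min M N)"])
      show "F L holomorphic_on {s. 1 - real (min M N) < Re s}"
        by (rule holomorphic_on_subset[OF F(1)]) (use that in auto)
    qed (use F M \<open>Re s > 1 - real N\<close> in \<open>auto simp: min_def\<close>)
    from this[of M] this[of N] show ?thesis by (simp add: E_def M_def)
  qed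
  have "E field_differentiable (at s)" for s
  proof -
    define N where "N = nat \<lceil>2 - Re s\<rceil>"
    have N: "Re s > 1 - real N" unfolding N_def by linarith
    have "E holomorphic_on {s. Re s > 1 - real N}"
      by (rule holomorphic_transform[OF F(1)]) (use eq in auto)
    then show ?thesis
      using N by (rule_tac holomorphic_on_imp_differentiable_at) (auto simp: open_halfspace_Re_gt)
  qed
  then have "E holomorphic_on UNIV" by (auto simp: holomorphic_on_def)
  moreover have "E s = (s - 1) * zeta_tail s" if "Re s > 1" for s
    using eq[of 0 s] F(2) that by simp
  ultimately show ?thesis by (rule that)
qed

lemma holomorphic_on_cnj_cnj:
  assumes f: "f holomorphic_on S" and S: "open S"
  shows "(\<lambda>z. cnj (f (cnj z))) holomorphic_on (cnj ` S)"
proof -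
  have "(cnj \<circ> f \<circ> cnj has_field_derivative cnj (deriv f z)) (at (cnj z))" if "z \<in> S" for z
    using has_field_derivative_cnj_cnj[of f "deriv f z" "cnj z"] holomorphic_derivI[OF f S that] by simp
  then have "(\<lambda>w. cnj (f (cnj w))) field_differentiable (at (cnj z))" if "z \<in> S" for z
    using that unfolding field_differentiable_def o_def by blast
  then show ?thesis
    by (auto simp: holomorphic_on_def intro: field_differentiable_at_within)
qed

lemma zeta_series_eq:
  assumes "Re s > 1"
  shows "(\<Sum>n. of_nat (Suc n) powr (- s)) = 1 + zeta_tail s"
proof -
  have *: "summable (\<lambda>n. of_nat (n + 2) powr (- s) :: complex)"
    using summable_zeta_tail[OF assms] by (rule summable_norm_cancel)
  then have "summable (\<lambda>n. of_nat (Suc n) powr (- s) :: complex)"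
    by (subst summable_Suc_iff[symmetric]) (simp add: add.commute)
  from suminf_split_head[OF this] show ?thesis
    by (simp add: zeta_tail_def add.commute)
qed

text \<open>The description determines one function: the punctured plane is connected, so the
  Dirichlet series fixes the continuation there, and the value at 1 is prescribed.\<close>

lemma zeta_properties:
  "zeta holomorphic_on (- {1})" "\<And>s. Re s > 1 \<Longrightarrow> zeta s = 1 + zeta_tail s"
proof -
  let ?P = "\<lambda>f. f holomorphic_on (- {1}) \<and> f 1 = 0 \<and>
             (\<forall>s. Re s > 1 \<longrightarrow> f s = (\<Sum>n. of_nat (Suc n) powr (- s)))"
  obtain E where E: "E holomorphic_on UNIV" "\<And>s. Re s > 1 \<Longrightarrow> E s = (s - 1) * zeta_tail s"
    using zeta_tail_continuation by blast
  have ex: "?P (\<lambda>s. if s = 1 then 0 else 1 + E s / (s - 1))"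
  proof (intro conjI allI impI)
    have "(\<lambda>s. 1 + E s / (s - 1)) holomorphic_on - {1}"
      by (intro holomorphic_intros holomorphic_on_subset[OF E(1)]) auto
    then show "(\<lambda>s. if s = 1 then 0 else 1 + E s / (s - 1)) holomorphic_on - {1}"
      by (rule holomorphic_transform) auto
  qed (use E zeta_series_eq in auto)
  have "?P zeta"
    unfolding zeta_def
  proof (rule theI[where P = ?P, OF ex])
    fix g assume g: "?P g"
    show "g = (\<lambda>s. if s = 1 then 0 else 1 + E s / (s - 1))" (is "g = ?h")
    proof
      fix s
      show "g s = ?h s"
      proof (cases "s = 1")
        case False
        show ?thesis
        proof (rule analytic_continuation_open[of "{s. Re s > 1}" "- {1}" g ?h])
          show "{s. 1 < Re s} \<noteq> {}" by (auto intro!: exI[of _ "2"])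
          show "connected (- {1 :: complex})" by (intro connected_punctured_universe) simp
        qed (use g ex False in \<open>auto simp: open_halfspace_Re_gt\<close>)
      qed (use g in simp)
    qed
  qed
  then show "zeta holomorphic_on (- {1})" "\<And>s. Re s > 1 \<Longrightarrow> zeta s = 1 + zeta_tail s"
    using zeta_series_eq by auto
qed

text \<open>E is a fixed point of \<open>landau_step\<close> by the identity theorem. For Re s \<ge>
  1/4 every shifted argument has real part at least 5/4, so the fixed-point equation bounds E by a
  convergent tail times the binomial series.\<close>

lemma zeta_entire_part:
  obtains E K where "E holomorphic_on UNIV" "\<And>s. s \<noteq> 1 \<Longrightarrow> zeta s = 1 + E s / (s - 1)" "E 1 = 1"
    "K \<ge> 0" "\<And>s. Re s \<ge> 1 / 4 \<Longrightarrow> norm (E s) \<le> 1 + K * 2 powr norm (s - 1)"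
proof -
  obtain E where E: "E holomorphic_on UNIV" "\<And>s. Re s > 1 \<Longrightarrow> E s = (s - 1) * zeta_tail s"
    using zeta_tail_continuation by blast
  have step: "landau_step E s = E s" for s
  proof -
    obtain N where "- Re s < real N" using reals_Archimedean2 by blast
    then have N: "Re s > - real N" by simp
    show ?thesis
    proof (rule halfplane_eqI[where f = "landau_step E" and g = E and a = "- real N"])
      show "landau_step E holomorphic_on {s. - real N < Re s}"
        by (rule landau_step_holomorphic[OF holomorphic_on_subset[OF E(1)] E(2)]) auto
      fix s :: complex assume s: "Re s > 1"
      have "landau_step E s = landau_step (\<lambda>s. (s - 1) * zeta_tail s) s"
        unfolding landau_step_def using s by (subst E(2)) auto
      then show "landau_step E s = E s" using landau_step_zeta_tail[OF s] E(2)[OF s] by simp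
    qed (use N holomorphic_on_subset[OF E(1)] in auto)
  qed
  have z: "zeta s = 1 + E s / (s - 1)" if "s \<noteq> 1" for s
  proof (rule analytic_continuation_open[of "{s. Re s > 1}" "- {1}" zeta "\<lambda>s. 1 + E s / (s - 1)"])
    show "{s. 1 < Re s} \<noteq> {}" by (auto intro!: exI[of _ "2"])
    show "connected (- {1 :: complex})" by (intro connected_punctured_universe) simp
    show "(\<lambda>s. 1 + E s / (s - 1)) holomorphic_on - {1}"
      by (intro holomorphic_intros holomorphic_on_subset[OF E(1)]) auto
    show "zeta z = 1 + E z / (z - 1)" if "z \<in> {s. 1 < Re s}" for z
    proof -
      have "z \<noteq> 1" "Re z > 1" using that by auto
      then show ?thesis using zeta_properties(2)[of z] E(2)[of z] by simp
    qed
  qed (use that in \<open>auto simp: open_halfspace_Re_gt zeta_properties\<close>)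
  \<comment> \<open>At s = 1 every coefficient contains the factor s - 1 and vanishes; the value 1
    is the residue of \<open>zeta\<close>.\<close>
  have E1: "E 1 = 1"
    unfolding step[of 1, symmetric] by (simp add: landau_step_def landau_coeff_def pochhammer_rec)
  define K where "K = (\<Sum>n. real (n + 2) powr (- (5/4))) * 2 powr 2"
  have K: "K \<ge> 0" unfolding K_def
    by (intro mult_nonneg_nonneg suminf_nonneg summable_nat_powr) auto
  have "norm (E s) \<le> 1 + K * 2 powr norm (s - 1)" if s: "Re s \<ge> 1 / 4" for s
  proof -
    define R where "R = norm (s - 1)"
    define t where "t k = landau_coeff k s * E (s + of_nat (k + 1))" for k
    define u where "u k = K * (pochhammer R (k + 2) / fact (k + 2) * (1 / 2) ^ (k + 2))" for k
    have le: "norm (t k) \<le> u k" for k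
    proof -
      have "t k = landau_coeff k s * ((s + of_nat (k + 1) - 1) * zeta_tail (s + of_nat (k + 1)))"
        unfolding t_def using s by (subst E(2)) auto
      moreover have "norm \<dots> \<le> (\<Sum>n. real (n + 2) powr (- (5/4))) * 2 powr (5/4 - Re s + 1) *
              (pochhammer R (k + 2) / fact (k + 2) * (1 / 2) ^ (k + 2))"
        by (intro norm_landau_term_le) (use s in \<open>auto simp: R_def\<close>)
      moreover have "\<dots> \<le> u k"
        unfolding u_def K_def using s
        by (intro mult_right_mono mult_left_mono powr_mono suminf_nonneg summable_nat_powr
            mult_nonneg_nonneg divide_nonneg_nonneg pochhammer_nonneg') (auto simp: R_def)
      ultimately show ?thesis by simp
    qed
    have su: "summable u" unfolding u_def by (intro summable_mult summable_pochhammer_half)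
    have st: "summable (\<lambda>k. norm (t k))" by (rule summable_comparison_test[OF _ su]) (use le in auto)
    have "norm (\<Sum>k. t k) \<le> (\<Sum>k. norm (t k))" by (rule summable_norm[OF st])
    also have "\<dots> \<le> (\<Sum>k. u k)" by (intro suminf_le st su le)
    also have "\<dots> = K * (\<Sum>k. pochhammer R (k + 2) / fact (k + 2) * (1 / 2) ^ (k + 2))"
      unfolding u_def by (intro suminf_mult summable_pochhammer_half)
    also have "(\<Sum>k. pochhammer R (k + 2) / fact (k + 2) * (1 / 2) ^ (k + 2)) \<le> 2 powr R"
    proof -
      have "(\<Sum>k. pochhammer R (k + 2) / fact (k + 2) * (1 / 2) ^ (k + 2)) =
        2 powr R - (\<Sum>k<2. pochhammer R k / fact k * (1 / 2) ^ k)"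
        using sums_split_initial_segment[OF pochhammer_half_sums[of R], of 2] by (simp add: sums_iff)
      moreover have "(\<Sum>k<2. pochhammer R k / fact k * (1 / 2) ^ k) \<ge> 0"
        by (intro sum_nonneg mult_nonneg_nonneg divide_nonneg_nonneg pochhammer_nonneg') (auto simp: R_def)
      ultimately show ?thesis by simp
    qed
    finally have "norm (\<Sum>k. t k) \<le> K * 2 powr R" using K by (simp add: mult_left_mono)
    moreover have "E s = 1 - (\<Sum>k. t k)" using step[of s] by (simp add: landau_step_def t_def)
    ultimately show ?thesis using norm_triangle_ineq4[of 1 "\<Sum>k. t k"] by (simp add: R_def)
  qed
  then show ?thesis using that[OF E(1) z E1 K] by blast
qed

section \<open>Size of \<open>zeta\<close> and finiteness of its zeros\<close>

text \<open>Exponential growth is far from sharp, but its logarithm is O(norm s), which suffices for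
  argument increments of size O(h) at height h.\<close>

lemma zeta_growth:
  obtains C where "C > 0" "\<And>s. Re s \<ge> 1 / 4 \<Longrightarrow> \<bar>Im s\<bar> \<ge> 1 \<Longrightarrow> norm (zeta s) \<le> C * 2 powr norm s"
proof -
  obtain E K where E: "\<And>s. s \<noteq> 1 \<Longrightarrow> zeta s = 1 + E s / (s - 1)"
    "K \<ge> 0" "\<And>s. Re s \<ge> 1 / 4 \<Longrightarrow> norm (E s) \<le> 1 + K * 2 powr norm (s - 1)"
    using zeta_entire_part by metis
  have "norm (zeta s) \<le> (2 + 2 * K) * 2 powr norm s" if s: "Re s \<ge> 1 / 4" "\<bar>Im s\<bar> \<ge> 1" for s
  proof -
    have s1: "s \<noteq> 1" using s by auto
    have n1: "norm (s - 1) \<ge> 1" using abs_Im_le_cmod[of "s - 1"] s by simp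
    have "norm (zeta s) \<le> 1 + norm (E s) / norm (s - 1)"
      unfolding E(1)[OF s1] by (metis norm_divide norm_one norm_triangle_ineq)
    also have "norm (E s) / norm (s - 1) \<le> norm (E s) / 1"
      using n1 by (intro divide_left_mono) auto
    also have "norm (E s) / 1 \<le> 1 + K * 2 powr norm (s - 1)" using E(3) s by simp
    finally have 1: "norm (zeta s) \<le> 2 + K * 2 powr norm (s - 1)" by simp
    have "2 powr norm (s - 1) \<le> 2 powr (norm s + 1)"
      using norm_triangle_ineq4[of s 1] by (intro powr_mono) auto
    then have "K * 2 powr norm (s - 1) \<le> K * (2 * 2 powr norm s)"
      using E(2) by (intro mult_left_mono) (auto simp: powr_add)
    moreover have "1 \<le> 2 powr norm s" by (rule ge_one_powr_ge_zero) auto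
    moreover have "(2 + 2 * K) * 2 powr norm s = 2 * 2 powr norm s + K * (2 * 2 powr norm s)"
      by (simp add: distrib_right)
    ultimately show ?thesis using 1 by linarith
  qed
  then show ?thesis using that[of "2 + 2 * K"] E(2) by simp
qed

text \<open>The integer 2 contributes 1/8; the integers m \<ge> 3 contribute at most 1/4 by
  comparing the cube of m with a telescoping series. The value 3/8 < 1/2 keeps \<open>zeta\<close>
  and the mollifiers so close to 1 on Re s \<ge> 3 that a principal logarithm is available; the line
  Re s = 3 is chosen for this.\<close>

lemma suminf_nat_powr_3_le: "(\<Sum>n. real (n + 2) powr (- 3)) \<le> 3 / 8"
proof -
  have tele: "(\<lambda>n. 1 / real (n + 2) - 1 / real (Suc n + 2)) sums (1 / real (0 + 2) - 0)"
    by (rule telescope_sums') real_asymp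
  have s: "summable (\<lambda>n. real (n + 2) powr (- 3))" by (rule summable_nat_powr) simp
  have "(\<Sum>n. real (Suc n + 2) powr (- 3)) \<le> (\<Sum>n. 1 / 2 * (1 / real (n + 2) - 1 / real (Suc n + 2)))"
  proof (intro suminf_le summable_mult sums_summable[OF tele])
    show "summable (\<lambda>n. real (Suc n + 2) powr (- 3))"
      using s summable_Suc_iff[of "\<lambda>n. real (n + 2) powr (- 3)"] by blast
    fix n
    have "2 * (2 + real n) * (3 + real n) \<le> (3 + real n) ^ 3"
      by (simp add: power3_eq_cube algebra_simps)
    then have "1 / (3 + real n) ^ 3 \<le> 1 / (2 * (2 + real n) * (3 + real n))"
      by (intro divide_left_mono) auto
    moreover have "real (Suc n + 2) powr (- 3) = 1 / (3 + real n) ^ 3"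
      by (simp add: powr_minus powr_realpow[of _ 3, simplified] divide_inverse add_ac)
    moreover have "1 / 2 * (1 / real (n + 2) - 1 / real (Suc n + 2)) = 1 / (2 * (2 + real n) * (3 + real n))"
      by (simp add: field_simps)
    ultimately show "real (Suc n + 2) powr (- 3) \<le> 1 / 2 * (1 / real (n + 2) - 1 / real (Suc n + 2))"
      by simp
  qed
  also have "\<dots> = 1 / 4" using sums_mult[OF tele, of "1/2"] by (simp add: sums_iff)
  finally have "(\<Sum>n. real (n + 2) powr (- 3)) - real (0 + 2) powr (- 3) \<le> 1 / 4"
    using suminf_split_head[OF s] by simp
  then show ?thesis by (simp add: powr_minus)
qed

lemma norm_zeta_minus_1_le:
  assumes "Re s \<ge> 3"
  shows "norm (zeta s - 1) \<le> 3 * 2 powr (- Re s)"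
proof -
  have "norm (zeta s - 1) \<le> (\<Sum>n. real (n + 2) powr (- 3)) * 2 powr (3 - Re s)"
    using norm_zeta_tail_le[of 3 s] assms by (simp add: zeta_properties)
  also have "\<dots> \<le> 3 / 8 * 2 powr (3 - Re s)"
    by (intro mult_right_mono suminf_nat_powr_3_le) auto
  also have "\<dots> = 3 * 2 powr (- Re s)"
    by (simp add: powr_diff powr_minus_divide)
  finally show ?thesis .
qed

lemma finite_zeta_zeros: "finite {s. zeta s = 0 \<and> s \<noteq> 1 \<and> s \<in> cball 0 r}"
proof -
  obtain E :: "complex \<Rightarrow> complex" where E: "E holomorphic_on UNIV" "\<And>s. s \<noteq> 1 \<Longrightarrow> zeta s = 1 + E s / (s - 1)" "E 1 = 1"
    using zeta_entire_part by metis
  let ?g = "\<lambda>s. s - 1 + E s"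
  have "finite {z \<in> cball 0 r. ?g z = 0}"
  proof (rule holomorphic_compact_finite_zeros[of _ UNIV])
    show "\<not> ?g constant_on UNIV"
    proof
      \<comment> \<open>The constant would be the value 1 at s = 1, so \<open>zeta 4\<close> would
        be 1/3, too far from 1 for the estimate on Re s \<ge> 3.\<close>
      assume "?g constant_on UNIV"
      then have "?g s = ?g 1" for s unfolding constant_on_def by (metis UNIV_I)
      then have g: "s - 1 + E s = 1" for s using E(3) by simp
      have "zeta 4 = 1 / 3" using g[of 4] E(2)[of 4] by (simp add: field_simps)
      moreover have "norm (zeta 4 - 1) \<le> 3 * 2 powr (- 4)"
        using norm_zeta_minus_1_le[of 4] by simp
      moreover have "zeta 4 - 1 = - (2 / 3)" unfolding calculation(1) by (simp add: field_simps)
      ultimately show False by (simp add: powr_minus norm_divide)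
    qed
  qed (auto intro!: holomorphic_intros E)
  moreover have "?g s = 0" if "zeta s = 0" "s \<noteq> 1" for s
    using that E(2)[of s] by (auto simp: field_simps add_eq_0_iff)
  ultimately show ?thesis by (auto elim!: finite_subset[rotated])
qed

lemma zeta_cnj: "zeta (cnj s) = cnj (zeta s)" if "s \<noteq> 1"
proof -
  have im: "cnj ` (- {1}) = - {1}"
  proof (intro equalityI subsetI)
    fix z :: complex assume "z \<in> - {1}"
    then have "cnj z \<in> - {1}" "z = cnj (cnj z)" by auto
    then show "z \<in> cnj ` (- {1})" by blast
  qed auto
  have h: "(\<lambda>z. cnj (zeta (cnj z))) holomorphic_on - {1}"
    using holomorphic_on_cnj_cnj[OF zeta_properties(1)] im by auto
  have "cnj (zeta (cnj s)) = zeta s"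
  proof (rule analytic_continuation_open[of "{s. Re s > 1}" "- {1}" "\<lambda>z. cnj (zeta (cnj z))" zeta])
    show "{s. 1 < Re s} \<noteq> {}" by (auto intro!: exI[of _ "2"])
    show "connected (- {1 :: complex})" by (intro connected_punctured_universe) simp
    fix z assume z: "z \<in> {s. 1 < Re s}"
    have "summable (\<lambda>n. of_nat (n + 2) powr (- cnj z) :: complex)"
      by (rule summable_norm_cancel[OF summable_zeta_tail]) (use z in auto)
    then have "cnj (zeta_tail (cnj z)) = (\<Sum>n. cnj (of_nat (n + 2) powr (- cnj z)))"
      unfolding zeta_tail_def by (metis sums_cnj summable_sums sums_unique)
    also have "\<dots> = zeta_tail z"
      unfolding zeta_tail_def
    proof (intro suminf_cong)
      fix n
      show "cnj (of_nat (n + 2) powr (- cnj z)) = of_nat (n + 2) powr (- z)"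
        by (subst cnj_powr) (simp_all del: of_nat_add)
    qed
    finally show "cnj (zeta (cnj z)) = zeta z" using z by (simp add: zeta_properties)
  qed (use h that in \<open>auto simp: open_halfspace_Re_gt zeta_properties\<close>)
  then show ?thesis by (metis complex_cnj_cnj)
qed

section \<open>Continuous arguments and zeros\<close>

text \<open>Off a finite set g takes values in the multiples of pi, hence everywhere by continuity,
  and a continuous function with discrete range on an interval is constant. The exceptional set
  makes room for zeros lying on a segment.\<close>

lemma sin_zero_imp_constant:
  fixes g :: "real \<Rightarrow> real"
  assumes cont: "continuous_on {a..b} g" and F: "finite F"
    and z: "\<And>t. t \<in> {a..b} - F \<Longrightarrow> sin (g t) = 0" and st: "s \<in> {a..b}" "t \<in> {a..b}"
  shows "g s = g t"
proof (cases "a < b")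
  case ab: True
  have z': "sin (g t) = 0" if t: "t \<in> {a..b}" for t
  proof (rule ccontr)
    assume nz: "sin (g t) \<noteq> 0"
    have "continuous_on {a..b} (\<lambda>t. sin (g t))" by (intro continuous_intros cont)
    then have "openin (top_of_set {a..b}) ({a..b} \<inter> (\<lambda>t. sin (g t)) -` (- {0}))"
      by (intro continuous_openin_preimage_gen) auto
    then obtain U where U: "open U" "{a..b} \<inter> (\<lambda>t. sin (g t)) -` (- {0}) = {a..b} \<inter> U"
      unfolding openin_open by blast
    have "t \<in> {a..b} \<inter> (\<lambda>t. sin (g t)) -` (- {0})" using nz t by simp
    then have "t \<in> U" unfolding U(2) by (rule IntD2)
    have "t \<in> closure {a<..<b}" using ab t by simp
    then have "U \<inter> {a<..<b} \<noteq> {}" using U(1) \<open>t \<in> U\<close> by (auto simp: closure_iff_nhds_not_empty)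
    moreover have "open (U \<inter> {a<..<b})" using U(1) by auto
    ultimately have "infinite (U \<inter> {a<..<b})" using finite_imp_not_open by blast
    moreover have "U \<inter> {a<..<b} \<subseteq> F"
    proof
      fix x assume "x \<in> U \<inter> {a<..<b}"
      then have "x \<in> {a..b} \<inter> U" by auto
      then have "x \<in> {a..b}" "sin (g x) \<noteq> 0" unfolding U(2)[symmetric] by auto
      then show "x \<in> F" using z by blast
    qed
    ultimately show False using F finite_subset by blast
  qed
  have "g constant_on {a..b}"
  proof (rule continuous_discrete_range_constant)
    fix x assume x: "x \<in> {a..b}"
    show "\<exists>e>0. \<forall>y. y \<in> {a..b} \<and> g y \<noteq> g x \<longrightarrow> e \<le> norm (g y - g x)"
    proof (intro exI[of _ pi] conjI allI impI)
      fix y assume y: "y \<in> {a..b} \<and> g y \<noteq> g x"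
      obtain i j :: int where "g x = of_int i * pi" "g y = of_int j * pi"
        using z'[OF x] z' y sin_zero_iff_int2 by metis
      then have "g y - g x = of_int (j - i) * pi" "j \<noteq> i" using y by (auto simp: algebra_simps)
      then have "norm (g y - g x) = \<bar>of_int (j - i)\<bar> * pi" "\<bar>of_int (j - i) :: real\<bar> \<ge> 1"
        by (auto simp: abs_mult simp flip: of_int_diff of_int_abs)
      then show "pi \<le> norm (g y - g x)" by simp
    qed simp
  qed (use cont in auto)
  then show ?thesis using st unfolding constant_on_def by metis
next
  case False
  then have "s = t" using st by simp
  then show ?thesis by simp
qed

text \<open>Two continuous phases differ by multiples of pi, hence by a constant. So exactly one
  number meets the description, and any continuous phase computes it.\<close>

lemma arg_increment_eqI:
  assumes cont: "continuous_on {0..1} \<phi>"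
    and rep: "\<And>u. u \<in> {0..1} \<Longrightarrow> f (linepath p q u) = of_real (norm (f (linepath p q u))) * cis (\<phi> u)"
    and nz: "\<And>u. u \<in> {0..1} \<Longrightarrow> f (linepath p q u) \<noteq> 0"
  shows "arg_increment f p q = \<phi> 1 - \<phi> 0"
  unfolding arg_increment_def
proof (rule the_equality)
  show "\<exists>\<psi>. continuous_on {0..1} \<psi> \<and>
        (\<forall>u\<in>{0..1}. f (linepath p q u) = of_real (norm (f (linepath p q u))) * cis (\<psi> u)) \<and>
        \<phi> 1 - \<phi> 0 = \<psi> 1 - \<psi> 0"
    using cont rep by blast
next
  fix d assume "\<exists>\<psi>. continuous_on {0..1} \<psi> \<and>
        (\<forall>u\<in>{0..1}. f (linepath p q u) = of_real (norm (f (linepath p q u))) * cis (\<psi> u)) \<and>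
        d = \<psi> 1 - \<psi> 0"
  then obtain \<psi> where \<psi>: "continuous_on {0..1} \<psi>" "d = \<psi> 1 - \<psi> 0"
    "\<And>u. u \<in> {0..1} \<Longrightarrow> f (linepath p q u) = of_real (norm (f (linepath p q u))) * cis (\<psi> u)"
    by blast
  have "sin (\<psi> u - \<phi> u) = 0" if u: "u \<in> {0..1}" for u
  proof -
    have "of_real (norm (f (linepath p q u))) * cis (\<psi> u) = of_real (norm (f (linepath p q u))) * cis (\<phi> u)"
      using rep[OF u] \<psi>(3)[OF u] by simp
    then have "cis (\<psi> u) = cis (\<phi> u)" using nz[OF u] by simp
    then show ?thesis by (simp add: complex_eq_iff sin_diff)
  qed
  then have "\<psi> 1 - \<phi> 1 = \<psi> 0 - \<phi> 0"
    by (intro sin_zero_imp_constant[of 0 1 "\<lambda>u. \<psi> u - \<phi> u" "{}"] continuous_intros \<psi> cont) auto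
  then show "d = \<phi> 1 - \<phi> 0" using \<psi>(2) by simp
qed

section \<open>Phase increments and sign changes of the real part\<close>

text \<open>An increment above pi would, by the intermediate value theorem, give two interior points
  whose phases differ by exactly pi; there the cosines are opposite, and they can be arranged to be
  nonzero.\<close>

lemma phase_increment_no_sign_change:
  fixes \<phi> :: "real \<Rightarrow> real"
  assumes "a \<le> b" and cont: "continuous_on {a..b} \<phi>"
    and sgn: "(\<forall>t\<in>{a<..<b}. cos (\<phi> t) \<ge> 0) \<or> (\<forall>t\<in>{a<..<b}. cos (\<phi> t) \<le> 0)"
  shows "\<phi> b - \<phi> a \<le> pi"
proof (rule ccontr)
  assume "\<not> \<phi> b - \<phi> a \<le> pi"
  then have gt: "\<phi> b - \<phi> a - pi > 0" by simp
  \<comment> \<open>So small that \<open>\<phi> a + d + pi\<close> and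
    \<open>\<phi> a + 2 * d + pi\<close> both stay below \<open>\<phi> b\<close>. Since d < pi, the
    cosine cannot vanish at both \<open>\<phi> a + d\<close> and
    \<open>\<phi> a + 2 * d\<close>.\<close>
  define d where "d = min 1 (\<phi> b - \<phi> a - pi) / 4"
  have d: "0 < d" "d < pi" "2 * d < \<phi> b - \<phi> a - pi"
    using gt pi_gt3 by (auto simp: d_def min_def)
  have val: "\<exists>t\<in>{a<..<b}. \<phi> t = y" if "\<phi> a < y" "y < \<phi> b" for y
  proof -
    obtain t where t: "a \<le> t" "t \<le> b" "\<phi> t = y"
      using IVT'[of \<phi> a y b] \<open>\<phi> a < y\<close> \<open>y < \<phi> b\<close> assms(1) cont by (meson less_imp_le)
    moreover have "t \<noteq> a" "t \<noteq> b" using t \<open>\<phi> a < y\<close> \<open>y < \<phi> b\<close> by auto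
    ultimately show ?thesis by (intro bexI[of _ t]) auto
  qed
  obtain y where y: "\<phi> a < y" "y + pi < \<phi> b" "cos y \<noteq> 0"
  proof (cases "cos (\<phi> a + d) = 0")
    case True
    have "cos (\<phi> a + 2 * d) \<noteq> 0"
    proof
      assume "cos (\<phi> a + 2 * d) = 0"
      then have "sin ((\<phi> a + 2 * d) - (\<phi> a + d)) = 0"
        using True by (subst sin_diff) simp
      then show False using sin_gt_zero[of d] d by simp
    qed
    then show ?thesis using d by (intro that[of "\<phi> a + 2 * d"]) auto
  next
    case False
    then show ?thesis using d by (intro that[of "\<phi> a + d"]) auto
  qed
  obtain t1 t2 where "t1 \<in> {a<..<b}" "\<phi> t1 = y" "t2 \<in> {a<..<b}" "\<phi> t2 = y + pi"
    using val[of y] val[of "y + pi"] y pi_gt_zero by (metis add_strict_increasing less_add_same_cancel1 less_trans)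
  moreover have "cos (y + pi) = - cos y" by simp
  ultimately show False using sgn y(3) by (metis linorder_not_less neg_0_le_iff_le neg_le_0_iff_le order_antisym)
qed

text \<open>Induction on the number of interior break points: k of them cut the interval into k + 1
  pieces, and each piece costs at most pi.\<close>

lemma phase_increment_le:
  fixes \<phi> :: "real \<Rightarrow> real"
  assumes "a \<le> b" and "continuous_on {a..b} \<phi>" and "finite S"
    and "\<And>u v. a \<le> u \<Longrightarrow> u < v \<Longrightarrow> v \<le> b \<Longrightarrow> {u<..<v} \<inter> S = {} \<Longrightarrow>
      (\<forall>t\<in>{u<..<v}. cos (\<phi> t) \<ge> 0) \<or> (\<forall>t\<in>{u<..<v}. cos (\<phi> t) \<le> 0)"
  shows "\<phi> b - \<phi> a \<le> pi * (card (S \<inter> {a<..<b}) + 1)"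
  using assms
proof (induction "card (S \<inter> {a<..<b})" arbitrary: a b rule: less_induct)
  case less
  show ?case
  proof (cases "S \<inter> {a<..<b} = {}")
    case True
    have "\<phi> b - \<phi> a \<le> pi"
    proof (cases "a = b")
      case False
      have "(\<forall>t\<in>{a<..<b}. cos (\<phi> t) \<ge> 0) \<or> (\<forall>t\<in>{a<..<b}. cos (\<phi> t) \<le> 0)"
      proof (rule less.prems(4))
        show "{a<..<b} \<inter> S = {}" using True by blast
        show "a < b" using less.prems(1) False by simp
      qed simp_all
      then show ?thesis by (rule phase_increment_no_sign_change[OF less.prems(1,2)])
    qed auto
    then show ?thesis using True by simp
  next
    case False
    then obtain s where s: "s \<in> S" "a < s" "s < b" by auto
    have fin: "finite (S \<inter> {a<..<b})" using less.prems by simp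
    have c1: "card (S \<inter> {a<..<s}) < card (S \<inter> {a<..<b})"
      by (rule psubset_card_mono[OF fin]) (use s in auto)
    have c2: "card (S \<inter> {s<..<b}) < card (S \<inter> {a<..<b})"
      by (rule psubset_card_mono[OF fin]) (use s in auto)
    have "card ((S \<inter> {a<..<s}) \<union> (S \<inter> {s<..<b}) \<union> {s}) \<le> card (S \<inter> {a<..<b})"
      by (rule card_mono[OF fin]) (use s in auto)
    moreover have "card ((S \<inter> {a<..<s}) \<union> (S \<inter> {s<..<b}) \<union> {s}) = card (S \<inter> {a<..<s}) + card (S \<inter> {s<..<b}) + 1"
      using less.prems by (subst card_Un_disjoint; (subst card_Un_disjoint)?) auto
    ultimately have c: "real (card (S \<inter> {a<..<s})) + real (card (S \<inter> {s<..<b})) + 1 \<le> real (card (S \<inter> {a<..<b}))"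
      by linarith
    have "\<phi> s - \<phi> a \<le> pi * (card (S \<inter> {a<..<s}) + 1)"
      by (rule less.hyps[OF c1]) (use less.prems s in \<open>auto intro: continuous_on_subset\<close>)
    moreover have "\<phi> b - \<phi> s \<le> pi * (card (S \<inter> {s<..<b}) + 1)"
      by (rule less.hyps[OF c2]) (use less.prems s in \<open>auto intro: continuous_on_subset\<close>)
    ultimately have "\<phi> b - \<phi> a \<le> pi * ((card (S \<inter> {a<..<s}) + 1) + (card (S \<inter> {s<..<b}) + 1))"
      by (simp add: distrib_left)
    also have "\<dots> \<le> pi * (card (S \<inter> {a<..<b}) + 1)"
      using c by (intro mult_left_mono) auto
    finally show ?thesis .
  qed
qed

text \<open>R may be a signed modulus. Between points of S it keeps its sign, so the sign of
  \<open>R t * cos (\<phi> t)\<close> determines that of the cosine up to a fixed sign. The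
  two-sided bound comes from replacing \<open>\<phi>\<close> by its negative, which leaves the
  cosine unchanged.\<close>

lemma phase_increment_real_part_le:
  fixes \<phi> R :: "real \<Rightarrow> real"
  assumes "a \<le> b" and "continuous_on {a..b} \<phi>" and R: "continuous_on {a..b} R" and "finite S"
    and zeros: "{t \<in> {a<..<b}. R t = 0} \<subseteq> S"
    and sgn: "\<And>u v. a \<le> u \<Longrightarrow> u < v \<Longrightarrow> v \<le> b \<Longrightarrow> {u<..<v} \<inter> S = {} \<Longrightarrow>
      (\<forall>t\<in>{u<..<v}. R t * cos (\<phi> t) \<ge> 0) \<or> (\<forall>t\<in>{u<..<v}. R t * cos (\<phi> t) \<le> 0)"
  shows "\<bar>\<phi> b - \<phi> a\<bar> \<le> pi * (card S + 1)"
proof -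
  have cs: "(\<forall>t\<in>{u<..<v}. cos (\<phi> t) \<ge> 0) \<or> (\<forall>t\<in>{u<..<v}. cos (\<phi> t) \<le> 0)"
    if uv: "a \<le> u" "u < v" "v \<le> b" "{u<..<v} \<inter> S = {}" for u v
  proof -
    have nz: "R t \<noteq> 0" if "t \<in> {u<..<v}" for t
    proof
      assume "R t = 0"
      moreover have "a < t" "t < b" using that uv(1,3) by auto
      ultimately have "t \<in> {t \<in> {a<..<b}. R t = 0}" by auto
      then show False using zeros uv(4) that by blast
    qed
    have "connected (R ` {u<..<v})"
      by (intro connected_continuous_image continuous_on_subset[OF R]) (use uv(1-3) in auto)
    then have "(\<forall>t\<in>{u<..<v}. R t > 0) \<or> (\<forall>t\<in>{u<..<v}. R t < 0)"
      using nz connectedD_interval[where U = "R ` {u<..<v}" and z = 0]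
      by (smt (verit, best) image_iff)
    then show ?thesis
    proof
      assume "\<forall>t\<in>{u<..<v}. R t > 0"
      then have "\<forall>t\<in>{u<..<v}. (R t * cos (\<phi> t) \<ge> 0 \<longleftrightarrow> cos (\<phi> t) \<ge> 0) \<and> (R t * cos (\<phi> t) \<le> 0 \<longleftrightarrow> cos (\<phi> t) \<le> 0)"
        by (auto simp: zero_le_mult_iff mult_le_0_iff dest!: bspec)
      then show ?thesis using sgn[OF uv] by blast
    next
      assume "\<forall>t\<in>{u<..<v}. R t < 0"
      then have "\<forall>t\<in>{u<..<v}. (R t * cos (\<phi> t) \<ge> 0 \<longleftrightarrow> cos (\<phi> t) \<le> 0) \<and> (R t * cos (\<phi> t) \<le> 0 \<longleftrightarrow> cos (\<phi> t) \<ge> 0)"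
        by (auto simp: zero_le_mult_iff mult_le_0_iff dest!: bspec)
      then show ?thesis using sgn[OF uv] by blast
    qed
  qed
  have card: "pi * (card (S \<inter> {a<..<b}) + 1) \<le> pi * (card S + 1)"
    using \<open>finite S\<close> by (intro mult_left_mono) (auto intro: card_mono)
  have "\<phi> b - \<phi> a \<le> pi * (card (S \<inter> {a<..<b}) + 1)"
    by (rule phase_increment_le) (use assms cs in auto)
  moreover have "(- \<phi> b) - (- \<phi> a) \<le> pi * (card (S \<inter> {a<..<b}) + 1)"
    by (rule phase_increment_le[of a b "\<lambda>t. - \<phi> t"]) (use assms cs in \<open>auto intro: continuous_intros\<close>)
  ultimately show ?thesis using card by linarith
qed

section \<open>Splitting off the zeros of a holomorphic function\<close>

text \<open>After division by the linear factors the function has no zeros on a convex neighbourhood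
  of K, so it has a holomorphic logarithm G there. Zeros on the boundary of K are split off like all
  others.\<close>

lemma zero_factorization:
  fixes f :: "complex \<Rightarrow> complex"
  assumes hol: "f holomorphic_on \<Omega>" and \<Omega>: "open \<Omega>" "convex \<Omega>"
    and K: "compact K" "convex K" "K \<noteq> {}" "K \<subseteq> \<Omega>" and nz: "\<exists>w\<in>\<Omega>. f w \<noteq> 0"
  defines "Z \<equiv> {z\<in>K. f z = 0}"
  obtains \<Omega>' G where "open \<Omega>'" "convex \<Omega>'" "K \<subseteq> \<Omega>'" "\<Omega>' \<subseteq> \<Omega>" "G holomorphic_on \<Omega>'" "finite Z"
    "\<And>s. s \<in> \<Omega>' \<Longrightarrow> f s = exp (G s) * (\<Prod>z\<in>Z. (s - z) ^ nat (zorder f z))"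
    "\<And>z. z \<in> Z \<Longrightarrow> zorder f z > 0"
proof -
  have conn: "connected \<Omega>" using \<Omega> by (simp add: convex_connected)
  have fin: "finite {z\<in>C. f z = 0}" if "compact C" "C \<subseteq> \<Omega>" for C
  proof (cases "f constant_on \<Omega>")
    case True
    then have "f z \<noteq> 0" if "z \<in> \<Omega>" for z using nz that unfolding constant_on_def by metis
    then have "{z\<in>C. f z = 0} = {}" using that by blast
    then show ?thesis by (metis finite.emptyI)
  next
    case False
    then show ?thesis by (rule holomorphic_compact_finite_zeros[OF hol \<Omega>(1) conn that])
  qed
  obtain \<epsilon> where \<epsilon>: "\<epsilon> > 0" "{x. infdist x K \<le> \<epsilon>} \<subseteq> \<Omega>"
    using compact_in_open_separated[OF K(3,1) \<Omega>(1) K(4)] by blast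
  define K1 where "K1 = {x. infdist x K \<le> \<epsilon>}"
  have "compact K1" unfolding K1_def using K(1,3) \<epsilon>(1) by (intro compact_infdist_le)
  then have fin1: "finite {z\<in>K1. f z = 0}" using \<epsilon>(2) by (intro fin) (auto simp: K1_def)
  \<comment> \<open>Zeros near K but outside it are removed, so that the neighbourhood chosen next
    contains no zeros besides those in K.\<close>
  define B where "B = {x. infdist x K < \<epsilon>} - ({z\<in>K1. f z = 0} - K)"
  have "open B" unfolding B_def
    by (intro open_Diff open_Collect_less continuous_intros finite_imp_closed finite_Diff fin1)
  moreover have "K \<subseteq> B" using \<epsilon>(1) by (auto simp: B_def)
  ultimately obtain e where e: "e > 0" "(\<Union>x\<in>K. ball x e) \<subseteq> B"
    using compact_subset_open_imp_ball_epsilon_subset[OF K(1)] by blast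
  \<comment> \<open>The e-neighbourhood of the convex set K is a Minkowski sum with a ball, hence
    convex again.\<close>
  define \<Omega>' where "\<Omega>' = (\<Union>x\<in>K. ball x e)"
  have eq: "\<Omega>' = (\<Union>x\<in>K. \<Union>y\<in>ball 0 e. {x + y})"
  proof -
    have *: "ball x e = (\<Union>y\<in>ball 0 e. {x + y})" for x :: complex
    proof (intro equalityI subsetI)
      fix y assume "y \<in> ball x e"
      then have "y - x \<in> ball 0 e" by (simp add: dist_norm norm_minus_commute)
      moreover have "y \<in> {x + (y - x)}" by simp
      ultimately show "y \<in> (\<Union>y\<in>ball 0 e. {x + y})" by (rule UN_I)
    qed (auto simp: dist_norm)
    show ?thesis unfolding \<Omega>'_def by (rule SUP_cong[OF refl *])
  qed
  have conv: "convex \<Omega>'" unfolding eq by (intro convex_sums K convex_ball)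
  have op: "open \<Omega>'" by (auto simp: \<Omega>'_def)
  have K\<Omega>': "K \<subseteq> \<Omega>'" using e(1) by (auto simp: \<Omega>'_def)
  have \<Omega>'B: "\<Omega>' \<subseteq> B" using e(2) by (simp add: \<Omega>'_def)
  then have "\<Omega>' \<subseteq> {x. infdist x K \<le> \<epsilon>}" unfolding B_def by auto
  then have \<Omega>'\<Omega>: "\<Omega>' \<subseteq> \<Omega>" using \<epsilon>(2) by (rule order_trans)
  have zeros: "f s \<noteq> 0" if "s \<in> \<Omega>'" "s \<notin> Z" for s
    using that \<Omega>'B by (auto simp: B_def K1_def Z_def)
  have Zfin: "finite Z" unfolding Z_def by (rule fin[OF K(1,4)])
  define m where "m z = nat (zorder f z)" for z
  define P where "P A s = (\<Prod>z\<in>A. (s - z) ^ m z)" for A s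
  have ZO: "zorder f z > 0" "\<exists>r. r>0 \<and> cball z r \<subseteq> \<Omega> \<and> zor_poly f z holomorphic_on cball z r
    \<and> (\<forall>w\<in>cball z r. f w  = zor_poly f z w * (w-z) ^ m z \<and> zor_poly f z w \<noteq> 0)" if "z \<in> Z" for z
    using zorder_exist_zero[OF hol \<Omega>(1) conn _ nz, of z] that K(4) by (auto simp: Z_def m_def)
  \<comment> \<open>The quotient with its removable singularities filled in: at a zero the cofactor
    \<open>zor_poly\<close> takes the place of f divided by its own linear factors.\<close>
  define h where "h s = (if s \<in> Z then zor_poly f s s / P (Z - {s}) s else f s / P Z s)" for s
  have P_nz: "P A s \<noteq> 0" if "s \<notin> A" for A s
    using that by (cases "finite A") (auto simp: P_def)
  have fh: "f s = h s * P Z s" if "s \<in> \<Omega>'" for s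
  proof (cases "s \<in> Z")
    case True
    then have "m s > 0" using ZO(1) by (simp add: m_def)
    then have "P Z s = 0" using True Zfin by (auto simp: P_def)
    then show ?thesis using True by (simp add: Z_def)
  qed (use P_nz in \<open>auto simp: h_def\<close>)
  have h_nz: "h s \<noteq> 0" if "s \<in> \<Omega>'" for s
  proof (cases "s \<in> Z")
    case True
    then have "zor_poly f s s \<noteq> 0" using ZO(2)[OF True] by force
    then show ?thesis using True P_nz[of s "Z - {s}"] by (simp add: h_def)
  qed (use zeros[OF that] P_nz in \<open>auto simp: h_def\<close>)
  have P_hol: "P A holomorphic_on T" for A T
    unfolding P_def[abs_def] by (intro holomorphic_intros)
  have "h field_differentiable at s" if s: "s \<in> \<Omega>'" for s
  proof (cases "s \<in> Z")
    case True
    obtain r where r: "r > 0" "zor_poly f s holomorphic_on cball s r"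
      "\<And>w. w \<in> cball s r \<Longrightarrow> f w  = zor_poly f s w * (w-s) ^ m s"
      using ZO(2)[OF True] by blast
    define D where "D = ball s r - (Z - {s})"
    have D: "open D" "s \<in> D" using r Zfin by (auto simp: D_def intro!: open_Diff finite_imp_closed)
    have "(\<lambda>w. zor_poly f s w / P (Z - {s}) w) holomorphic_on D"
      by (intro holomorphic_intros P_hol holomorphic_on_subset[OF r(2)]) (use P_nz in \<open>auto simp: D_def\<close>)
    moreover have "zor_poly f s w / P (Z - {s}) w = h w" if "w \<in> D" for w
    proof (cases "w = s")
      case False
      then have "w \<notin> Z" using that by (auto simp: D_def)
      moreover have "P Z w = (w - s) ^ m s * P (Z - {s}) w"
        unfolding P_def by (rule prod.remove[OF Zfin True])
      moreover have "f w  = zor_poly f s w * (w-s) ^ m s" using that by (intro r) (auto simp: D_def)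
      ultimately show ?thesis using False by (simp add: h_def)
    qed (use True in \<open>auto simp: h_def\<close>)
    ultimately have "h holomorphic_on D" by (rule holomorphic_transform)
    then show ?thesis using D holomorphic_on_imp_differentiable_at by blast
  next
    case False
    define D where "D = \<Omega>' - Z"
    have D: "open D" "s \<in> D" using op Zfin False s by (auto simp: D_def intro!: open_Diff finite_imp_closed)
    have "(\<lambda>w. f w / P Z w) holomorphic_on D"
      by (intro holomorphic_intros P_hol holomorphic_on_subset[OF hol]) (use P_nz \<Omega>'\<Omega> in \<open>auto simp: D_def\<close>)
    then have "h holomorphic_on D" by (rule holomorphic_transform) (auto simp: h_def D_def)
    then show ?thesis using D holomorphic_on_imp_differentiable_at by blast
  qed
  then have h_hol: "h holomorphic_on \<Omega>'"
    by (auto simp: holomorphic_on_def intro: field_differentiable_at_within)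
  obtain z0 where "z0 \<in> \<Omega>'" using K(3) K\<Omega>' by blast
  then obtain G where G: "G holomorphic_on \<Omega>'" "\<And>s. s \<in> \<Omega>' \<Longrightarrow> exp (G s) = h s"
    using holomorphic_logarithm_exists[OF conv op h_hol h_nz] by blast
  show ?thesis
    by (rule that[OF op conv K\<Omega>' \<Omega>'\<Omega> G(1) Zfin _ ZO(1)]) (use fh G(2) in \<open>auto simp: P_def m_def\<close>)
qed

section \<open>Littlewood's lemma and the argument principle on a rectangle\<close>

text \<open>A primitive of \<open>ln (norm (Complex x u))\<close> in the variable u. For x = 0 the
  last summand is 0 and the formula stays correct for u \<noteq> 0.\<close>

definition log_primitive :: "real \<Rightarrow> real \<Rightarrow> real" where
  "log_primitive x u = u / 2 * ln (x\<^sup>2 + u\<^sup>2) - u + x * arctan (u / x)"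

text \<open>A primitive of \<open>arctan (x / k)\<close> in the variable x, for k \<noteq>
  0.\<close>

definition arctan_primitive :: "real \<Rightarrow> real \<Rightarrow> real" where
  "arctan_primitive k x = x * arctan (x / k) - k / 2 * ln (x\<^sup>2 + k\<^sup>2)"

lemma log_primitive_deriv:
  assumes "x \<noteq> 0 \<or> u \<noteq> 0"
  shows "(log_primitive x has_real_derivative ln (norm (Complex x u))) (at u)"
proof -
  have pos: "x\<^sup>2 + u\<^sup>2 > 0" using assms by (simp add: sum_power2_gt_zero_iff)
  have ln: "ln (norm (Complex x u)) = 1 / 2 * ln (x\<^sup>2 + u\<^sup>2)"
    using pos by (simp add: complex_norm ln_sqrt)
  show ?thesis
  proof (cases "x = 0")
    case True
    then have u: "u \<noteq> 0" using assms by simp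
    have "((\<lambda>u. ln (u\<^sup>2)) has_real_derivative inverse (u\<^sup>2) * (2 * u)) (at u)"
      using DERIV_chain2[OF DERIV_ln[of "u\<^sup>2"] DERIV_pow[of 2 u]] u by simp
    from DERIV_diff[OF DERIV_mult[OF DERIV_cdivide[OF DERIV_ident] this] DERIV_ident, of 2]
    have "((\<lambda>u. u / 2 * ln (u\<^sup>2) - u) has_real_derivative
        (1 / 2 * ln (u\<^sup>2) + inverse (u\<^sup>2) * (2 * u) * (u / 2) - 1)) (at u)" .
    moreover have "inverse (u\<^sup>2) * (2 * u) * (u / 2) = 1" using u by (simp add: power2_eq_square field_simps)
    ultimately have "((\<lambda>u. u / 2 * ln (u\<^sup>2) - u) has_real_derivative 1 / 2 * ln (u\<^sup>2)) (at u)"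
      by simp
    then show ?thesis unfolding ln using True by (simp add: log_primitive_def[abs_def])
  next
    case False
    have e1: "1 + (u / x)\<^sup>2 = (x\<^sup>2 + u\<^sup>2) / x\<^sup>2" using False by (simp add: field_simps)
    have D1: "((\<lambda>u. ln (x\<^sup>2 + u\<^sup>2)) has_real_derivative inverse (x\<^sup>2 + u\<^sup>2) * (0 + 2 * u)) (at u)"
      using DERIV_chain2[OF DERIV_ln[OF pos] DERIV_add[OF DERIV_const DERIV_pow[of 2 u]]] by simp
    have D2: "((\<lambda>u. arctan (u / x)) has_real_derivative inverse (1 + (u / x)\<^sup>2) * (1 / x)) (at u)"
      by (rule DERIV_chain2[OF DERIV_arctan DERIV_cdivide[OF DERIV_ident]])
    have D: "((\<lambda>u. u / 2 * ln (x\<^sup>2 + u\<^sup>2) - u + x * arctan (u / x)) has_real_derivative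
      (1 / 2 * ln (x\<^sup>2 + u\<^sup>2) + inverse (x\<^sup>2 + u\<^sup>2) * (0 + 2 * u) * (u / 2) - 1 +
       x * (inverse (1 + (u / x)\<^sup>2) * (1 / x)))) (at u)"
      by (rule DERIV_add[OF DERIV_diff[OF DERIV_mult[OF DERIV_cdivide[OF DERIV_ident] D1] DERIV_ident]
          DERIV_cmult[OF D2]])
    have eq: "inverse (x\<^sup>2 + u\<^sup>2) * (0 + 2 * u) * (u / 2) - 1 + x * (inverse (1 + (u / x)\<^sup>2) * (1 / x)) = 0"
      unfolding e1 using pos False by (simp add: field_simps power2_eq_square)
    show ?thesis unfolding ln log_primitive_def[abs_def]
      by (rule DERIV_cong[OF D]) (use eq in linarith)
  qed
qed

text \<open>The critical point is x = u = 0, where \<open>u * ln (u\<^sup>2)\<close> tends to 0.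
  This continuity lets the vertical integrals run through zeros on the edge.\<close>

lemma continuous_log_primitive: "isCont (log_primitive x) u"
proof (cases "x \<noteq> 0 \<or> u \<noteq> 0")
  case True
  then show ?thesis using log_primitive_deriv DERIV_isCont by blast
next
  case False
  have "((\<lambda>u::real. u / 2 * ln (u\<^sup>2) - u) \<longlongrightarrow> 0) (at 0)"
    by (rule filterlim_split_at; real_asymp)
  then show ?thesis using False
    by (simp add: isCont_def log_primitive_def[abs_def])
qed

lemma ln_norm_has_integral:
  assumes "u1 \<le> u2"
  shows "((\<lambda>u. ln (norm (Complex x (u - g)))) has_integral
           (log_primitive x (u2 - g) - log_primitive x (u1 - g))) {u1..u2}"
proof (rule fundamental_theorem_of_calculus_interior_strong[of "{g}"])
  show "continuous_on {u1..u2} (\<lambda>u. log_primitive x (u - g))"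
    by (rule continuous_on_compose2[of UNIV "log_primitive x"])
      (auto intro!: continuous_intros continuous_at_imp_continuous_on continuous_log_primitive)
  fix u assume "u \<in> {u1<..<u2} - {g}"
  then have u: "x \<noteq> 0 \<or> u - g \<noteq> 0" by simp
  have "((\<lambda>u. u - g) has_real_derivative 1) (at u)" by (auto intro!: derivative_eq_intros)
  from DERIV_chain2[OF log_primitive_deriv[OF u] this]
  show "((\<lambda>u. log_primitive x (u - g)) has_vector_derivative ln (norm (Complex x (u - g)))) (at u)"
    by (simp add: has_real_derivative_iff_has_vector_derivative)
qed (use assms in auto)

lemma arctan_has_integral:
  assumes "x1 \<le> x2" "k \<noteq> 0"
  shows "((\<lambda>x. arctan ((x - g) / k)) has_integral
           (arctan_primitive k (x2 - g) - arctan_primitive k (x1 - g))) {x1..x2}"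
proof (rule fundamental_theorem_of_calculus)
  fix x
  have pos: "y\<^sup>2 + k\<^sup>2 > 0" for y using assms by (simp add: sum_power2_gt_zero_iff)
  have e1: "1 + ((x - g) / k)\<^sup>2 = ((x - g)\<^sup>2 + k\<^sup>2) / k\<^sup>2" using assms by (simp add: field_simps)
  have D0: "((\<lambda>x. x - g) has_real_derivative 1) (at x)"
    by (auto intro!: derivative_eq_intros)
  have D1: "((\<lambda>x. ln ((x - g)\<^sup>2 + k\<^sup>2)) has_real_derivative inverse ((x - g)\<^sup>2 + k\<^sup>2) * (2 * (x - g))) (at x)"
    using DERIV_chain2[OF DERIV_ln[OF pos[of "x - g"]] DERIV_add[OF DERIV_power[OF D0, of 2] DERIV_const]]
    by simp
  have D2: "((\<lambda>x. arctan ((x - g) / k)) has_real_derivative inverse (1 + ((x - g) / k)\<^sup>2) * (1 / k)) (at x)"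
    by (rule DERIV_chain2[OF DERIV_arctan DERIV_cdivide[OF D0]])
  have D: "((\<lambda>x. arctan_primitive k (x - g)) has_real_derivative
      (1 * arctan ((x - g) / k) + inverse (1 + ((x - g) / k)\<^sup>2) * (1 / k) * (x - g) -
       k / 2 * (inverse ((x - g)\<^sup>2 + k\<^sup>2) * (2 * (x - g))))) (at x)"
    unfolding arctan_primitive_def
    by (rule DERIV_diff[OF DERIV_mult[OF D0 D2] DERIV_cmult[OF D1]])
  have eq: "inverse (1 + ((x - g) / k)\<^sup>2) * (1 / k) * (x - g) -
       k / 2 * (inverse ((x - g)\<^sup>2 + k\<^sup>2) * (2 * (x - g))) = 0"
    unfolding e1 using pos[of "x - g"] assms by (simp add: field_simps power2_eq_square)
  have "((\<lambda>x. arctan_primitive k (x - g)) has_real_derivative arctan ((x - g) / k)) (at x)"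
    by (rule DERIV_cong[OF D]) (use eq in linarith)
  then show "((\<lambda>x. arctan_primitive k (x - g)) has_vector_derivative arctan ((x - g) / k)) (at x within {x1..x2})"
    by (simp add: has_real_derivative_iff_has_vector_derivative has_vector_derivative_at_within)
qed (use assms in auto)

text \<open>The convention for division by zero covers x = 0 as well: every term is then 0.\<close>

lemma arctan_swap:
  assumes "k \<noteq> 0"
  shows "arctan (x / k) = sgn x * sgn k * (pi / 2) - arctan (k / x)"
proof (cases "x = 0")
  case False
  then have "x / k \<noteq> 0" using assms by simp
  from Transcendental.arctan_inverse[OF this]
  have "arctan (k / x) = sgn (x / k) * (pi / 2) - arctan (x / k)" by simp
  moreover have "sgn (x / k) = sgn x * sgn k"
    by (simp add: sgn_divide sgn_mult divide_inverse sgn_inverse)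
  ultimately show ?thesis by simp
qed simp

text \<open>The horizontal and vertical primitives are negatives of each other up to a linear term
  and one with \<open>sgn k\<close>. This sign jumps at the height of a zero, and the jump is what
  counts the zero in Littlewood's lemma.\<close>

lemma log_arctan_primitive:
  assumes "k \<noteq> 0"
  shows "arctan_primitive k x = - k + \<bar>x\<bar> * sgn k * (pi / 2) - log_primitive x k"
  unfolding arctan_primitive_def log_primitive_def arctan_swap[OF assms]
  by (simp add: algebra_simps abs_sgn)

lemma cis_arctan: "of_real (sqrt (1 + x\<^sup>2)) * cis (arctan x) = Complex 1 x"
proof -
  have "sqrt (1 + x\<^sup>2) > 0" by (simp add: add_pos_nonneg)
  then show ?thesis by (simp add: complex_eq_iff cos_arctan sin_arctan)
qed

lemma polar_prod:
  assumes "finite Z" "\<And>z. z \<in> Z \<Longrightarrow> g z = of_real (r z) * cis (p z)"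
  shows "(\<Prod>z\<in>Z. g z ^ m z) = of_real (\<Prod>z\<in>Z. r z ^ m z) * cis (\<Sum>z\<in>Z. real (m z) * p z)"
  using assms
proof (induction Z)
  case (insert x F)
  have "(of_real (r x) * cis (p x)) ^ m x = of_real (r x ^ m x) * cis (real (m x) * p x)"
    by (simp add: power_mult_distrib Complex.DeMoivre)
  then show ?case using insert by (simp add: cis_mult[symmetric] mult_ac del: of_real_power)
qed simp

lemma polar_horizontal:
  assumes "k \<noteq> 0"
  shows "Complex x k = of_real (norm (Complex x k)) * cis (sgn k * (pi / 2) - arctan (x / k))"
proof -
  have n: "norm (Complex x k) = \<bar>k\<bar> * sqrt (1 + (x / k)\<^sup>2)"
  proof -
    have "x\<^sup>2 + k\<^sup>2 = k\<^sup>2 * (1 + (x / k)\<^sup>2)" using assms by (simp add: field_simps)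
    then show ?thesis by (simp add: complex_norm real_sqrt_mult)
  qed
  have c: "of_real (sqrt (1 + (x / k)\<^sup>2)) * cis (- arctan (x / k)) = Complex 1 (- (x / k))"
    using cis_arctan[of "- (x / k)"] by (simp add: arctan_minus)
  have s: "cis (sgn k * (pi / 2)) = of_real (sgn k) * \<i>"
    using assms by (cases k "0 :: real" rule: linorder_cases) (auto simp: complex_eq_iff)
  have "of_real (norm (Complex x k)) * cis (sgn k * (pi / 2) - arctan (x / k)) =
     of_real \<bar>k\<bar> * cis (sgn k * (pi / 2)) * (of_real (sqrt (1 + (x / k)\<^sup>2)) * cis (- arctan (x / k)))"
    by (simp add: n cis_mult)
  also have "\<dots> = Complex x k"
    unfolding c s using assms by (simp add: complex_eq_iff sgn_mult_abs mult.assoc[symmetric] abs_mult_sgn)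
  finally show ?thesis by simp
qed

text \<open>
  A signed modulus: at \<open>x = 0\<close> it changes sign with \<open>k\<close>, so that the phase stays continuous when a
  vertical line is followed through zeros on it.
\<close>

definition vertical_modulus :: "real \<Rightarrow> real \<Rightarrow> real" where
  "vertical_modulus x k = (if x = 0 then k else x * sqrt (1 + (k / x)\<^sup>2))"

lemma polar_vertical:
  "Complex x k = of_real (vertical_modulus x k) * cis (arctan (k / x) + (if x = 0 then pi / 2 else 0))"
proof (cases "x = 0")
  case False
  then show ?thesis using cis_arctan[of "k / x"]
    by (simp add: vertical_modulus_def mult.assoc) (simp add: complex_eq_iff)
qed (simp add: vertical_modulus_def complex_eq_iff)

section \<open>Functions on a rectangle with their zeros split off\<close>

text \<open>Logarithms and arguments on the edges are additive over exp G and the linear factors.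
  Littlewood's lemma and the argument principle thus reduce to identities for a single linear
  factor, while the terms from G cancel at the corners. Z may meet the boundary.\<close>

locale rect_factorization =
  fixes f G :: "complex \<Rightarrow> complex" and Z :: "complex set" and m :: "complex \<Rightarrow> nat"
    and \<Omega> :: "complex set" and a b T1 T2 :: real
  assumes ab: "a < b" and T12: "T1 < T2" and open_dom: "open \<Omega>" and convex_dom: "convex \<Omega>"
    and rect: "\<And>x y. a \<le> x \<Longrightarrow> x \<le> b \<Longrightarrow> T1 \<le> y \<Longrightarrow> y \<le> T2 \<Longrightarrow> Complex x y \<in> \<Omega>"
    and hol: "G holomorphic_on \<Omega>" and fin: "finite Z"
    and Z_rect: "\<And>z. z \<in> Z \<Longrightarrow> a \<le> Re z \<and> Re z \<le> b \<and> T1 \<le> Im z \<and> Im z \<le> T2"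
    and m_pos: "\<And>z. z \<in> Z \<Longrightarrow> m z > 0"
    and f_eq: "\<And>s. s \<in> \<Omega> \<Longrightarrow> f s = exp (G s) * (\<Prod>z\<in>Z. (s - z) ^ m z)"
begin

lemma f_zero_iff: "s \<in> \<Omega> \<Longrightarrow> f s = 0 \<longleftrightarrow> s \<in> Z"
  using fin m_pos by (auto simp: f_eq)

definition vmod :: "real \<Rightarrow> real \<Rightarrow> real" where
  "vmod x t = exp (Re (G (Complex x t))) * (\<Prod>z\<in>Z. vertical_modulus (x - Re z) (t - Im z) ^ m z)"

text \<open>On the line through a zero the arctangent has argument 0 by the convention for division,
  and the constant pi / 2 remains. The sign change sits in \<open>vmod\<close>, so the phase has no
  jump there.\<close>

definition vphase :: "real \<Rightarrow> real \<Rightarrow> real" where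
  "vphase x t = Im (G (Complex x t)) + (\<Sum>z\<in>Z. real (m z) *
     (arctan ((t - Im z) / (x - Re z)) + (if x = Re z then pi / 2 else 0)))"

lemma exp_polar: "exp (G s) = of_real (exp (Re (G s))) * cis (Im (G s))"
  by (metis exp_eq_polar of_real_exp)

lemma vertical_polar:
  assumes "a \<le> x" "x \<le> b" "T1 \<le> t" "t \<le> T2"
  shows "f (Complex x t) = of_real (vmod x t) * cis (vphase x t)"
proof -
  have "(\<Prod>z\<in>Z. (Complex x t - z) ^ m z) =
      of_real (\<Prod>z\<in>Z. vertical_modulus (x - Re z) (t - Im z) ^ m z) *
      cis (\<Sum>z\<in>Z. real (m z) * (arctan ((t - Im z) / (x - Re z)) + (if x = Re z then pi / 2 else 0)))"
  proof (rule polar_prod[OF fin])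
    fix z
    have "Complex x t - z = Complex (x - Re z) (t - Im z)" by (simp add: complex_eq_iff)
    then show "Complex x t - z = of_real (vertical_modulus (x - Re z) (t - Im z)) *
        cis (arctan ((t - Im z) / (x - Re z)) + (if x = Re z then pi / 2 else 0))"
      using polar_vertical[of "x - Re z" "t - Im z"] by simp
  qed
  then show ?thesis
    using f_eq[OF rect[OF assms]] exp_polar[of "Complex x t"]
    by (simp add: vmod_def vphase_def cis_mult[symmetric] mult_ac)
qed

lemma continuous_G_vertical: "a \<le> x \<Longrightarrow> x \<le> b \<Longrightarrow> continuous_on {T1..T2} (\<lambda>t. G (Complex x t))"
  by (intro continuous_on_compose2[OF holomorphic_on_imp_continuous_on[OF hol]]
      continuous_on_Complex continuous_intros) (auto intro: rect)

lemma continuous_vphase: "a \<le> x \<Longrightarrow> x \<le> b \<Longrightarrow> continuous_on {T1..T2} (vphase x)"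
  unfolding vphase_def[abs_def]
proof (intro continuous_on_add continuous_on_Im continuous_G_vertical continuous_on_sum
    continuous_on_mult continuous_on_const continuous_on_arctan)
  fix z
  show "continuous_on {T1..T2} (\<lambda>t. (t - Im z) / (x - Re z))"
    by (cases "x = Re z") (auto intro!: continuous_intros)
qed

lemma continuous_vmod: "a \<le> x \<Longrightarrow> x \<le> b \<Longrightarrow> continuous_on {T1..T2} (vmod x)"
  unfolding vmod_def[abs_def]
proof (intro continuous_intros continuous_G_vertical)
  fix z
  show "continuous_on {T1..T2} (\<lambda>t. vertical_modulus (x - Re z) (t - Im z))"
    unfolding vertical_modulus_def by (cases "x = Re z") (auto intro!: continuous_intros)
qed

lemma vmod_zero_iff:
  assumes "a \<le> x" "x \<le> b" "T1 \<le> t" "t \<le> T2"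
  shows "vmod x t = 0 \<longleftrightarrow> Complex x t \<in> Z"
proof -
  have "vmod x t = 0 \<longleftrightarrow> f (Complex x t) = 0" using vertical_polar[OF assms] by simp
  then show ?thesis using f_zero_iff[OF rect[OF assms]] by simp
qed

text \<open>On a horizontal line a linear factor has phase \<open>sgn k * (pi / 2)\<close> minus an
  arctangent. The constant drops out of the increment, and the minus sign reverses the order of the
  arctangents.\<close>

definition inc :: "real \<Rightarrow> real \<Rightarrow> real" where
  "inc h x = Im (G (Complex x h)) - Im (G (Complex b h)) +
     (\<Sum>z\<in>Z. real (m z) * (arctan ((b - Re z) / (h - Im z)) - arctan ((x - Re z) / (h - Im z))))"

lemma arg_increment_eq:
  assumes h: "T1 \<le> h" "h \<le> T2" "h \<notin> Im ` Z" and x: "a \<le> x" "x \<le> b"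
  shows "arg_increment f (Complex b h) (Complex x h) = inc h x"
proof -
  define l where "l u = b + u * (x - b)" for u :: real
  have lin: "linepath (Complex b h) (Complex x h) u = Complex (l u) h" for u
    by (simp add: linepath_def l_def complex_eq_iff algebra_simps)
  have l: "a \<le> l u" "l u \<le> b" if "u \<in> {0..1}" for u
  proof -
    have "u * (b - x) \<le> 1 * (b - x)" using that x by (intro mult_right_mono) auto
    then show "a \<le> l u" using x by (simp add: l_def algebra_simps)
    have "0 \<le> u * (b - x)" using that x by (intro mult_nonneg_nonneg) auto
    then show "l u \<le> b" by (simp add: l_def algebra_simps)
  qed
  have dom: "Complex (l u) h \<in> \<Omega>" if "u \<in> {0..1}" for u
    using rect[OF l[OF that] h(1,2)] .
  define p where "p u = Im (G (Complex (l u) h)) +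
    (\<Sum>z\<in>Z. real (m z) * (sgn (h - Im z) * (pi / 2) - arctan ((l u - Re z) / (h - Im z))))" for u
  have k: "h - Im z \<noteq> 0" if "z \<in> Z" for z using h(3) that by auto
  have fp: "f (Complex (l u) h) = of_real (exp (Re (G (Complex (l u) h))) * (\<Prod>z\<in>Z. norm (Complex (l u) h - z) ^ m z)) * cis (p u)"
    if u: "u \<in> {0..1}" for u
  proof -
    have "(\<Prod>z\<in>Z. (Complex (l u) h - z) ^ m z) = of_real (\<Prod>z\<in>Z. norm (Complex (l u) h - z) ^ m z) *
       cis (\<Sum>z\<in>Z. real (m z) * (sgn (h - Im z) * (pi / 2) - arctan ((l u - Re z) / (h - Im z))))"
    proof (rule polar_prod[OF fin])
      fix z assume "z \<in> Z"
      have "Complex (l u) h - z = Complex (l u - Re z) (h - Im z)" by (simp add: complex_eq_iff)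
      then show "Complex (l u) h - z = of_real (norm (Complex (l u) h - z)) *
          cis (sgn (h - Im z) * (pi / 2) - arctan ((l u - Re z) / (h - Im z)))"
        using polar_horizontal[OF k[OF \<open>z \<in> Z\<close>], of "l u - Re z"] by simp
    qed
    then show ?thesis
      using f_eq[OF dom[OF u]] exp_polar[of "Complex (l u) h"]
      by (simp add: p_def cis_mult[symmetric] mult_ac)
  qed
  have "arg_increment f (Complex b h) (Complex x h) = p 1 - p 0"
  proof (rule arg_increment_eqI)
    have lc: "continuous_on {0..1} l" unfolding l_def by (intro continuous_intros)
    have Gc: "continuous_on {0..1} (\<lambda>u. G (Complex (l u) h))"
    proof (rule continuous_on_compose2[OF holomorphic_on_imp_continuous_on[OF hol]])
      show "continuous_on {0..1} (\<lambda>u. Complex (l u) h)"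
        by (intro continuous_on_Complex lc continuous_on_const)
    qed (use dom in blast)
    have qc: "continuous_on {0..1} (\<lambda>u. (l u - Re z) / (h - Im z))" if "z \<in> Z" for z
      by (intro continuous_on_divide continuous_on_diff lc continuous_on_const) (use k[OF that] in simp)
    show "continuous_on {0..1} p"
      unfolding p_def[abs_def]
      by (intro continuous_on_add continuous_on_diff continuous_on_Im Gc continuous_on_sum
          continuous_on_mult continuous_on_const continuous_on_arctan qc)
    fix u :: real assume u: "u \<in> {0..1}"
    let ?r = "exp (Re (G (Complex (l u) h))) * (\<Prod>z\<in>Z. norm (Complex (l u) h - z) ^ m z)"
    have "?r \<ge> 0" by (intro mult_nonneg_nonneg prod_nonneg) auto
    then have "norm (f (Complex (l u) h)) = ?r"
      unfolding fp[OF u] norm_mult norm_of_real norm_cis by (simp only: abs_of_nonneg mult_1_right)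
    then show "f (linepath (Complex b h) (Complex x h) u) =
        of_real (norm (f (linepath (Complex b h) (Complex x h) u))) * cis (p u)"
      unfolding lin using fp[OF u] by simp
    have "Complex (l u) h \<notin> Z" using h(3) by force
    then show "f (linepath (Complex b h) (Complex x h) u) \<noteq> 0"
      unfolding lin using f_zero_iff[OF dom[OF u]] by simp
  qed
  also have "\<dots> = inc h x"
    by (simp add: p_def inc_def l_def sum_subtractf[symmetric] right_diff_distrib[symmetric])
  finally show ?thesis .
qed

lemma primitive_exists: "\<exists>P. \<forall>s\<in>\<Omega>. (P has_field_derivative G s) (at s)"
proof -
  obtain P where "\<And>s. s \<in> \<Omega> \<Longrightarrow> (P has_field_derivative G s) (at s within \<Omega>)"
    using holomorphic_convex_primitive'[OF convex_dom open_dom hol] by blast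
  then show ?thesis using open_dom by (metis at_within_open)
qed

text \<open>With a primitive of G the integrals of Re G over vertical edges and of Im G over
  horizontal ones both become differences of Im P at corners.\<close>

definition P :: "complex \<Rightarrow> complex" where
  "P = (SOME P. \<forall>s\<in>\<Omega>. (P has_field_derivative G s) (at s))"

lemma P_deriv: "s \<in> \<Omega> \<Longrightarrow> (P has_field_derivative G s) (at s)"
  using someI_ex[OF primitive_exists] unfolding P_def by blast

definition log_int :: "real \<Rightarrow> real" where
  "log_int x = Im (P (Complex x T2)) - Im (P (Complex x T1)) +
     (\<Sum>z\<in>Z. real (m z) * (log_primitive (x - Re z) (T2 - Im z) - log_primitive (x - Re z) (T1 - Im z)))"

lemma log_has_integral:
  assumes x: "a \<le> x" "x \<le> b"
  shows "((\<lambda>t. ln (norm (f (Complex x t)))) has_integral log_int x) {T1..T2}"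
proof -
  have G: "((\<lambda>t. Re (G (Complex x t))) has_integral Im (P (Complex x T2)) - Im (P (Complex x T1))) {T1..T2}"
  proof (rule fundamental_theorem_of_calculus)
    fix t assume t: "t \<in> {T1..T2}"
    have "((\<lambda>t. P (Complex x t)) has_vector_derivative \<i> * G (Complex x t)) (at t within {T1..T2})"
    proof (rule field_vector_diff_chain_within[unfolded o_def, where f = "\<lambda>t. Complex x t" and g = P])
      have "((\<lambda>t. of_real x + \<i> * of_real t) has_vector_derivative \<i>) (at t within {T1..T2})"
        by (auto intro!: derivative_eq_intros)
      moreover have "Complex x = (\<lambda>t. of_real x + \<i> * of_real t)" by (simp add: Complex_eq fun_eq_iff)
      ultimately show "(Complex x has_vector_derivative \<i>) (at t within {T1..T2})" by simp
      show "(P has_field_derivative G (Complex x t)) (at (Complex x t) within Complex x ` {T1..T2})"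
        using P_deriv[OF rect[OF x]] t by (auto intro: has_field_derivative_at_within)
    qed
    then have "((\<lambda>t. Im (P (Complex x t))) has_vector_derivative Im (\<i> * G (Complex x t))) (at t within {T1..T2})"
      by (rule bounded_linear.has_vector_derivative[OF bounded_linear_Im])
    then show "((\<lambda>t. Im (P (Complex x t))) has_vector_derivative Re (G (Complex x t))) (at t within {T1..T2})"
      by simp
  qed (use T12 in simp)
  have "((\<lambda>t. Re (G (Complex x t)) + (\<Sum>z\<in>Z. real (m z) * ln (norm (Complex (x - Re z) (t - Im z))))) has_integral log_int x) {T1..T2}"
    unfolding log_int_def using T12
    by (intro has_integral_add G has_integral_sum fin has_integral_mult_right ln_norm_has_integral) auto
  then show ?thesis
  \<comment> \<open>At the ordinates of zeros the logarithm of the product need not split, but these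
    are finitely many points.\<close>
  proof (rule has_integral_spike_finite[rotated 2])
    show "finite (Im ` Z)" using fin by simp
    fix t assume t: "t \<in> {T1..T2} - Im ` Z"
    then have dom: "Complex x t \<in> \<Omega>" using rect[OF x] by auto
    have nz: "Complex x t - z \<noteq> 0" if "z \<in> Z" for z using t that by force
    have "ln (norm (f (Complex x t))) = Re (G (Complex x t)) + ln (\<Prod>z\<in>Z. norm (Complex x t - z) ^ m z)"
      using nz fin by (subst f_eq[OF dom], subst norm_mult, subst ln_mult)
        (auto simp: prod_norm[symmetric] norm_power intro!: prod_pos)
    also have "ln (\<Prod>z\<in>Z. norm (Complex x t - z) ^ m z) = (\<Sum>z\<in>Z. ln (norm (Complex x t - z) ^ m z))"
      using nz by (intro ln_prod) (use fin in auto)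
    also have "\<dots> = (\<Sum>z\<in>Z. real (m z) * ln (norm (Complex (x - Re z) (t - Im z))))"
    proof (intro sum.cong refl)
      fix z assume "z \<in> Z"
      have "Complex x t - z = Complex (x - Re z) (t - Im z)" by (simp add: complex_eq_iff)
      then show "ln (norm (Complex x t - z) ^ m z) = real (m z) * ln (norm (Complex (x - Re z) (t - Im z)))"
        using nz[OF \<open>z \<in> Z\<close>] by (simp add: ln_realpow)
    qed
    finally show "ln (norm (f (Complex x t))) = Re (G (Complex x t)) +
       (\<Sum>z\<in>Z. real (m z) * ln (norm (Complex (x - Re z) (t - Im z))))" .
  qed
qed

text \<open>Half of the Littlewood weight \<open>2 * pi * (Re z - a)\<close>, since each of the two
  horizontal sides supplies one half. A zero on the right edge gets half of that, in accordance with
  a phase that is continued through it.\<close>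

definition edge :: "complex \<Rightarrow> real" where
  "edge z = (if Re z = b then pi * (b - a) / 2 else pi * (Re z - a))"

definition hor_reg :: "real \<Rightarrow> complex \<Rightarrow> real" where
  "hor_reg h z = (a - b) * arctan ((h - Im z) / (b - Re z)) +
     log_primitive (b - Re z) (h - Im z) - log_primitive (a - Re z) (h - Im z)"

text \<open>Separates the jump, which depends only on the side of the zero on which h lies, from
  \<open>hor_reg\<close>, which is continuous in h. One-sided limits can then be read off.\<close>

lemma hor_term_factor:
  assumes z: "z \<in> Z" and k: "h - Im z \<noteq> 0"
  shows "(b - a) * arctan ((b - Re z) / (h - Im z)) -
           (arctan_primitive (h - Im z) (b - Re z) - arctan_primitive (h - Im z) (a - Re z)) =
         sgn (h - Im z) * edge z + hor_reg h z"
proof -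
  note zr = Z_rect[OF z]
  have "(b - a) * arctan ((b - Re z) / (h - Im z)) = (b - a) * (sgn (b - Re z) * sgn (h - Im z) * (pi / 2)) -
    (b - a) * arctan ((h - Im z) / (b - Re z))"
    by (subst arctan_swap[OF k]) (simp add: right_diff_distrib)
  moreover have "\<bar>b - Re z\<bar> = b - Re z" "\<bar>a - Re z\<bar> = Re z - a" using zr by auto
  moreover have "sgn (b - Re z) = (if Re z = b then 0 else 1)" using zr by (auto simp: sgn_if)
  ultimately have 1: "(b - a) * arctan ((b - Re z) / (h - Im z)) =
      (if Re z = b then 0 else (b - a) * (sgn (h - Im z) * (pi / 2))) - (b - a) * arctan ((h - Im z) / (b - Re z))"
    and 2: "\<bar>b - Re z\<bar> = b - Re z" "\<bar>a - Re z\<bar> = Re z - a" by simp_all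
  show ?thesis
    unfolding log_arctan_primitive[OF k] hor_reg_def edge_def 1 2
    by (cases "Re z = b") (simp_all add: field_simps)
qed

lemma horizontal_term_eq:
  assumes h: "T1 \<le> h" "h \<le> T2" "h \<notin> Im ` Z"
  shows "horizontal_term f a b h = Im (P (Complex b h)) - Im (P (Complex a h)) -
     (b - a) * Im (G (Complex b h)) + (\<Sum>z\<in>Z. real (m z) * (sgn (h - Im z) * edge z + hor_reg h z))"
proof -
  have G: "((\<lambda>x. Im (G (Complex x h))) has_integral Im (P (Complex b h)) - Im (P (Complex a h))) {a..b}"
  proof (rule fundamental_theorem_of_calculus)
    fix x assume x: "x \<in> {a..b}"
    have "((\<lambda>x. P (Complex x h)) has_vector_derivative 1 * G (Complex x h)) (at x within {a..b})"
    proof (rule field_vector_diff_chain_within[unfolded o_def, where f = "\<lambda>x. Complex x h" and g = P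
        and f' = 1 and g' = "G (Complex x h)" and x = x and S = "{a..b}"])
      have "((\<lambda>x. of_real x :: complex) has_vector_derivative of_real 1) (at x within {a..b})"
        by (rule bounded_linear.has_vector_derivative[OF bounded_linear_of_real has_vector_derivative_id])
      from has_vector_derivative_add[OF this has_vector_derivative_const[of "\<i> * of_real h"]]
      show "((\<lambda>x. Complex x h) has_vector_derivative 1) (at x within {a..b})"
        by (simp add: Complex_eq)
      show "(P has_field_derivative G (Complex x h)) (at (Complex x h) within (\<lambda>x. Complex x h) ` {a..b})"
        using P_deriv[OF rect] h x by (auto intro: has_field_derivative_at_within)
    qed
    then have "((\<lambda>x. Im (P (Complex x h))) has_vector_derivative Im (1 * G (Complex x h))) (at x within {a..b})"
      by (rule bounded_linear.has_vector_derivative[OF bounded_linear_Im])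
    then show "((\<lambda>x. Im (P (Complex x h))) has_vector_derivative Im (G (Complex x h))) (at x within {a..b})"
      by simp
  qed (use ab in simp)
  have k: "h - Im z \<noteq> 0" if "z \<in> Z" for z using h(3) that by auto
  have const: "((\<lambda>x. c) has_integral (b - a) * c) {a..b}" for c :: real
    using has_integral_const_real[of c a b] ab by simp
  have "(inc h has_integral (Im (P (Complex b h)) - Im (P (Complex a h)) - (b - a) * Im (G (Complex b h)) +
     (\<Sum>z\<in>Z. real (m z) * ((b - a) * arctan ((b - Re z) / (h - Im z)) -
           (arctan_primitive (h - Im z) (b - Re z) - arctan_primitive (h - Im z) (a - Re z)))))) {a..b}"
    unfolding inc_def[abs_def] using ab
    by (intro has_integral_add has_integral_diff G const has_integral_sum fin has_integral_mult_right
        arctan_has_integral k) auto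
  moreover have "(\<Sum>z\<in>Z. real (m z) * ((b - a) * arctan ((b - Re z) / (h - Im z)) -
           (arctan_primitive (h - Im z) (b - Re z) - arctan_primitive (h - Im z) (a - Re z)))) =
      (\<Sum>z\<in>Z. real (m z) * (sgn (h - Im z) * edge z + hor_reg h z))"
    by (intro sum.cong refl arg_cong2[where f = times] hor_term_factor k)
  ultimately have "(inc h has_integral (Im (P (Complex b h)) - Im (P (Complex a h)) -
     (b - a) * Im (G (Complex b h)) + (\<Sum>z\<in>Z. real (m z) * (sgn (h - Im z) * edge z + hor_reg h z)))) {a..b}"
    by simp
  moreover have "horizontal_term f a b h = integral {a..b} (inc h)"
    unfolding horizontal_term_def using arg_increment_eq[OF h] by (intro integral_cong) auto
  ultimately show ?thesis by (simp add: integral_unique)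
qed

text \<open>
  The value that the formula for \<open>horizontal_term f a b\<close> approaches at height \<open>h\<close>; at a zero of
  height \<open>h\<close> the sign \<open>sg\<close> records the side from which \<open>h\<close> is approached.
\<close>

definition hor_limit :: "(complex \<Rightarrow> real) \<Rightarrow> real \<Rightarrow> real" where
  "hor_limit sg h = Im (P (Complex b h)) - Im (P (Complex a h)) -
     (b - a) * Im (G (Complex b h)) + (\<Sum>z\<in>Z. real (m z) * (sg z * edge z + hor_reg h z))"

lemma tendsto_hor_limit:
  assumes h: "T1 \<le> h" "h \<le> T2" and lim: "(q \<longlongrightarrow> h) F"
  shows "((\<lambda>x. hor_limit sg (q x)) \<longlongrightarrow> hor_limit sg h) F"
proof -
  have P: "isCont P s" if "s \<in> \<Omega>" for s
    using P_deriv[OF that] by (rule DERIV_isCont)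
  have G: "isCont G s" if "s \<in> \<Omega>" for s
    using continuous_on_interior[OF holomorphic_on_imp_continuous_on[OF hol]] open_dom that
    by (simp add: interior_open)
  have c: "((\<lambda>x. Complex s (q x)) \<longlongrightarrow> Complex s h) F" for s
    by (intro tendsto_Complex lim tendsto_const)
  have r: "Complex a h \<in> \<Omega>" "Complex b h \<in> \<Omega>" using ab h by (auto intro!: rect)
  have lp: "((\<lambda>x. log_primitive s (q x - g)) \<longlongrightarrow> log_primitive s (h - g)) F" for s g
    by (intro isCont_tendsto_compose[OF continuous_log_primitive] tendsto_diff lim tendsto_const)
  have at: "((\<lambda>x. (q x - g) / s) \<longlongrightarrow> (h - g) / s) F" for s g
  proof (cases "s = 0")
    case False
    then show ?thesis by (intro tendsto_divide tendsto_diff lim tendsto_const)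
  qed simp
  note Pc = isCont_tendsto_compose[OF P[OF r(1)] c] isCont_tendsto_compose[OF P[OF r(2)] c]
  note Gc = isCont_tendsto_compose[OF G[OF r(2)] c]
  have reg: "((\<lambda>x. hor_reg (q x) z) \<longlongrightarrow> hor_reg h z) F" for z
    unfolding hor_reg_def
    by (intro tendsto_add tendsto_diff tendsto_mult tendsto_const tendsto_arctan lp at)
  show ?thesis
    unfolding hor_limit_def
    by (intro tendsto_add tendsto_diff tendsto_mult tendsto_const tendsto_sum tendsto_Im Pc Gc reg)
qed

lemma horizontal_term_hor_limit:
  assumes h: "T1 \<le> h" "h \<le> T2" and sg: "\<And>z. z \<in> Z \<Longrightarrow> sgn (h - Im z) = sg z" "\<And>z. sg z \<noteq> 0"
  shows "horizontal_term f a b h = hor_limit sg h"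
proof -
  have "h \<notin> Im ` Z"
  proof
    assume "h \<in> Im ` Z"
    then obtain z where "z \<in> Z" "h = Im z" by blast
    then show False using sg(1)[of z] sg(2)[of z] by simp
  qed
  then show ?thesis
    using h sg(1) by (simp add: horizontal_term_eq hor_limit_def)
qed

text \<open>Z is finite, so for small positive \<eta> no zero lies at the heights in question and
  all signs have settled. A zero on a horizontal side is seen from inside the rectangle.\<close>

lemma horizontal_tendsto:
  "((\<lambda>\<eta>. horizontal_term f a b (T2 - \<eta>) - horizontal_term f a b (T1 + \<eta>)) \<longlongrightarrow>
     hor_limit (\<lambda>z. if Im z = T2 then -1 else 1) T2 - hor_limit (\<lambda>z. if Im z = T1 then 1 else -1) T1)
     (at_right 0)"
proof -
  let ?s2 = "\<lambda>z. if Im z = T2 then -1 else 1 :: real"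
  let ?s1 = "\<lambda>z. if Im z = T1 then 1 else -1 :: real"
  have pos: "\<forall>\<^sub>F \<eta> in at_right (0 :: real). \<eta> > 0" by (rule eventually_at_right_less)
  have lt: "\<forall>\<^sub>F \<eta> in at_right (0 :: real). \<eta> < d" if "d > 0" for d
    using eventually_at_right_real[OF that] by (rule eventually_mono) simp
  have ev2: "\<forall>\<^sub>F \<eta> in at_right 0. \<forall>z\<in>Z. sgn (T2 - \<eta> - Im z) = ?s2 z"
  proof (intro eventually_ball_finite fin ballI)
    fix z assume z: "z \<in> Z"
    show "\<forall>\<^sub>F \<eta> in at_right 0. sgn (T2 - \<eta> - Im z) = ?s2 z"
    proof (cases "Im z = T2")
      case False
      then have "T2 - Im z > 0" using Z_rect[OF z] by simp
      from lt[OF this] show ?thesis by (rule eventually_mono) (use False in simp)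
    next
      case True
      from pos show ?thesis by (rule eventually_mono) (use True in simp)
    qed
  qed
  have ev1: "\<forall>\<^sub>F \<eta> in at_right 0. \<forall>z\<in>Z. sgn (T1 + \<eta> - Im z) = ?s1 z"
  proof (intro eventually_ball_finite fin ballI)
    fix z assume z: "z \<in> Z"
    show "\<forall>\<^sub>F \<eta> in at_right 0. sgn (T1 + \<eta> - Im z) = ?s1 z"
    proof (cases "Im z = T1")
      case False
      then have "Im z - T1 > 0" using Z_rect[OF z] by simp
      from lt[OF this] show ?thesis by (rule eventually_mono) (use False in simp)
    next
      case True
      from pos show ?thesis by (rule eventually_mono) (use True in simp)
    qed
  qed
  have "T2 - T1 > 0" using T12 by simp
  note evT = lt[OF this]
  have eq: "\<forall>\<^sub>F \<eta> in at_right 0. hor_limit ?s2 (T2 - \<eta>) - hor_limit ?s1 (T1 + \<eta>) =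
      horizontal_term f a b (T2 - \<eta>) - horizontal_term f a b (T1 + \<eta>)"
    using ev1 ev2 pos evT
  proof eventually_elim
    case (elim \<eta>)
    have "horizontal_term f a b (T2 - \<eta>) = hor_limit ?s2 (T2 - \<eta>)"
      by (rule horizontal_term_hor_limit) (use elim in auto)
    moreover have "horizontal_term f a b (T1 + \<eta>) = hor_limit ?s1 (T1 + \<eta>)"
      by (rule horizontal_term_hor_limit) (use elim in auto)
    ultimately show ?case by simp
  qed
  have id: "((\<lambda>\<eta>. \<eta>) \<longlongrightarrow> (0::real)) (at_right 0)" by (rule tendsto_ident_at)
  have q: "((\<lambda>\<eta>. T2 - \<eta>) \<longlongrightarrow> T2) (at_right 0)" "((\<lambda>\<eta>. T1 + \<eta>) \<longlongrightarrow> T1) (at_right 0)"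
    using tendsto_diff[OF tendsto_const id, of T2] tendsto_add[OF tendsto_const id, of T1] by auto
  have "((\<lambda>\<eta>. hor_limit ?s2 (T2 - \<eta>) - hor_limit ?s1 (T1 + \<eta>)) \<longlongrightarrow> hor_limit ?s2 T2 - hor_limit ?s1 T1) (at_right 0)"
    using T12 by (intro tendsto_diff tendsto_hor_limit q) simp_all
  then show ?thesis using eq by (rule Lim_transform_eventually)
qed

text \<open>For one linear factor the logarithmic primitives and the arctangents cancel and
  \<open>(s2 z - s1 z) * edge z\<close> is left: twice the edge weight strictly between the
  horizontal sides, and 0 on them. The phase increment on the right edge enters because arguments
  are continued from that edge without being normalised there.\<close>

lemma littlewood:
  "log_int a - log_int b +
     (hor_limit (\<lambda>z. if Im z = T2 then -1 else 1) T2 - hor_limit (\<lambda>z. if Im z = T1 then 1 else -1) T1) +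
     (b - a) * (vphase b T2 - vphase b T1) =
   (\<Sum>z\<in>Z. real (m z) * (if T1 < Im z \<and> Im z < T2 then 2 * edge z else 0))"
proof -
  define s2 s1 :: "complex \<Rightarrow> real"
    where "s2 z = (if Im z = T2 then -1 else 1)" and "s1 z = (if Im z = T1 then 1 else -1)" for z
  define A B C D E F where
    "A z = real (m z) * (log_primitive (a - Re z) (T2 - Im z) - log_primitive (a - Re z) (T1 - Im z))" and
    "B z = real (m z) * (log_primitive (b - Re z) (T2 - Im z) - log_primitive (b - Re z) (T1 - Im z))" and
    "C z = real (m z) * (s2 z * edge z + hor_reg T2 z)" and
    "D z = real (m z) * (s1 z * edge z + hor_reg T1 z)" and
    "E z = real (m z) * (arctan ((T2 - Im z) / (b - Re z)) + (if b = Re z then pi / 2 else 0))" and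
    "F z = real (m z) * (arctan ((T1 - Im z) / (b - Re z)) + (if b = Re z then pi / 2 else 0))" for z
  have "(\<Sum>z\<in>Z. real (m z) * (if T1 < Im z \<and> Im z < T2 then 2 * edge z else 0)) =
    (\<Sum>z\<in>Z. A z - B z + (C z - D z) + (b - a) * (E z - F z))"
  proof (intro sum.cong refl)
    fix z assume "z \<in> Z"
    have "T1 \<le> Im z" "Im z \<le> T2" using Z_rect[OF \<open>z \<in> Z\<close>] by auto
    then have 1: "(if T1 < Im z \<and> Im z < T2 then 2 * edge z else 0) = (s2 z - s1 z) * edge z"
      using T12 by (simp add: s1_def s2_def)
    show "real (m z) * (if T1 < Im z \<and> Im z < T2 then 2 * edge z else 0) =
       A z - B z + (C z - D z) + (b - a) * (E z - F z)"
      unfolding 1 A_def B_def C_def D_def E_def F_def hor_reg_def by (simp only: algebra_simps)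
  qed
  also have "\<dots> = sum A Z - sum B Z + (sum C Z - sum D Z) + (b - a) * (sum E Z - sum F Z)"
    by (simp only: sum.distrib sum_subtractf sum_distrib_left[symmetric])
  finally have sums: "(\<Sum>z\<in>Z. real (m z) * (if T1 < Im z \<and> Im z < T2 then 2 * edge z else 0)) =
      sum A Z - sum B Z + (sum C Z - sum D Z) + (b - a) * (sum E Z - sum F Z)" .
  have la: "log_int a = Im (P (Complex a T2)) - Im (P (Complex a T1)) + sum A Z"
    by (simp only: log_int_def A_def[abs_def])
  have lb: "log_int b = Im (P (Complex b T2)) - Im (P (Complex b T1)) + sum B Z"
    by (simp only: log_int_def B_def[abs_def])
  have h2: "hor_limit (\<lambda>z. if Im z = T2 then -1 else 1) T2 =
      Im (P (Complex b T2)) - Im (P (Complex a T2)) - (b - a) * Im (G (Complex b T2)) + sum C Z"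
    by (simp only: hor_limit_def C_def[abs_def] s2_def)
  have h1: "hor_limit (\<lambda>z. if Im z = T1 then 1 else -1) T1 =
      Im (P (Complex b T1)) - Im (P (Complex a T1)) - (b - a) * Im (G (Complex b T1)) + sum D Z"
    by (simp only: hor_limit_def D_def[abs_def] s1_def)
  have p2: "vphase b T2 = Im (G (Complex b T2)) + sum E Z"
    by (simp only: vphase_def E_def[abs_def])
  have p1: "vphase b T1 = Im (G (Complex b T1)) + sum F Z"
    by (simp only: vphase_def F_def[abs_def])
  show ?thesis unfolding sums la lb h1 h2 p1 p2 by (simp add: algebra_simps)
qed

text \<open>The phase is continued through zeros on the vertical edges, so each of these counts pi
  instead of \<open>2 * pi\<close>.\<close>

lemma argument_principle:
  assumes "T1 \<notin> Im ` Z" "T2 \<notin> Im ` Z"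
  shows "inc T2 a - inc T1 a + (vphase b T2 - vphase b T1) - (vphase a T2 - vphase a T1) =
    (\<Sum>z\<in>Z. real (m z) * (pi * ((if Re z = b then 0 else 1) + (if Re z = a then 0 else 1))))"
proof -
  define A B C D E F where
    "A z = real (m z) * (arctan ((b - Re z) / (T2 - Im z)) - arctan ((a - Re z) / (T2 - Im z)))" and
    "B z = real (m z) * (arctan ((b - Re z) / (T1 - Im z)) - arctan ((a - Re z) / (T1 - Im z)))" and
    "C z = real (m z) * (arctan ((T2 - Im z) / (b - Re z)) + (if b = Re z then pi / 2 else 0))" and
    "D z = real (m z) * (arctan ((T1 - Im z) / (b - Re z)) + (if b = Re z then pi / 2 else 0))" and
    "E z = real (m z) * (arctan ((T2 - Im z) / (a - Re z)) + (if a = Re z then pi / 2 else 0))" and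
    "F z = real (m z) * (arctan ((T1 - Im z) / (a - Re z)) + (if a = Re z then pi / 2 else 0))" for z
  have "(\<Sum>z\<in>Z. real (m z) * (pi * ((if Re z = b then 0 else 1) + (if Re z = a then 0 else 1)))) =
    (\<Sum>z\<in>Z. A z - B z + (C z - D z) - (E z - F z))"
  proof (intro sum.cong refl)
    fix z assume z: "z \<in> Z"
    have r: "a \<le> Re z" "Re z \<le> b" "T1 < Im z" "Im z < T2"
      using Z_rect[OF z] assms z by (auto simp: order.strict_iff_order)
    have k: "T2 - Im z \<noteq> 0" "T1 - Im z \<noteq> 0" "sgn (T2 - Im z) = 1" "sgn (T1 - Im z) = -1"
      "sgn (b - Re z) = (if Re z = b then 0 else 1)" "sgn (a - Re z) = (if Re z = a then 0 else -1)"
      using r by (auto simp: sgn_if)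
    show "real (m z) * (pi * ((if Re z = b then 0 else 1) + (if Re z = a then 0 else 1))) =
       A z - B z + (C z - D z) - (E z - F z)"
      unfolding A_def B_def C_def D_def E_def F_def
      unfolding arctan_swap[OF k(1)] arctan_swap[OF k(2)] k(3-)
      by (cases "Re z = b"; cases "Re z = a") (simp_all add: field_simps)
  qed
  also have "\<dots> = sum A Z - sum B Z + (sum C Z - sum D Z) - (sum E Z - sum F Z)"
    by (simp only: sum.distrib sum_subtractf)
  finally have sums: "(\<Sum>z\<in>Z. real (m z) * (pi * ((if Re z = b then 0 else 1) + (if Re z = a then 0 else 1)))) =
      sum A Z - sum B Z + (sum C Z - sum D Z) - (sum E Z - sum F Z)" .
  have i2: "inc T2 a = Im (G (Complex a T2)) - Im (G (Complex b T2)) + sum A Z"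
    by (simp only: inc_def A_def[abs_def])
  have i1: "inc T1 a = Im (G (Complex a T1)) - Im (G (Complex b T1)) + sum B Z"
    by (simp only: inc_def B_def[abs_def])
  have p: "vphase b T2 = Im (G (Complex b T2)) + sum C Z" "vphase b T1 = Im (G (Complex b T1)) + sum D Z"
    "vphase a T2 = Im (G (Complex a T2)) + sum E Z" "vphase a T1 = Im (G (Complex a T1)) + sum F Z"
    by (simp_all only: vphase_def C_def[abs_def] D_def[abs_def] E_def[abs_def] F_def[abs_def])
  show ?thesis unfolding sums i1 i2 p by (simp add: algebra_simps)
qed

end

section \<open>Littlewood's lemma as an inequality\<close>

lemma rect_eq: "{s. a \<le> Re s \<and> Re s \<le> b \<and> c \<le> Im s \<and> Im s \<le> d} = cbox (Complex a c) (Complex b d)"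
  by (auto simp: in_cbox_complex_iff)

lemma rect_factorization_exists:
  assumes hol: "f holomorphic_on \<Omega>" and \<Omega>: "open \<Omega>" "convex \<Omega>" and nz: "\<exists>w\<in>\<Omega>. f w \<noteq> 0"
    and ab: "a < b" "T1 < T2"
    and rect: "{s. a \<le> Re s \<and> Re s \<le> b \<and> T1 \<le> Im s \<and> Im s \<le> T2} \<subseteq> \<Omega>"
  defines "Z \<equiv> {s. a \<le> Re s \<and> Re s \<le> b \<and> T1 \<le> Im s \<and> Im s \<le> T2 \<and> f s = 0}"
  obtains \<Omega>' G where "rect_factorization f G Z (\<lambda>z. nat (zorder f z)) \<Omega>' a b T1 T2"
    "\<And>z. z \<in> Z \<Longrightarrow> zorder f z > 0" "\<Omega>' \<subseteq> \<Omega>"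
proof -
  define K where "K = cbox (Complex a T1) (Complex b T2)"
  have K: "K = {s. a \<le> Re s \<and> Re s \<le> b \<and> T1 \<le> Im s \<and> Im s \<le> T2}"
    by (simp add: rect_eq K_def)
  have Z: "Z = {z\<in>K. f z = 0}" by (auto simp: K Z_def)
  have "compact K" "convex K" by (simp_all add: K_def)
  moreover have "Complex a T1 \<in> K" using ab by (simp add: K)
  then have "K \<noteq> {}" by blast
  moreover have "K \<subseteq> \<Omega>" using rect by (auto simp: K)
  ultimately obtain \<Omega>' G where F: "open \<Omega>'" "convex \<Omega>'" "K \<subseteq> \<Omega>'" "\<Omega>' \<subseteq> \<Omega>" "G holomorphic_on \<Omega>'" "finite Z"
    "\<And>s. s \<in> \<Omega>' \<Longrightarrow> f s = exp (G s) * (\<Prod>z\<in>Z. (s - z) ^ nat (zorder f z))"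
    "\<And>z. z \<in> Z \<Longrightarrow> zorder f z > 0"
    using zero_factorization[OF hol \<Omega> _ _ _ _ nz, of K, folded Z] by blast
  have "rect_factorization f G Z (\<lambda>z. nat (zorder f z)) \<Omega>' a b T1 T2"
  proof
    show "Complex x y \<in> \<Omega>'" if "a \<le> x" "x \<le> b" "T1 \<le> y" "y \<le> T2" for x y
      using F(3) that by (auto simp: K)
    show "a \<le> Re z \<and> Re z \<le> b \<and> T1 \<le> Im z \<and> Im z \<le> T2" if "z \<in> Z" for z
      using that by (simp add: Z_def)
    show "0 < nat (zorder f z)" if "z \<in> Z" for z using F(8)[OF that] by simp
  qed (use F ab in blast)+
  then show ?thesis using F(8) F(4) by (rule that)
qed

text \<open>Zeros off the right edge have nonnegative weight and are dropped. Zeros on the open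
  right edge keep at least \<open>pi * (b - a)\<close> each, to be set against their share in a
  bound for the phase; phase and signed modulus are exported for that purpose.\<close>

lemma littlewood_inequality:
  assumes hol: "f holomorphic_on \<Omega>" and \<Omega>: "open \<Omega>" "convex \<Omega>" and nz: "\<exists>w\<in>\<Omega>. f w \<noteq> 0"
    and ab: "a < b" and T: "T > 0"
    and rect: "{s. a \<le> Re s \<and> Re s \<le> b \<and> T \<le> Im s \<and> Im s \<le> 2 * T} \<subseteq> \<Omega>"
  obtains \<phi> R where "continuous_on {T..2*T} \<phi>" "continuous_on {T..2*T} R"
    "\<And>t. t \<in> {T..2*T} \<Longrightarrow> f (Complex b t) = of_real (R t) * cis (\<phi> t)"
    "finite {t\<in>{T..2*T}. f (Complex b t) = 0}"
    "finite {t\<in>{T..2*T}. f (Complex a t) = 0}"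
    "(\<lambda>t. ln (norm (f (Complex a t)))) integrable_on {T..2*T}"
    "(\<lambda>t. ln (norm (f (Complex b t)))) integrable_on {T..2*T}"
    "0 \<le> integral {T..2*T} (\<lambda>t. ln (norm (f (Complex a t)))) - integral {T..2*T} (\<lambda>t. ln (norm (f (Complex b t))))
       + horizontal_contribution f a b T
       + (b - a) * (\<phi> (2*T) - \<phi> T - pi * card {t\<in>{T<..<2*T}. f (Complex b t) = 0})"
proof -
  define Z where "Z = {s. a \<le> Re s \<and> Re s \<le> b \<and> T \<le> Im s \<and> Im s \<le> 2 * T \<and> f s = 0}"
  obtain \<Omega>' G where F: "rect_factorization f G Z (\<lambda>z. nat (zorder f z)) \<Omega>' a b T (2*T)"
  proof -
    have "T < 2 * T" using T by simp
    show thesis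
      by (rule rect_factorization_exists[OF hol \<Omega> nz ab \<open>T < 2 * T\<close> rect, folded Z_def]) (rule that)
  qed
  interpret rect_factorization f G Z "\<lambda>z. nat (zorder f z)" \<Omega>' a b T "2 * T" by (rule F)
  have fz: "finite {t\<in>{T..2*T}. f (Complex x t) = 0}" if "a \<le> x" "x \<le> b" for x
  proof (rule finite_subset)
    show "{t\<in>{T..2*T}. f (Complex x t) = 0} \<subseteq> Im ` Z"
    proof
      fix t assume "t \<in> {t\<in>{T..2*T}. f (Complex x t) = 0}"
      then have "Complex x t \<in> Z" using that by (simp add: Z_def)
      then show "t \<in> Im ` Z" by (metis complex.sel(2) image_eqI)
    qed
  qed (use fin in simp)
  define hl where "hl = hor_limit (\<lambda>z. if Im z = 2 * T then -1 else 1) (2 * T) - hor_limit (\<lambda>z. if Im z = T then 1 else -1) T"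
  have hc: "horizontal_contribution f a b T = hl"
    unfolding horizontal_contribution_def hl_def
    by (intro tendsto_Lim horizontal_tendsto) simp
  define E where "E = {t\<in>{T<..<2*T}. f (Complex b t) = 0}"
  have inj: "inj_on (Complex b) E" by (auto simp: inj_on_def)
  have "(b - a) * (pi * card E) = (\<Sum>z\<in>Complex b ` E. pi * (b - a))"
    using inj by (simp add: card_image)
  also have "\<dots> \<le> (\<Sum>z\<in>Complex b ` E. real (nat (zorder f z)) * (if T < Im z \<and> Im z < 2*T then 2 * edge z else 0))"
  proof (rule sum_mono)
    fix z assume "z \<in> Complex b ` E"
    then obtain t where t: "z = Complex b t" "t \<in> E" by blast
    then have "z \<in> Z" using ab by (auto simp: E_def Z_def)
    then have "1 \<le> real (nat (zorder f z))" using m_pos[of z] by linarith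
    then have "1 * (pi * (b - a)) \<le> real (nat (zorder f z)) * (pi * (b - a))"
      using ab by (intro mult_right_mono) auto
    then show "pi * (b - a) \<le> real (nat (zorder f z)) * (if T < Im z \<and> Im z < 2*T then 2 * edge z else 0)"
      using t by (auto simp: E_def edge_def)
  qed
  also have "\<dots> \<le> (\<Sum>z\<in>Z. real (nat (zorder f z)) * (if T < Im z \<and> Im z < 2*T then 2 * edge z else 0))"
  proof (rule sum_mono2[OF fin])
    show "Complex b ` E \<subseteq> Z" using ab by (auto simp: E_def Z_def)
    fix z assume "z \<in> Z - Complex b ` E"
    then have "a \<le> Re z" using Z_rect by blast
    then have "edge z \<ge> 0" using ab by (simp add: edge_def)
    then show "0 \<le> real (nat (zorder f z)) * (if T < Im z \<and> Im z < 2*T then 2 * edge z else 0)" by simp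
  qed
  finally have "(b - a) * (pi * card E) \<le> log_int a - log_int b + hl + (b - a) * (vphase b (2 * T) - vphase b T)"
    using littlewood by (simp add: hl_def)
  then have ineq: "0 \<le> log_int a - log_int b + hl + (b - a) * (vphase b (2 * T) - vphase b T - pi * card E)"
    by (simp add: right_diff_distrib)
  have la: "integral {T..2*T} (\<lambda>t. ln (norm (f (Complex a t)))) = log_int a"
    using log_has_integral[of a] ab by (intro integral_unique) simp
  have lb: "integral {T..2*T} (\<lambda>t. ln (norm (f (Complex b t)))) = log_int b"
    using log_has_integral[of b] ab by (intro integral_unique) simp
  show ?thesis
  proof (rule that[of "vphase b" "vmod b"])
    show "(\<lambda>t. ln (norm (f (Complex a t)))) integrable_on {T..2*T}"
      "(\<lambda>t. ln (norm (f (Complex b t)))) integrable_on {T..2*T}"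
      using log_has_integral[of a] log_has_integral[of b] ab by (auto simp: integrable_on_def)
    show "f (Complex b t) = of_real (vmod b t) * cis (vphase b t)" if "t \<in> {T..2*T}" for t
      using that ab by (intro vertical_polar) auto
  qed (use ab fz continuous_vphase[of b] continuous_vmod[of b] ineq hc la lb in \<open>auto simp: E_def\<close>)
qed

section \<open>Mean logarithms on Re s = 3 and on the critical line\<close>

lemma norm_Ln_one_plus_le:
  fixes w :: complex
  assumes "norm w < 1 / 2"
  shows "norm (Ln (1 + w)) \<le> 2 * norm w"
  using norm_Ln_le[of w] assms by simp

text \<open>With a primitive P of Ln D on Re s \<ge> 3 the integral is an increment of Im P. It is
  estimated by a detour far to the right, where Ln D is so small that the length T costs at most 1;
  hence a bound independent of T.\<close>

lemma log_integral_right_edge: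
  fixes D :: "complex \<Rightarrow> complex"
  assumes hol: "D holomorphic_on {s. Re s > 2}"
    and bd: "\<And>s. Re s \<ge> 3 \<Longrightarrow> norm (D s - 1) \<le> 3 * 2 powr (- Re s)" and T: "T > 0"
  shows "((\<lambda>t. ln (norm (D (Complex 3 t)))) integrable_on {T..2*T})"
    "integral {T..2*T} (\<lambda>t. ln (norm (D (Complex 3 t)))) \<ge> - 4"
proof -
  define S where "S = {s. Re s \<ge> 3}"
  have cS: "convex S" unfolding S_def by (rule convex_halfspace_Re_ge)
  have lt: "norm (D s - 1) < 1 / 2" if "s \<in> S" for s
  proof -
    have "(2 :: real) powr (- Re s) \<le> 2 powr (- 3)" using that by (intro powr_mono) (auto simp: S_def)
    also have "(2 :: real) powr (- 3) = 1 / 8" by (simp add: powr_minus)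
    finally show ?thesis using bd[of s] that by (simp add: S_def)
  qed
  have D_dom: "D s \<notin> \<real>\<^sub>\<le>\<^sub>0" if "s \<in> S" for s
  proof
    assume "D s \<in> \<real>\<^sub>\<le>\<^sub>0"
    then have "Re (D s) \<le> 0" by (simp add: complex_nonpos_Reals_iff)
    then show False using lt[OF that] abs_Re_le_cmod[of "D s - 1"] by simp
  qed
  have D_nz: "D s \<noteq> 0" if "s \<in> S" for s using D_dom[OF that] by auto
  have SD: "S \<subseteq> {s. Re s > 2}" by (auto simp: S_def)
  have Ln_bd: "norm (Ln (D s)) \<le> 6 * 2 powr (- Re s)" if "s \<in> S" for s
    using norm_Ln_one_plus_le[OF lt[OF that]] bd[of s] that by (simp add: S_def)
  have cont: "continuous_on S (\<lambda>s. Ln (D s))"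
    by (intro continuous_on_Ln' holomorphic_on_imp_continuous_on[OF holomorphic_on_subset[OF hol SD]] D_dom)
  have fd: "(\<lambda>s. Ln (D s)) field_differentiable at s" if "s \<in> S" for s
  proof -
    have "D field_differentiable at s"
      using hol SD that by (auto intro!: holomorphic_on_imp_differentiable_at[OF hol] simp: open_halfspace_Re_gt)
    then show ?thesis
      using field_differentiable_compose[of D s Ln] field_differentiable_at_Ln[OF D_dom[OF that]]
      by (simp add: o_def)
  qed
  obtain P where P: "\<And>s. s \<in> S \<Longrightarrow> (P has_field_derivative Ln (D s)) (at s within S)"
    using holomorphic_convex_primitive[OF cS finite.emptyI cont] fd interior_subset by blast
  have step: "norm (P z - P w) \<le> 6 * 2 powr (- r) * norm (z - w)" if "r \<ge> 3" "Re z \<ge> r" "Re w \<ge> r" for z w r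
  proof (rule field_differentiable_bound[of "{s. Re s \<ge> r}" P "\<lambda>s. Ln (D s)"])
    show "convex {s. Re s \<ge> r}" by (rule convex_halfspace_Re_ge)
    fix s assume s: "s \<in> {s. Re s \<ge> r}"
    then have sS: "s \<in> S" using that by (simp add: S_def)
    show "(P has_field_derivative Ln (D s)) (at s within {s. Re s \<ge> r})"
      using P[OF sS] by (rule DERIV_subset) (use that in \<open>auto simp: S_def\<close>)
    have "norm (Ln (D s)) \<le> 6 * 2 powr (- Re s)" by (rule Ln_bd[OF sS])
    also have "\<dots> \<le> 6 * 2 powr (- r)" using s by (intro mult_left_mono powr_mono) auto
    finally show "norm (Ln (D s)) \<le> 6 * 2 powr (- r)" .
  qed (use that in auto)
  \<comment> \<open>Successive unit steps to the right cost at most 3/4, 3/8, ..., so each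
    horizontal part of the detour costs at most 3/2; with 1 for the far vertical part the total is
    4.\<close>
  have horiz: "norm (P (Complex (3 + real n) h) - P (Complex 3 h)) \<le> 3 / 2 - 3 / 2 * (1 / 2) ^ n" for n h
  proof (induction n)
    case (Suc n)
    have "Complex (3 + real (Suc n)) h - Complex (3 + real n) h = 1" by (simp add: complex_eq_iff)
    then have "norm (P (Complex (3 + real (Suc n)) h) - P (Complex (3 + real n) h)) \<le> 6 * 2 powr (- (3 + real n))"
      using step[of "3 + real n" "Complex (3 + real (Suc n)) h" "Complex (3 + real n) h"] by simp
    also have "2 powr (- (3 + real n)) = (1 / 8) * (1 / 2 :: real) ^ n"
      by (simp add: powr_diff powr_minus powr_realpow power_one_over field_simps)
    finally have "norm (P (Complex (3 + real (Suc n)) h) - P (Complex (3 + real n) h)) \<le> 3 / 4 * (1 / 2) ^ n" by simp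
    then show ?case
      using Suc norm_triangle_ineq[of "P (Complex (3 + real (Suc n)) h) - P (Complex (3 + real n) h)"
          "P (Complex (3 + real n) h) - P (Complex 3 h)"] by simp
  qed simp
  obtain n where n: "T < 2 ^ n" using real_arch_pow[of 2 T] by auto
  have h': "norm (P (Complex (3 + real n) h) - P (Complex 3 h)) \<le> 3 / 2" for h
  proof -
    have "0 \<le> (1 / 2 :: real) ^ n" by simp
    then show ?thesis using horiz[of n h] by linarith
  qed
  have vert: "norm (P (Complex (3 + real n) (2 * T)) - P (Complex (3 + real n) T)) \<le> 1"
  proof -
    have "Complex (3 + real n) (2 * T) - Complex (3 + real n) T = Complex 0 T" by (simp add: complex_eq_iff)
    then have "norm (P (Complex (3 + real n) (2 * T)) - P (Complex (3 + real n) T)) \<le> 6 * 2 powr (- (3 + real n)) * T"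
      using step[of "3 + real n" "Complex (3 + real n) (2 * T)" "Complex (3 + real n) T"] T
      by (simp add: complex_norm)
    also have "2 powr (- (3 + real n)) = (1 / 8) / (2 :: real) ^ n"
      by (simp add: powr_diff powr_minus powr_realpow field_simps)
    also have "6 * (1 / 8 / 2 ^ n) * T \<le> 1" using n T by (simp add: field_simps)
    finally show ?thesis .
  qed
  have "P (Complex 3 (2 * T)) - P (Complex 3 T) =
     (P (Complex (3 + real n) (2 * T)) - P (Complex (3 + real n) T))
     - (P (Complex (3 + real n) (2 * T)) - P (Complex 3 (2 * T)))
     + (P (Complex (3 + real n) T) - P (Complex 3 T))" by simp
  then have "norm (P (Complex 3 (2 * T)) - P (Complex 3 T)) \<le> 1 + 3 / 2 + 3 / 2"
    using vert h'[of "2 * T"] h'[of T] norm_triangle_le norm_triangle_le_diff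
    by (smt (verit, best) norm_triangle_ineq norm_triangle_ineq4)
  then have P4: "norm (P (Complex 3 (2 * T)) - P (Complex 3 T)) \<le> 4" by simp
  have int: "((\<lambda>t. ln (norm (D (Complex 3 t)))) has_integral
      (Im (P (Complex 3 (2 * T))) - Im (P (Complex 3 T)))) {T..2*T}"
  proof (rule fundamental_theorem_of_calculus)
    fix t assume "t \<in> {T..2*T}"
    have tS: "Complex 3 t \<in> S" by (simp add: S_def)
    have "((\<lambda>t. P (Complex 3 t)) has_vector_derivative \<i> * Ln (D (Complex 3 t))) (at t within {T..2*T})"
    proof (rule field_vector_diff_chain_within[unfolded o_def, where f = "\<lambda>t. Complex 3 t" and g = P
          and f' = \<i> and g' = "Ln (D (Complex 3 t))" and x = t and S = "{T..2*T}"])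
      have "((\<lambda>t. of_real 3 + \<i> * of_real t) has_vector_derivative \<i>) (at t within {T..2*T})"
        by (auto intro!: derivative_eq_intros)
      moreover have "Complex 3 = (\<lambda>t. of_real 3 + \<i> * of_real t)" by (simp add: Complex_eq fun_eq_iff)
      ultimately show "(Complex 3 has_vector_derivative \<i>) (at t within {T..2*T})" by simp
      show "(P has_field_derivative Ln (D (Complex 3 t))) (at (Complex 3 t) within Complex 3 ` {T..2*T})"
        using P[OF tS] by (rule DERIV_subset) (auto simp: S_def)
    qed
    then have "((\<lambda>t. Im (P (Complex 3 t))) has_vector_derivative Im (\<i> * Ln (D (Complex 3 t)))) (at t within {T..2*T})"
      by (rule bounded_linear.has_vector_derivative[OF bounded_linear_Im])
    then show "((\<lambda>t. Im (P (Complex 3 t))) has_vector_derivative ln (norm (D (Complex 3 t)))) (at t within {T..2*T})"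
      using D_nz[OF tS] by simp
  qed (use T in simp)
  then show "(\<lambda>t. ln (norm (D (Complex 3 t)))) integrable_on {T..2*T}" by blast
  have "\<bar>Im (P (Complex 3 (2 * T))) - Im (P (Complex 3 T))\<bar> \<le> 4"
    using abs_Im_le_cmod[of "P (Complex 3 (2 * T)) - P (Complex 3 T)"] P4 by simp
  then show "integral {T..2*T} (\<lambda>t. ln (norm (D (Complex 3 t)))) \<ge> - 4"
    using integral_unique[OF int] by simp
qed

lemma phase_increment_right_half_plane:
  fixes g :: "real \<Rightarrow> complex"
  assumes "a \<le> b" "continuous_on {a..b} \<phi>" "continuous_on {a..b} R"
    and rep: "\<And>t. t \<in> {a..b} \<Longrightarrow> g t = of_real (R t) * cis (\<phi> t)"
    and pos: "\<And>t. t \<in> {a..b} \<Longrightarrow> Re (g t) > 0"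
  shows "\<bar>\<phi> b - \<phi> a\<bar> \<le> pi"
proof -
  have Rc: "R t * cos (\<phi> t) > 0" if "t \<in> {a..b}" for t
    using pos[OF that] rep[OF that] by simp
  have "\<bar>\<phi> b - \<phi> a\<bar> \<le> pi * (card ({} :: real set) + 1)"
  proof (rule phase_increment_real_part_le[OF assms(1-3)])
    show "{t \<in> {a<..<b}. R t = 0} \<subseteq> {}"
    proof
      fix t assume t: "t \<in> {t \<in> {a<..<b}. R t = 0}"
      then have "t \<in> {a..b}" by simp
      from Rc[OF this] t show "t \<in> {}" by simp
    qed
    fix u v assume "a \<le> u" "u < v" "v \<le> b"
    then have "\<forall>t\<in>{u<..<v}. R t * cos (\<phi> t) \<ge> 0" using Rc by (auto intro!: less_imp_le)
    then show "(\<forall>t\<in>{u<..<v}. R t * cos (\<phi> t) \<ge> 0) \<or> (\<forall>t\<in>{u<..<v}. R t * cos (\<phi> t) \<le> 0)" ..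
  qed simp
  then show ?thesis by simp
qed

text \<open>On Re s = 3 the real part of D is positive, which limits the phase increment to pi; 5/2
  is the width of the rectangle. The lemma serves both \<open>zeta\<close> and the mollifier, and
  the two half-planes avoid the pole of \<open>zeta\<close>.\<close>

lemma critical_line_log_integral:
  fixes D :: "complex \<Rightarrow> complex"
  assumes hol: "D holomorphic_on {s. Im s > 0}" "D holomorphic_on {s. Re s > 2}"
    and bd: "\<And>s. Re s \<ge> 3 \<Longrightarrow> norm (D s - 1) \<le> 3 * 2 powr (- Re s)" and T: "T > 0"
  shows "(\<lambda>t. ln (norm (D (Complex (1/2) t)))) integrable_on {T..2*T}"
    "integral {T..2*T} (\<lambda>t. ln (norm (D (Complex (1/2) t)))) \<ge> - 4 - horizontal_contribution D (1/2) 3 T - 5/2 * pi"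
    "finite {t\<in>{T..2*T}. D (Complex (1/2) t) = 0}"
proof -
  have pos: "Re (D (Complex 3 t)) > 0" for t
  proof -
    have "norm (D (Complex 3 t) - 1) \<le> 3 * 2 powr (- 3)" using bd[of "Complex 3 t"] by simp
    then show ?thesis using abs_Re_le_cmod[of "D (Complex 3 t) - 1"] by (simp add: powr_minus)
  qed
  have "D (Complex 3 T) \<noteq> 0" using pos[of T] by auto
  then have nz: "\<exists>w\<in>{s. Im s > 0}. D w \<noteq> 0" using T by (intro bexI[of _ "Complex 3 T"]) auto
  obtain \<phi> R where L: "continuous_on {T..2*T} \<phi>" "continuous_on {T..2*T} R"
    "\<And>t. t \<in> {T..2*T} \<Longrightarrow> D (Complex 3 t) = of_real (R t) * cis (\<phi> t)"
    "finite {t\<in>{T..2*T}. D (Complex (1/2) t) = 0}"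
    "(\<lambda>t. ln (norm (D (Complex (1/2) t)))) integrable_on {T..2*T}"
    "0 \<le> integral {T..2*T} (\<lambda>t. ln (norm (D (Complex (1/2) t)))) - integral {T..2*T} (\<lambda>t. ln (norm (D (Complex 3 t))))
       + horizontal_contribution D (1/2) 3 T
       + (3 - 1/2) * (\<phi> (2*T) - \<phi> T - pi * card {t\<in>{T<..<2*T}. D (Complex 3 t) = 0})"
  proof (rule littlewood_inequality[OF hol(1) _ _ nz, of "1/2" 3 T])
    show "open {s. 0 < Im s}" "convex {s. 0 < Im s}"
      by (simp_all add: open_halfspace_Im_gt convex_halfspace_Im_gt)
  qed (use T in auto)
  have "D (Complex 3 t) \<noteq> 0" for t using pos[of t] by auto
  then have no0: "{t\<in>{T<..<2*T}. D (Complex 3 t) = 0} = {}" by simp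
  have "\<bar>\<phi> (2*T) - \<phi> T\<bar> \<le> pi"
    by (rule phase_increment_right_half_plane[OF _ L(1,2,3)]) (use T pos in auto)
  then have "\<phi> (2*T) - \<phi> T \<le> pi" by simp
  then have "5/2 * (\<phi> (2*T) - \<phi> T) \<le> 5/2 * pi" by (rule mult_left_mono) simp
  moreover have "0 \<le> integral {T..2*T} (\<lambda>t. ln (norm (D (Complex (1/2) t)))) - integral {T..2*T} (\<lambda>t. ln (norm (D (Complex 3 t))))
       + horizontal_contribution D (1/2) 3 T + 5/2 * (\<phi> (2*T) - \<phi> T)"
    using L(6) unfolding no0 by simp
  moreover have "integral {T..2*T} (\<lambda>t. ln (norm (D (Complex 3 t)))) \<ge> - 4"
    by (rule log_integral_right_edge(2)[OF hol(2) bd T])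
  ultimately show "integral {T..2*T} (\<lambda>t. ln (norm (D (Complex (1/2) t)))) \<ge> - 4 - horizontal_contribution D (1/2) 3 T - 5/2 * pi"
    by linarith
  show "(\<lambda>t. ln (norm (D (Complex (1/2) t)))) integrable_on {T..2*T}"
    "finite {t\<in>{T..2*T}. D (Complex (1/2) t) = 0}" by (rule L)+
qed

section \<open>Horizontal argument increments of the zeta function\<close>

text \<open>The zeros are divided out one at a time by Blaschke factors of the disc. This leaves the
  modulus on the circle unchanged and raises the modulus at c by a factor of at least R / r.\<close>

lemma jensen_zero_count:
  fixes f :: "complex \<Rightarrow> complex"
  assumes "finite A" "f holomorphic_on S" and S: "open S" "cball c R \<subseteq> S" and r: "0 < r" "r < R"
    and "\<And>z. norm (z - c) = R \<Longrightarrow> norm (f z) \<le> M"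
    and "A \<subseteq> cball c r" "\<And>a. a \<in> A \<Longrightarrow> f a = 0"
  shows "norm (f c) * (R / r) ^ card A \<le> M"
  using assms(1,2,7-)
proof (induction A arbitrary: f rule: finite_induct)
  case empty
  have "norm (f c) \<le> M"
  proof (rule maximum_modulus_frontier[of f "cball c R"])
    show "f holomorphic_on interior (cball c R)"
      by (rule holomorphic_on_subset[OF empty(1)]) (use S interior_subset in blast)
    show "continuous_on (closure (cball c R)) f"
      using S holomorphic_on_imp_continuous_on[OF holomorphic_on_subset[OF empty(1)], of "cball c R"] by simp
    show "norm (f z) \<le> M" if "z \<in> frontier (cball c R)" for z
      using that by (intro empty(2)) (simp add: dist_norm norm_minus_commute)
    show "c \<in> cball c R" using r by simp
  qed auto
  then show ?case by simp
next
  case (insert a A)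
  have a: "norm (a - c) \<le> r" "f a = 0" using insert.prems by (auto simp: dist_norm norm_minus_commute)
  define h where "h z = (if z = a then deriv f a else (f z - f a) / (z - a))" for z
  \<comment> \<open>The second factor vanishes at the mirror image of a in the circle, when there is
    one, and has modulus \<open>norm (z - a)\<close> on the circle; it undoes there the division
    made in h.\<close>
  define g where "g z = h z * ((of_real (R\<^sup>2) - cnj (a - c) * (z - c)) / of_real R)" for z
  have h: "h holomorphic_on S" unfolding h_def[abs_def] by (rule pole_lemma_open[OF insert.prems(1) S(1)])
  have R: "R > 0" using r by simp
  have gh: "g holomorphic_on S" unfolding g_def[abs_def] using R by (intro holomorphic_intros h) auto
  have "norm (g c) * (R / r) ^ card A \<le> M"
  proof (rule insert.IH[OF gh])
    fix z assume z: "norm (z - c) = R"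
    have za: "z \<noteq> a" using z a r by auto
    have "of_real (R\<^sup>2) - cnj (a - c) * (z - c) = (z - c) * cnj (z - a)"
      unfolding z[symmetric] using complex_norm_square[of "z - c"] by (simp add: algebra_simps)
    then have "norm (g z) = norm (h z) * (norm (z - a))"
      using R z complex_mod_cnj[of "z - a"] by (simp add: g_def norm_mult norm_divide)
    also have "\<dots> = norm (f z)" using za a by (simp add: h_def norm_divide)
    also have "\<dots> \<le> M" by (rule insert.prems(2)[OF z])
    finally show "norm (g z) \<le> M" .
  next
    fix a' assume "a' \<in> A"
    then have "a' \<noteq> a" "f a' = 0" using insert by auto
    then show "g a' = 0" using a by (simp add: g_def h_def)
  qed (use insert.prems in auto)
  moreover have "norm (f c) * (R / r) \<le> norm (g c)"
  proof (cases "c = a")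
    case False
    have gc: "norm (g c) = norm (f c) * R / norm (a - c)"
      using False a R by (simp add: g_def h_def norm_mult norm_divide power2_eq_square norm_minus_commute)
    have "0 < norm (a - c)" using False by simp
    then have "norm (f c) * R / r \<le> norm (f c) * R / norm (a - c)"
      using R a r by (intro divide_left_mono) (auto intro!: mult_pos_pos)
    then show ?thesis using gc by simp
  qed (use a in simp)
  then have "norm (f c) * (R / r) * (R / r) ^ card A \<le> norm (g c) * (R / r) ^ card A"
    using r by (intro mult_right_mono) auto
  ultimately show ?case using insert by (simp add: mult_ac)
qed

lemma zeta_holomorphic_upper: "zeta holomorphic_on {s. Im s > 0}"
  by (rule holomorphic_on_subset[OF zeta_properties(1)]) auto

lemma Re_zeta_ge: "Re s \<ge> 3 \<Longrightarrow> Re (zeta s) \<ge> 1 / 2"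
proof -
  assume s: "Re s \<ge> 3"
  have "norm (zeta s - 1) \<le> 3 * 2 powr (- Re s)" by (rule norm_zeta_minus_1_le[OF s])
  also have "\<dots> \<le> 3 * 2 powr (- 3)" using s by (intro mult_left_mono powr_mono) auto
  also have "\<dots> = 3 / 8" by (simp add: powr_minus)
  finally show ?thesis using abs_Re_le_cmod[of "zeta s - 1"] by simp
qed

lemma zeta_nonzero_upper: "\<exists>w\<in>{s. Im s > 0}. zeta w \<noteq> 0"
proof (rule bexI)
  have "Re (zeta (Complex 3 1)) \<ge> 1 / 2" by (rule Re_zeta_ge) simp
  then show "zeta (Complex 3 1) \<noteq> 0" by auto
qed simp

text \<open>
  Backlund's argument: on the segment, \<open>Re zeta\<close> agrees with the function
  \<open>(zeta (s + \<i> h) + zeta (s - \<i> h)) / 2\<close>, whose zeros Jensen's inequality counts.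
\<close>

lemma zeta_real_part_zero_count:
  obtains C where "C > 0" "\<And>h :: real. h \<ge> 4 \<Longrightarrow> finite {x \<in> {1/2..3}. Re (zeta (Complex x h)) = 0} \<and>
     real (card {x \<in> {1/2..3}. Re (zeta (Complex x h)) = 0}) \<le> C * h"
proof -
  obtain K where K: "K > 0" "\<And>s. Re s \<ge> 1 / 4 \<Longrightarrow> \<bar>Im s\<bar> \<ge> 1 \<Longrightarrow> norm (zeta s) \<le> K * 2 powr norm s"
    using zeta_growth by blast
  \<comment> \<open>11/10 is the ratio of the radii 11/4 and 5/2 of two discs about 3. The smaller
    disc contains the segment from 1/2 to 3; the larger one reaches Re s = 1/4, where
    \<open>zeta_growth\<close> still applies.\<close>
  define L where "L = ln (11 / 10 :: real)"
  have L: "L > 0" by (simp add: L_def)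
  define C where "C = (\<bar>ln (2 * K)\<bar> + 7) / L"
  have C: "C > 0" using L by (simp add: C_def add_nonneg_pos)
  have count: "card A \<le> C * h" if h: "h \<ge> 4" and A: "A \<subseteq> {x \<in> {1/2..3}. Re (zeta (Complex x h)) = 0}" "finite A" for A h
  proof -
    define q where "q z = (zeta (z + \<i> * of_real h) + zeta (z - \<i> * of_real h)) / 2" for z
    define S where "S = {z. Im z < h} \<inter> {z. Im z > - h}"
    have S: "open S" "cball 3 (11/4) \<subseteq> S"
    proof -
      show "open S" unfolding S_def by (intro open_Int open_halfspace_Im_lt open_halfspace_Im_gt)
      show "cball 3 (11/4) \<subseteq> S"
      proof
        fix z :: complex assume "z \<in> cball 3 (11/4)"
        then have "\<bar>Im z\<bar> \<le> 11 / 4" using abs_Im_le_cmod[of "z - 3"] by (simp add: dist_norm norm_minus_commute)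
        then show "z \<in> S" using h by (auto simp: S_def abs_le_iff)
      qed
    qed
    have qh: "q holomorphic_on S"
      unfolding q_def[abs_def]
      by (intro holomorphic_intros holomorphic_on_compose_gen[OF _ zeta_properties(1), unfolded o_def])
        (auto simp: S_def complex_eq_iff)
    have qr: "q (of_real x) = of_real (Re (zeta (Complex x h)))" for x
    proof -
      have 1: "of_real x + \<i> * of_real h = Complex x h" "of_real x - \<i> * of_real h = cnj (Complex x h)"
        by (simp_all add: complex_eq_iff)
      have "Complex x h \<noteq> 1" using h by (simp add: complex_eq_iff)
      then show ?thesis unfolding q_def 1 using zeta_cnj by (simp add: complex_add_cnj)
    qed
    have jensen: "norm (q 3) * ((11/4) / (5/2)) ^ card (complex_of_real ` A) \<le> K * 2 powr (6 + h)"
    proof (rule jensen_zero_count[OF _ qh S])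
      show "finite (complex_of_real ` A)" using A by simp
      fix z :: complex assume z: "norm (z - 3) = 11 / 4"
      have "\<bar>Im z\<bar> \<le> 11 / 4" "\<bar>Re z - 3\<bar> \<le> 11 / 4"
        using abs_Im_le_cmod[of "z - 3"] abs_Re_le_cmod[of "z - 3"] z by auto
      \<comment> \<open>Here h \<ge> 4 matters: the shifted discs of radius 11/4 stay at distance at
        least 5/4 from the real axis.\<close>
      then have re: "Re z \<ge> 1 / 4" and im: "Im z + h \<ge> 1" "h - Im z \<ge> 1" using h by linarith+
      have nz: "norm z \<le> 6" using norm_triangle_ineq[of "z - 3" 3] z by simp
      have "norm (z + \<i> * of_real h) \<le> 6 + h" "norm (z - \<i> * of_real h) \<le> 6 + h"
        using norm_triangle_ineq[of z "\<i> * of_real h"] norm_triangle_ineq4[of z "\<i> * of_real h"] nz h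
        by (auto simp: norm_mult)
      then have p: "K * 2 powr norm (z + \<i> * of_real h) \<le> K * 2 powr (6 + h)"
        "K * 2 powr norm (z - \<i> * of_real h) \<le> K * 2 powr (6 + h)"
        using K(1) by (auto intro!: mult_left_mono powr_mono)
      have "norm (zeta (z + \<i> * of_real h)) \<le> K * 2 powr norm (z + \<i> * of_real h)"
        using re im by (intro K(2)) auto
      moreover have "norm (zeta (z - \<i> * of_real h)) \<le> K * 2 powr norm (z - \<i> * of_real h)"
        using re im by (intro K(2)) auto
      ultimately have "norm (zeta (z + \<i> * of_real h)) + norm (zeta (z - \<i> * of_real h)) \<le> 2 * (K * 2 powr (6 + h))"
        using p by linarith
      then show "norm (q z) \<le> K * 2 powr (6 + h)"
        using norm_triangle_ineq[of "zeta (z + \<i> * of_real h)" "zeta (z - \<i> * of_real h)"]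
        by (simp add: q_def norm_divide)
    next
      show "complex_of_real ` A \<subseteq> cball (3 :: complex) (5/2)"
      proof
        fix z :: complex assume "z \<in> complex_of_real ` A"
        then obtain x where "z = of_real x" "1/2 \<le> x" "x \<le> 3" using A by auto
        moreover from this have "dist (3 :: complex) z = \<bar>3 - x\<bar>"
          by (metis dist_of_real dist_real_def of_real_numeral)
        ultimately show "z \<in> cball 3 (5/2)" by simp
      qed
    qed (use A qr in auto)
    have "card (complex_of_real ` A) = card A"
      by (intro card_image) (simp add: inj_on_def)
    then have jensen': "norm (q 3) * (11 / 10) ^ card A \<le> K * 2 powr (6 + h)" using jensen by simp
    have "norm (q 3) \<ge> 1 / 2"
    proof -
      have "q 3 = of_real (Re (zeta (Complex 3 h)))" using qr[of 3] by simp
      moreover have "Re (zeta (Complex 3 h)) \<ge> 1 / 2" by (rule Re_zeta_ge) simp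
      ultimately show ?thesis by simp
    qed
    then have "1 / 2 * (11 / 10) ^ card A \<le> norm (q 3) * (11 / 10) ^ card A"
      by (intro mult_right_mono) auto
    with jensen' have le: "(11 / 10) ^ card A \<le> 2 * K * 2 powr (6 + h)" by linarith
    have "card A * L = ln ((11 / 10) ^ card A)" by (simp add: L_def ln_realpow)
    also have "\<dots> \<le> ln (2 * K * 2 powr (6 + h))" using le by (subst ln_le_cancel_iff) (use K in auto)
    also have "\<dots> = ln (2 * K) + (6 + h) * ln 2" using K by (simp add: ln_mult ln_powr)
    also have "\<dots> \<le> \<bar>ln (2 * K)\<bar> + (6 + h) * 1"
      using h ln_2_less_1 by (intro add_mono mult_left_mono) auto
    also have "\<dots> \<le> (\<bar>ln (2 * K)\<bar> + 7) * h"
    proof -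
      have "\<bar>ln (2 * K)\<bar> * 1 \<le> \<bar>ln (2 * K)\<bar> * h" using h by (intro mult_left_mono) auto
      then show ?thesis using h by (simp add: distrib_right)
    qed
    finally have "card A * L \<le> (\<bar>ln (2 * K)\<bar> + 7) * h" .
    then show ?thesis using L by (simp add: C_def field_simps)
  qed
  \<comment> \<open>The count above was made for arbitrary finite subsets, so a uniform bound on
    their size already gives finiteness of the whole set.\<close>
  have fin: "finite {x \<in> {1/2..3}. Re (zeta (Complex x h)) = 0}" if h: "h \<ge> 4" for h
  proof -
    have "finite {x \<in> {1/2..3}. Re (zeta (Complex x h)) = 0} \<and>
      card {x \<in> {1/2..3}. Re (zeta (Complex x h)) = 0} \<le> nat \<lceil>C * h\<rceil>"
    proof (rule finite_if_finite_subsets_card_bdd)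
      fix G assume G: "G \<subseteq> {x \<in> {1/2..3}. Re (zeta (Complex x h)) = 0}" "finite G"
      from count[OF h G] show "card G \<le> nat \<lceil>C * h\<rceil>" by linarith
    qed
    then show ?thesis by blast
  qed
  show ?thesis by (rule that[OF C]) (use fin count in blast)
qed

text \<open>The real part is the modulus times the cosine of a continuous phase, so between its
  zeros the phase moves by at most pi.\<close>

lemma arg_increment_le_sign_changes:
  fixes f :: "complex \<Rightarrow> complex"
  assumes cont: "continuous_on {0..1} (\<lambda>u. f (linepath p q u))"
    and nz: "\<And>u. u \<in> {0..1} \<Longrightarrow> f (linepath p q u) \<noteq> 0"
    and S: "finite S" "{u \<in> {0..1}. Re (f (linepath p q u)) = 0} \<subseteq> S"
  shows "\<bar>arg_increment f p q\<bar> \<le> pi * (card S + 1)"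
proof -
  have "contractible {0..1 :: real}" by (intro convex_imp_contractible) simp
  then obtain g where g: "continuous_on {0..1} g" "\<And>u. u \<in> {0..1} \<Longrightarrow> f (linepath p q u) = exp (g u)"
    using continuous_logarithm_on_contractible[OF cont _ nz] by blast
  have rep: "f (linepath p q u) = of_real (norm (f (linepath p q u))) * cis (Im (g u))" if "u \<in> {0..1}" for u
    using g(2)[OF that] exp_eq_polar[of "g u"] by (simp add: norm_mult)
  have ai: "arg_increment f p q = Im (g 1) - Im (g 0)"
    by (rule arg_increment_eqI[where \<phi> = "\<lambda>u. Im (g u)"]) (use rep nz g(1) in \<open>auto intro: continuous_on_Im\<close>)
  have "\<bar>Im (g 1) - Im (g 0)\<bar> \<le> pi * (card S + 1)"
  proof (rule phase_increment_real_part_le[of 0 1 "\<lambda>u. Im (g u)" "\<lambda>u. norm (f (linepath p q u))"])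
    show "{t \<in> {0<..<1}. norm (f (linepath p q t)) = 0} \<subseteq> S"
    proof
      fix t assume "t \<in> {t \<in> {0<..<1}. norm (f (linepath p q t)) = 0}"
      then have "t \<in> {0..1}" "f (linepath p q t) = 0" by auto
      then show "t \<in> S" using nz by blast
    qed
    fix u v :: real assume uv: "0 \<le> u" "u < v" "v \<le> 1" "{u<..<v} \<inter> S = {}"
    define X where "X t = norm (f (linepath p q t)) * cos (Im (g t))" for t
    have X: "X t = Re (f (linepath p q t))" if "t \<in> {0..1}" for t
      using arg_cong[OF rep[OF that], of Re] by (simp add: X_def)
    have sub: "{u<..<v} \<subseteq> {0..1}" using uv(1,3) by auto
    have Xnz: "X t \<noteq> 0" if t: "t \<in> {u<..<v}" for t
    proof
      assume "X t = 0"
      moreover have "t \<in> {0..1}" using sub t by blast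
      ultimately have "t \<in> {u \<in> {0..1}. Re (f (linepath p q u)) = 0}" using X by simp
      then show False using S(2) uv(4) t by blast
    qed
    have "continuous_on {u<..<v} X" unfolding X_def
      by (intro continuous_intros continuous_on_subset[OF cont sub] continuous_on_subset[OF g(1) sub])
    then have "connected (X ` {u<..<v})" by (intro connected_continuous_image) auto
    then have "(\<forall>t\<in>{u<..<v}. X t > 0) \<or> (\<forall>t\<in>{u<..<v}. X t < 0)"
      using Xnz connectedD_interval[where U = "X ` {u<..<v}" and z = 0]
      by (smt (verit, best) image_iff)
    then show "(\<forall>t\<in>{u<..<v}. norm (f (linepath p q t)) * cos (Im (g t)) \<ge> 0) \<or>
               (\<forall>t\<in>{u<..<v}. norm (f (linepath p q t)) * cos (Im (g t)) \<le> 0)"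
      unfolding X_def by (meson less_imp_le)
  qed (use S g(1) cont in \<open>auto intro: continuous_on_Im continuous_on_norm\<close>)
  then show ?thesis by (simp add: ai)
qed

text \<open>The classical order is O(log h); a bound O(h) is enough here because it stays below the
  main term T log T of the zero count.\<close>

lemma zeta_horizontal_increment:
  obtains C where "C > 0" "\<And>h. h \<ge> 4 \<Longrightarrow> (\<And>x. x \<in> {1/2..3} \<Longrightarrow> zeta (Complex x h) \<noteq> 0) \<Longrightarrow>
    \<bar>arg_increment zeta (Complex 3 h) (Complex (1/2) h)\<bar> \<le> C * h"
proof -
  obtain C where C: "C > 0" "\<And>h :: real. h \<ge> 4 \<Longrightarrow> finite {x \<in> {1/2..3}. Re (zeta (Complex x h)) = 0} \<and>
     real (card {x \<in> {1/2..3}. Re (zeta (Complex x h)) = 0}) \<le> C * h"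
    using zeta_real_part_zero_count by blast
  have "\<bar>arg_increment zeta (Complex 3 h) (Complex (1/2) h)\<bar> \<le> pi * (C + 1) * h"
    if h: "h \<ge> 4" and nz: "\<And>x. x \<in> {1/2..3} \<Longrightarrow> zeta (Complex x h) \<noteq> 0" for h
  proof -
    define X where "X = {x \<in> {1/2..3}. Re (zeta (Complex x h)) = 0}"
    have X: "finite X" "card X \<le> C * h" using C(2)[OF h] by (auto simp: X_def)
    have lin: "linepath (Complex 3 h) (Complex (1/2) h) u = Complex (3 - 5/2 * u) h" for u
      by (simp add: linepath_def complex_eq_iff algebra_simps)
    have "\<bar>arg_increment zeta (Complex 3 h) (Complex (1/2) h)\<bar> \<le> pi * (card ((\<lambda>x. (3 - x) * (2 / 5)) ` X) + 1)"
    proof (rule arg_increment_le_sign_changes)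
      show "continuous_on {0..1} (\<lambda>u. zeta (linepath (Complex 3 h) (Complex (1/2) h) u))"
        by (rule continuous_on_compose2[OF holomorphic_on_imp_continuous_on[OF zeta_holomorphic_upper]])
          (use h in \<open>auto simp: lin intro!: continuous_on_Complex continuous_intros\<close>)
      show "zeta (linepath (Complex 3 h) (Complex (1/2) h) u) \<noteq> 0" if "u \<in> {0..1}" for u
        unfolding lin using that by (intro nz) auto
      show "{u \<in> {0..1}. Re (zeta (linepath (Complex 3 h) (Complex (1/2) h) u)) = 0} \<subseteq> (\<lambda>x. (3 - x) * (2 / 5)) ` X"
      proof
        fix u assume "u \<in> {u \<in> {0..1}. Re (zeta (linepath (Complex 3 h) (Complex (1/2) h) u)) = 0}"
        then have "3 - 5/2 * u \<in> X" by (auto simp: X_def lin)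
        moreover have "u = (3 - (3 - 5/2 * u)) * (2 / 5)" by simp
        ultimately show "u \<in> (\<lambda>x. (3 - x) * (2 / 5)) ` X" by (rule rev_image_eqI)
      qed
    qed (use X in simp)
    also have "\<dots> \<le> pi * (C * h + h)"
    proof (intro mult_left_mono)
      have "real (card ((\<lambda>x. (3 - x) * (2 / 5)) ` X)) \<le> C * h"
        using card_image_le[OF X(1), of "\<lambda>x. (3 - x) * (2 / 5)"] X(2) by linarith
      then show "card ((\<lambda>x. (3 - x) * (2 / 5)) ` X) + 1 \<le> C * h + h" using h by simp
    qed simp
    finally show ?thesis by (simp add: algebra_simps)
  qed
  then show ?thesis using that[of "pi * (C + 1)"] C(1) by simp
qed

section \<open>The phase of aleph on the critical line\<close>

lemma upper_nonpos_Ints: "Im s \<noteq> 0 \<Longrightarrow> s \<notin> \<int>\<^sub>\<le>\<^sub>0"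
  by (auto elim!: nonpos_Ints_cases)

lemma chi_nonzero: "Im s > 0 \<Longrightarrow> chi s \<noteq> 0"
  using upper_nonpos_Ints[of "s / 2"] upper_nonpos_Ints[of "(1 - s) / 2"]
  by (simp add: chi_def Gamma_eq_zero_iff)

lemma chi_has_field_derivative:
  assumes "Im s > 0"
  shows "(chi has_field_derivative chi s * (of_real (ln pi) - Digamma ((1 - s) / 2) / 2 - Digamma (s / 2) / 2)) (at s)"
proof -
  have n: "s / 2 \<notin> \<int>\<^sub>\<le>\<^sub>0" "(1 - s) / 2 \<notin> \<int>\<^sub>\<le>\<^sub>0" using assms by (auto intro!: upper_nonpos_Ints)
  have G: "Gamma (s / 2) \<noteq> 0" using n by (simp add: Gamma_eq_zero_iff)
  have 1: "((\<lambda>s. of_real pi powr (s - 1 / 2)) has_field_derivative of_real pi powr (s - 1 / 2) * of_real (ln pi)) (at s)"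
  proof -
    have "((\<lambda>s. exp ((s - 1 / 2) * of_real (ln pi))) has_field_derivative
        exp ((s - 1 / 2) * of_real (ln pi)) * of_real (ln pi)) (at s)"
      by (auto intro!: derivative_eq_intros)
    then show ?thesis by (simp add: powr_def Ln_of_real)
  qed
  have 2: "((\<lambda>s. Gamma ((1 - s) / 2)) has_field_derivative Gamma ((1 - s) / 2) * Digamma ((1 - s) / 2) * (- 1 / 2)) (at s)"
    by (rule DERIV_chain2[where f = Gamma and g = "\<lambda>s. (1 - s) / 2", OF has_field_derivative_Gamma[OF n(2)]]) (auto intro!: derivative_eq_intros)
  have 3: "((\<lambda>s. Gamma (s / 2)) has_field_derivative Gamma (s / 2) * Digamma (s / 2) * (1 / 2)) (at s)"
    by (rule DERIV_chain2[where f = Gamma and g = "\<lambda>s. s / 2", OF has_field_derivative_Gamma[OF n(1)]]) (auto intro!: derivative_eq_intros)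
  from DERIV_divide[OF DERIV_mult[OF 1 2] 3 G]
  show ?thesis unfolding chi_def[abs_def]
    by (rule DERIV_cong) (use G in \<open>simp add: field_simps\<close>)
qed

lemma chi_holomorphic: "chi holomorphic_on {s. Im s > 0}"
  unfolding holomorphic_on_def field_differentiable_def
  using chi_has_field_derivative by (blast intro: has_field_derivative_at_within)

text \<open>On the line, (1 - s) / 2 is the conjugate of s / 2, so the Gamma factors have equal
  modulus.\<close>

lemma norm_chi_critical_line:
  assumes "Re s = 1 / 2" "Im s > 0"
  shows "norm (chi s) = 1"
proof -
  have e: "(1 - s) / 2 = cnj (s / 2)" using assms by (simp add: complex_eq_iff)
  have "Gamma (s / 2) \<noteq> 0" using assms by (simp add: Gamma_eq_zero_iff upper_nonpos_Ints)
  moreover have "norm (Gamma ((1 - s) / 2)) = norm (Gamma (s / 2))"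
    unfolding e by (metis cnj_Gamma complex_mod_cnj)
  moreover have "norm (of_real pi powr (s - 1 / 2)) = 1"
  proof -
    have "Re (s - 1 / 2) = 0" using assms by simp
    then show ?thesis using norm_powr_real_powr[of "of_real pi" "s - 1 / 2"] by (simp del: minus_complex.simps)
  qed
  ultimately show ?thesis by (simp add: chi_def norm_mult norm_divide)
qed

text \<open>Half of a holomorphic logarithm of 1 / chi gives one square root. Any other continuous
  root differs from it by a sign that is constant on the connected half-plane and is stored in B as
  a summand \<open>\<i> * pi\<close>. Mere continuity of A thus yields holomorphy.\<close>

lemma aleph_branch_exp:
  assumes A: "aleph_branch A"
  obtains B where "B holomorphic_on {s. Im s > 0}" "\<And>s. Im s > 0 \<Longrightarrow> A s = exp (B s)"
    "\<And>s. Im s > 0 \<Longrightarrow> (B has_field_derivative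
       ((Digamma ((1 - s) / 2) + Digamma (s / 2)) / 2 - of_real (ln pi)) / 2) (at s)"
proof -
  let ?H = "{s. Im s > 0}"
  have H: "open ?H" "convex ?H" by (simp_all add: open_halfspace_Im_gt convex_halfspace_Im_gt)
  have "\<i> \<in> ?H" by simp
  have hol: "(\<lambda>s. 1 / chi s) holomorphic_on ?H"
    by (intro holomorphic_intros chi_holomorphic) (use chi_nonzero in auto)
  have nz: "1 / chi s \<noteq> 0" if "s \<in> ?H" for s using chi_nonzero that by simp
  obtain g where g: "g holomorphic_on ?H" "\<And>s. s \<in> ?H \<Longrightarrow> exp (g s) = 1 / chi s"
    using holomorphic_logarithm_exists[OF H(2,1) hol nz \<open>\<i> \<in> ?H\<close>] by blast
  have Asq: "(A s)\<^sup>2 = (exp (g s / 2))\<^sup>2" if "s \<in> ?H" for s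
  proof -
    have "(exp (g s / 2))\<^sup>2 = exp (g s)" by (simp add: exp_double[symmetric])
    then show ?thesis using A g(2)[OF that] that by (simp add: aleph_branch_def)
  qed
  define q where "q s = A s / exp (g s / 2)" for s
  have q2: "q s = 1 \<or> q s = -1" if "s \<in> ?H" for s
  proof -
    have "(q s)\<^sup>2 = 1" using Asq[OF that] by (simp add: q_def power_divide)
    then show ?thesis by (simp add: power2_eq_1_iff)
  qed
  have "q constant_on ?H"
  proof (rule continuous_finite_range_constant)
    show "connected ?H" using H(2) by (rule convex_connected)
    have "continuous_on ?H A" using A by (simp add: aleph_branch_def)
    moreover have "continuous_on ?H (\<lambda>s. exp (g s / 2))"
      by (intro holomorphic_on_imp_continuous_on holomorphic_intros g) auto
    ultimately show "continuous_on ?H q" unfolding q_def[abs_def] by (intro continuous_on_divide) auto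
    have "q ` ?H \<subseteq> {1, -1}" using q2 by blast
    then show "finite (q ` ?H)" using finite_subset by blast
  qed
  then obtain c where c: "\<And>s. s \<in> ?H \<Longrightarrow> q s = c" unfolding constant_on_def by blast
  have c2: "c = 1 \<or> c = -1" using q2[OF \<open>\<i> \<in> ?H\<close>] c[OF \<open>\<i> \<in> ?H\<close>] by simp
  define B where "B s = g s / 2 + (if c = 1 then 0 else \<i> * of_real pi)" for s
  have AB: "A s = exp (B s)" if "Im s > 0" for s
  proof -
    have "A s = c * exp (g s / 2)" using c[of s] that by (simp add: q_def field_simps)
    also have "c = exp (if c = 1 then 0 else \<i> * of_real pi)"
      using c2 by auto
    finally show ?thesis by (simp add: B_def exp_add mult.commute)
  qed
  have Bh: "B holomorphic_on ?H" unfolding B_def[abs_def] by (intro holomorphic_intros g) auto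
  have Bd: "(B has_field_derivative ((Digamma ((1 - s) / 2) + Digamma (s / 2)) / 2 - of_real (ln pi)) / 2) (at s)"
    if s: "Im s > 0" for s
  proof -
    have sH: "s \<in> ?H" using s by simp
    have gd: "(g has_field_derivative deriv g s) (at s)" by (rule holomorphic_derivI[OF g(1) H(1) sH])
    have "((\<lambda>s. exp (g s)) has_field_derivative exp (g s) * deriv g s) (at s)"
      by (rule DERIV_chain2[OF DERIV_exp gd])
    moreover have "((\<lambda>s. 1 / chi s) has_field_derivative
        (0 * chi s - 1 * (chi s * (of_real (ln pi) - Digamma ((1 - s) / 2) / 2 - Digamma (s / 2) / 2))) / (chi s * chi s)) (at s)"
      by (rule DERIV_divide[OF DERIV_const chi_has_field_derivative[OF s] chi_nonzero[OF s]])
    then have "((\<lambda>s. exp (g s)) has_field_derivative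
        (0 * chi s - 1 * (chi s * (of_real (ln pi) - Digamma ((1 - s) / 2) / 2 - Digamma (s / 2) / 2))) / (chi s * chi s)) (at s)"
      by (rule has_field_derivative_transform_within_open[OF _ H(1) sH]) (use g(2) in auto)
    ultimately have "exp (g s) * deriv g s =
        (0 * chi s - 1 * (chi s * (of_real (ln pi) - Digamma ((1 - s) / 2) / 2 - Digamma (s / 2) / 2))) / (chi s * chi s)"
      by (rule DERIV_unique)
    also have "\<dots> = exp (g s) * ((Digamma ((1 - s) / 2) + Digamma (s / 2)) / 2 - of_real (ln pi))"
      using chi_nonzero[OF s] by (simp add: g(2)[OF sH] divide_simps)
    finally have dg: "deriv g s = (Digamma ((1 - s) / 2) + Digamma (s / 2)) / 2 - of_real (ln pi)"
      by simp
    show ?thesis unfolding B_def[abs_def]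
      using DERIV_add[OF DERIV_cdivide[OF gd, of 2] DERIV_const] unfolding dg by simp
  qed
  show ?thesis by (rule that[OF Bh AB Bd])
qed

text \<open>\<open>Digamma\<close> is the limit of ln m minus the partial sums of 1 / (z + n). Their
  real parts \<open>g n\<close> are compared with the increments of \<open>L n\<close>, which
  telescope. The start \<open>L 0\<close> costs 1 and the accumulated errors at most 6, whence 7. An
  upper bound suffices, as the zeros are only to be counted from above.\<close>

lemma Re_Digamma_quarter_le:
  assumes y: "y\<^sup>2 \<ge> 1 / 4"
  shows "Re (Digamma (Complex (1 / 4) y)) \<le> ln \<bar>y\<bar> + 7"
proof -
  define u where "u n = real n + 1 / 4" for n :: nat
  define g where "g n = u n / ((u n)\<^sup>2 + y\<^sup>2)" for n
  define L where "L n = ln ((u n)\<^sup>2 + y\<^sup>2) / 2" for n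
  have pos: "(u n)\<^sup>2 + y\<^sup>2 > 0" for n using y by (intro add_nonneg_pos) auto
  have step: "L (Suc n) - L n \<le> g n + 1 / 2 / ((u n)\<^sup>2 + y\<^sup>2)" for n
  proof -
    have e: "((u (Suc n))\<^sup>2 + y\<^sup>2) / ((u n)\<^sup>2 + y\<^sup>2) = 1 + (2 * u n + 1) / ((u n)\<^sup>2 + y\<^sup>2)"
      using pos[of n] by (simp add: field_simps u_def power2_eq_square)
    have "L (Suc n) - L n = ln (((u (Suc n))\<^sup>2 + y\<^sup>2) / ((u n)\<^sup>2 + y\<^sup>2)) / 2"
      by (subst ln_divide_pos[OF pos pos]) (simp add: L_def diff_divide_distrib)
    also have "\<dots> \<le> ((2 * u n + 1) / ((u n)\<^sup>2 + y\<^sup>2)) / 2"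
      unfolding e using pos[of n] by (intro divide_right_mono ln_add_one_self_le_self) (auto simp: u_def)
    also have "\<dots> = g n + 1 / 2 / ((u n)\<^sup>2 + y\<^sup>2)"
    proof -
      have "(2 * a + 1) / D / 2 = a / D + 1 / 2 / D" for a D :: real by (simp add: add_divide_distrib)
      then show ?thesis unfolding g_def .
    qed
    finally show ?thesis .
  qed
  \<comment> \<open>The first error is at most 4 because of the lower bound on
    \<open>y\<^sup>2\<close>; the error with index m \<ge> 1 is at most
    \<open>2 / m - 2 / (m + 1)\<close>, which telescopes.\<close>
  have err: "(\<Sum>n<m. 1 / 2 / ((u n)\<^sup>2 + y\<^sup>2)) \<le> 6 - 2 / real m" if "m \<ge> 1" for m
    using that
  proof (induction m rule: dec_induct)
    case base
    have "1 / 2 / ((u 0)\<^sup>2 + y\<^sup>2) \<le> 1 / 2 / (1 / 8)"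
      using y pos[of 0] by (intro divide_left_mono) (auto simp: u_def power2_eq_square)
    then show ?case by simp
  next
    case (step m)
    have m: "real m \<ge> 1" using step by simp
    have "1 / 2 / ((u m)\<^sup>2 + y\<^sup>2) \<le> 1 / 2 / (real m * (real m + 1) / 4)"
    proof (intro divide_left_mono mult_pos_pos pos)
      have "real m * (real m + 1) / 4 \<le> (real m)\<^sup>2" using m by (simp add: power2_eq_square field_simps)
      also have "\<dots> \<le> (u m)\<^sup>2 + y\<^sup>2" by (simp add: u_def power2_eq_square field_simps add_nonneg_nonneg)
      finally show "real m * (real m + 1) / 4 \<le> (u m)\<^sup>2 + y\<^sup>2" .
    qed (use m in auto)
    also have "\<dots> = 2 / real m - 2 / real (Suc m)" using m by (simp add: field_simps)
    finally show ?case using step by simp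
  qed
  have Lm: "L m - L 0 \<le> (\<Sum>n<m. g n) + (\<Sum>n<m. 1 / 2 / ((u n)\<^sup>2 + y\<^sup>2))" for m
  proof -
    have "L m - L 0 = (\<Sum>n<m. L (Suc n) - L n)" by (simp add: sum_lessThan_telescope)
    also have "\<dots> \<le> (\<Sum>n<m. g n + 1 / 2 / ((u n)\<^sup>2 + y\<^sup>2))" by (intro sum_mono step)
    finally show ?thesis by (simp add: sum.distrib)
  qed
  have y0: "\<bar>y\<bar> \<ge> 1 / 2" using y abs_le_square_iff[of "1/2" y] by (simp add: power2_eq_square)
  have L0: "L 0 \<le> ln \<bar>y\<bar> + 1"
  proof -
    have "(u 0)\<^sup>2 + y\<^sup>2 \<le> 2 * \<bar>y\<bar>\<^sup>2" using y by (simp add: u_def power2_eq_square)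
    then have "ln ((u 0)\<^sup>2 + y\<^sup>2) \<le> ln (2 * \<bar>y\<bar>\<^sup>2)" using pos[of 0] y0 by (subst ln_le_cancel_iff) auto
    also have "\<dots> = ln 2 + 2 * ln \<bar>y\<bar>" 
    proof -
      have "ln (\<bar>y\<bar>\<^sup>2) = 2 * ln \<bar>y\<bar>" using ln_realpow[of "\<bar>y\<bar>" 2] y0 by (simp del: power2_abs)
      moreover have "ln (2 * \<bar>y\<bar>\<^sup>2) = ln 2 + ln (\<bar>y\<bar>\<^sup>2)" by (rule ln_mult_pos) (use y0 in auto)
      ultimately show ?thesis by linarith
    qed
    finally show ?thesis using ln_2_less_1 by (simp add: L_def)
  qed
  have bound: "ln (real m) - (\<Sum>n<m. g n) \<le> ln \<bar>y\<bar> + 7" if m: "m \<ge> 1" for m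
  proof -
    have "(real m)\<^sup>2 \<le> (u m)\<^sup>2 + y\<^sup>2" by (simp add: u_def power2_eq_square field_simps add_nonneg_nonneg)
    then have "ln ((real m)\<^sup>2) \<le> ln ((u m)\<^sup>2 + y\<^sup>2)" using m pos[of m] by (subst ln_le_cancel_iff) auto
    then have "ln (real m) \<le> L m" using m by (simp add: L_def ln_realpow)
    moreover have "(\<Sum>n<m. 1 / 2 / ((u n)\<^sup>2 + y\<^sup>2)) \<le> 6"
      using err[OF m] by (smt (verit) divide_nonneg_nonneg of_nat_0_le_iff)
    ultimately show ?thesis using Lm[of m] L0 by linarith
  qed
  have nz: "Complex (1 / 4) y \<noteq> 0" by (simp add: complex_eq_iff)
  have "(\<lambda>m. Re (of_real (ln (real m)) - (\<Sum>n<m. inverse (Complex (1 / 4) y + of_nat n)))) \<longlonglongrightarrow> Re (Digamma (Complex (1 / 4) y))"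
    by (intro tendsto_Re Digamma_LIMSEQ nz)
  moreover have "Re (of_real (ln (real m)) - (\<Sum>n<m. inverse (Complex (1 / 4) y + of_nat n))) = ln (real m) - (\<Sum>n<m. g n)" for m
    by (simp add: g_def u_def add.commute)
  ultimately have lim: "(\<lambda>m. ln (real m) - (\<Sum>n<m. g n)) \<longlonglongrightarrow> Re (Digamma (Complex (1 / 4) y))" by simp
  show ?thesis
    by (rule LIMSEQ_le_const2[OF lim]) (use bound in blast)
qed

text \<open>By the mean value theorem the increment is governed by the real part of the logarithmic
  derivative of A, that is by \<open>Digamma\<close> at conjugate points. Of the bound only the
  coefficient 1/2 reaches the final constant: divided by pi it becomes the
  \<open>1 / (2 * pi)\<close> of the zero count.\<close>

lemma aleph_phase_increment_le:
  assumes B: "\<And>s. Im s > 0 \<Longrightarrow> (B has_field_derivative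
       ((Digamma ((1 - s) / 2) + Digamma (s / 2)) / 2 - of_real (ln pi)) / 2) (at s)"
    and T: "1 \<le> T1" "T1 \<le> T2"
  shows "Im (B (Complex (1/2) T2)) - Im (B (Complex (1/2) T1)) \<le> T2 * (ln T2 / 2 + 4)"
proof -
  define D where "D t = ((Digamma (cnj (Complex (1/4) (t/2))) + Digamma (Complex (1/4) (t/2))) / 2 - of_real (ln pi)) / 2" for t
  have der: "((\<lambda>t. Im (B (Complex (1/2) t))) has_real_derivative Re (D t)) (at t)" if t: "t > 0" for t
  proof -
    have e: "(1 - Complex (1/2) t) / 2 = cnj (Complex (1/4) (t/2))" "Complex (1/2) t / 2 = Complex (1/4) (t/2)"
      by (simp_all add: complex_eq_iff)
    have "((\<lambda>t. of_real (1/2) + \<i> * of_real t) has_vector_derivative \<i>) (at t)"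
      by (auto intro!: derivative_eq_intros)
    moreover have "Complex (1/2) = (\<lambda>t. of_real (1/2) + \<i> * of_real t)" by (simp add: complex_eq_iff fun_eq_iff)
    ultimately have 1: "(Complex (1/2) has_vector_derivative \<i>) (at t)" by simp
    have "(B has_field_derivative D t) (at (Complex (1/2) t))"
      using B[of "Complex (1/2) t"] t unfolding D_def e by simp
    from field_vector_diff_chain_at[OF 1 this]
    have "((\<lambda>t. B (Complex (1/2) t)) has_vector_derivative \<i> * D t) (at t)" by (simp add: o_def)
    then have "((\<lambda>t. Im (B (Complex (1/2) t))) has_vector_derivative Im (\<i> * D t)) (at t)"
      by (rule bounded_linear.has_vector_derivative[OF bounded_linear_Im])
    then show ?thesis by (simp add: has_real_derivative_iff_has_vector_derivative)
  qed
  have Dle: "Re (D t) \<le> ln T2 / 2 + 4" if t: "T1 \<le> t" "t \<le> T2" for t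
  proof -
    have t1: "t \<ge> 1" using t T by simp
    have y: "1 / 4 \<le> (t / 2)\<^sup>2" "1 / 4 \<le> (- (t / 2))\<^sup>2" 
      using mult_mono[of 1 t 1 t] t1 by (simp_all add: power2_eq_square)
    have c: "cnj (Complex (1/4) (t/2)) = Complex (1/4) (- (t/2))" by (simp add: complex_eq_iff)
    have "Re (D t) = ((Re (Digamma (Complex (1/4) (- (t/2)))) + Re (Digamma (Complex (1/4) (t/2)))) / 2 - ln pi) / 2"
      by (simp add: D_def c)
    also have "\<dots> \<le> (((ln (t/2) + 7) + (ln (t/2) + 7)) / 2 - ln pi) / 2"
      using Re_Digamma_quarter_le[OF y(1)] Re_Digamma_quarter_le[OF y(2)] t1
      by (intro divide_right_mono diff_right_mono add_mono) auto
    also have "\<dots> \<le> ln T2 / 2 + 4"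
    proof -
      have "ln (t / 2) \<le> ln T2" using t t1 by simp
      moreover have "ln pi \<ge> 0" by (rule ln_ge_zero) (use pi_ge_two in simp)
      ultimately show ?thesis by argo
    qed
    finally show ?thesis .
  qed
  have nn: "ln T2 / 2 + 4 \<ge> 0" using T by simp
  show ?thesis
  proof (cases "T1 = T2")
    case False
    then have lt: "T1 < T2" using T by simp
    obtain z where z: "T1 < z" "z < T2"
      "Im (B (Complex (1/2) T2)) - Im (B (Complex (1/2) T1)) = (T2 - T1) * Re (D z)"
      using MVT2[OF lt, of "\<lambda>t. Im (B (Complex (1/2) t))" "\<lambda>t. Re (D t)"] der T by force
    have "(T2 - T1) * Re (D z) \<le> (T2 - T1) * (ln T2 / 2 + 4)"
      using z lt by (intro mult_left_mono Dle) auto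
    also have "\<dots> \<le> T2 * (ln T2 / 2 + 4)" using T nn by (intro mult_right_mono) auto
    finally show ?thesis using z by simp
  qed (use T nn in auto)
qed

section \<open>Holomorphy of Lavrik's analytic half\<close>

definition uG_integrand :: "complex \<Rightarrow> complex \<Rightarrow> real \<Rightarrow> complex" where
  "uG_integrand a z u = (z + of_real u) powr (a - 1) * exp (- (z + of_real u))"

text \<open>A multiple of the logarithm is absorbed into half of r. In the incomplete Gamma integral
  this pays for the complex power with half of the exponential decay.\<close>

lemma abs_ln_le:
  fixes r r0 B :: real
  assumes "r0 > 0" "r \<ge> r0" "B \<ge> 1"
  shows "B * \<bar>ln r\<bar> \<le> r / 2 + B * (ln (2 * B) + \<bar>ln r0\<bar>)"
proof -
  have r: "r > 0" using assms by simp
  have "ln (r / (2 * B)) \<le> r / (2 * B) - 1" using r assms by (intro ln_le_minus_one) auto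
  then have 1: "ln r \<le> r / (2 * B) + ln (2 * B)" using r assms by (subst (asm) ln_divide_pos) auto
  have 2: "- ln r \<le> \<bar>ln r0\<bar>" using assms ln_le_cancel_iff[of r0 r] by linarith
  have "0 \<le> ln (2 * B)" "0 \<le> r / (2 * B)" using assms r by (auto intro!: ln_ge_zero)
  then have "\<bar>ln r\<bar> \<le> r / (2 * B) + (ln (2 * B) + \<bar>ln r0\<bar>)" using 1 2 by linarith
  then have "B * \<bar>ln r\<bar> \<le> B * (r / (2 * B) + (ln (2 * B) + \<bar>ln r0\<bar>))" using assms by (intro mult_left_mono) auto
  then show ?thesis using assms by (simp add: distrib_left)
qed

text \<open>The sector condition with \<kappa> makes the modulus and the real part of z + u
  comparable, so the power costs at most B times the logarithm of that real part, up to constants.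
  Half of the decay survives, both in z and in u.\<close>

lemma norm_uG_integrand_le:
  assumes \<kappa>: "0 < \<kappa>" "\<kappa> \<le> 1" and c0: "0 < c0" and z: "c0 \<le> norm z" "\<kappa> * norm z \<le> Re z"
    and B: "B \<ge> 1" "norm (a - 1) \<le> B" and u: "u \<ge> 0"
  shows "norm (uG_integrand a z u) \<le>
     exp (B * (pi + \<bar>ln \<kappa>\<bar> + ln (2 * B) + \<bar>ln (\<kappa> * c0)\<bar>)) * exp (- (Re z / 2)) * exp (- (1/2) * u)"
proof -
  define w where "w = z + of_real u"
  define r where "r = Re w"
  have "\<kappa> * c0 \<le> \<kappa> * norm z" using \<kappa> z by (intro mult_left_mono) auto
  then have r0: "\<kappa> * c0 \<le> r" using z u by (simp add: r_def w_def)
  have kc: "0 < \<kappa> * c0" using \<kappa> c0 by simp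
  then have rpos: "r > 0" using r0 by simp
  have rw: "r \<le> norm w" unfolding r_def by (rule complex_Re_le_cmod)
  have "norm w \<le> norm z + u" using norm_triangle_ineq[of z "of_real u"] u by (simp add: w_def)
  then have "\<kappa> * norm w \<le> \<kappa> * (norm z + u)" using \<kappa> by (intro mult_left_mono) auto
  also have "\<dots> \<le> Re z + u" using z u \<kappa> mult_right_mono[of \<kappa> 1 u] by (simp add: distrib_left)
  finally have kw: "\<kappa> * norm w \<le> r" by (simp add: r_def w_def)
  have wpos: "norm w > 0" using rpos rw by (rule less_le_trans)
  have w0: "w \<noteq> 0" using wpos by auto
  have "ln (\<kappa> * norm w) \<le> ln r" using kw wpos \<kappa> rpos by (subst ln_le_cancel_iff) auto
  then have 1: "ln \<kappa> + ln (norm w) \<le> ln r" using \<kappa> wpos by (simp add: ln_mult_pos)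
  have 2: "ln r \<le> ln (norm w)" using rw rpos wpos by simp
  have lw: "\<bar>ln (norm w)\<bar> \<le> \<bar>ln r\<bar> + \<bar>ln \<kappa>\<bar>" using 1 2 by linarith
  have "norm (Ln w) \<le> \<bar>Re (Ln w)\<bar> + \<bar>Im (Ln w)\<bar>" by (rule cmod_le)
  also have "\<dots> \<le> \<bar>ln r\<bar> + \<bar>ln \<kappa>\<bar> + pi"
    using lw w0 mpi_less_Im_Ln[OF w0] Im_Ln_le_pi[OF w0] by (intro add_mono) auto
  finally have Lw: "norm (Ln w) \<le> \<bar>ln r\<bar> + \<bar>ln \<kappa>\<bar> + pi" .
  have "Re ((a - 1) * Ln w) \<le> norm (a - 1) * norm (Ln w)" by (metis complex_Re_le_cmod norm_mult)
  also have "\<dots> \<le> B * (\<bar>ln r\<bar> + \<bar>ln \<kappa>\<bar> + pi)" using B Lw by (intro mult_mono) auto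
  also have "\<dots> = B * \<bar>ln r\<bar> + B * (\<bar>ln \<kappa>\<bar> + pi)" by (simp add: distrib_left)
  also have "\<dots> \<le> r / 2 + B * (ln (2 * B) + \<bar>ln (\<kappa> * c0)\<bar>) + B * (\<bar>ln \<kappa>\<bar> + pi)"
    using abs_ln_le[OF kc r0 B(1)] by simp
  finally have "Re ((a - 1) * Ln w) - r \<le> B * (pi + \<bar>ln \<kappa>\<bar> + ln (2 * B) + \<bar>ln (\<kappa> * c0)\<bar>) - r / 2"
    by (simp add: distrib_left)
  moreover have "norm (uG_integrand a z u) = exp (Re ((a - 1) * Ln w) - r)"
    using w0 by (simp add: uG_integrand_def w_def[symmetric] powr_def norm_mult r_def mult_exp_exp)
  ultimately have "norm (uG_integrand a z u) \<le> exp (B * (pi + \<bar>ln \<kappa>\<bar> + ln (2 * B) + \<bar>ln (\<kappa> * c0)\<bar>) - r / 2)" by simp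
  also have "\<dots> = exp (B * (pi + \<bar>ln \<kappa>\<bar> + ln (2 * B) + \<bar>ln (\<kappa> * c0)\<bar>)) * exp (- (Re z / 2)) * exp (- (1/2) * u)"
    by (simp add: r_def w_def exp_add[symmetric] add_divide_distrib)
  finally show ?thesis .
qed

lemma not_nonpos_shift:
  assumes "Re z > 0" "u \<ge> 0"
  shows "z + of_real u \<notin> \<real>\<^sub>\<le>\<^sub>0"
  using assms by (simp add: complex_nonpos_Reals_iff)

lemma continuous_uG_integrand:
  assumes "Re z > 0"
  shows "continuous_on {0..} (uG_integrand a z)"
proof -
  have L: "continuous_on {0..} (\<lambda>u. Ln (z + of_real u))"
    by (intro continuous_on_Ln' continuous_on_add continuous_on_const continuous_on_of_real continuous_on_id)
      (use not_nonpos_shift[OF assms] in simp)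
  have c: "continuous_on {0..} (\<lambda>u. exp ((a - 1) * Ln (z + of_real u)) * exp (- (z + of_real u)))"
    by (intro continuous_on_mult continuous_on_exp continuous_on_minus continuous_on_add L
        continuous_on_const continuous_on_of_real continuous_on_id)
  have nz: "z + of_real u \<noteq> 0" if "u \<ge> 0" for u using not_nonpos_shift[OF assms that] by auto
  show ?thesis by (rule continuous_on_eq[OF c]) (use nz in \<open>simp add: uG_integrand_def powr_def\<close>)
qed

lemma exp_half_integrable: "a > 0 \<Longrightarrow> (\<lambda>u::real. C * exp (- a * u)) integrable_on {0..}"
  using has_integral_mult_right[OF has_integral_exp_minus_to_infinity[of a 0], of C] by blast

lemma integral_exp_half: "a > 0 \<Longrightarrow> integral {0..} (\<lambda>u::real. C * exp (- a * u)) = C / a"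
  using integral_unique[OF has_integral_exp_minus_to_infinity[of a 0]] by simp

lemma integrable_halfline:
  fixes f :: "real \<Rightarrow> complex"
  assumes c: "continuous_on {0..} f" and "\<And>u. u \<ge> 0 \<Longrightarrow> norm (f u) \<le> C * exp (- a * u)" "a > 0"
  shows "f integrable_on {0..}"
proof (rule integrable_on_all_intervals_integrable_bound)
  show "(\<lambda>u. C * exp (- a * u)) integrable_on {0..}" by (rule exp_half_integrable[OF assms(3)])
  fix p q :: real
  have "f integrable_on {max 0 p..q}"
    by (rule integrable_continuous_interval[OF continuous_on_subset[OF c]]) auto
  moreover have "{0..} \<inter> cbox p q = {max 0 p..q}" by auto
  ultimately show "(\<lambda>x. if x \<in> {0..} then f x else 0) integrable_on cbox p q"
    unfolding integrable_restrict_Int by (simp only:)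
qed (use assms in auto)

lemma upper_Gamma_alt: "upper_Gamma a z = integral {0..} (uG_integrand a z)"
  by (simp add: upper_Gamma_def uG_integrand_def[abs_def])

lemma norm_upper_Gamma_le:
  assumes \<kappa>: "0 < \<kappa>" "\<kappa> \<le> 1" and c0: "0 < c0" and z: "c0 \<le> norm z" "\<kappa> * norm z \<le> Re z"
    and B: "B \<ge> 1" "norm (a - 1) \<le> B"
  shows "norm (upper_Gamma a z) \<le>
     2 * exp (B * (pi + \<bar>ln \<kappa>\<bar> + ln (2 * B) + \<bar>ln (\<kappa> * c0)\<bar>)) * exp (- (Re z / 2))"
proof -
  define C where "C = exp (B * (pi + \<bar>ln \<kappa>\<bar> + ln (2 * B) + \<bar>ln (\<kappa> * c0)\<bar>)) * exp (- (Re z / 2))"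
  have "0 < \<kappa> * norm z" using \<kappa> z c0 by (intro mult_pos_pos) auto
  then have re: "Re z > 0" using z by simp
  have bd: "norm (uG_integrand a z u) \<le> C * exp (- (1/2) * u)" if "u \<ge> 0" for u
    using norm_uG_integrand_le[OF \<kappa> c0 z B that] by (simp add: C_def)
  have "norm (upper_Gamma a z) \<le> integral {0..} (\<lambda>u. C * exp (- (1/2) * u))"
    unfolding upper_Gamma_alt
    by (intro integral_norm_bound_integral integrable_halfline[OF continuous_uG_integrand[OF re] bd] exp_half_integrable)
      (use bd in auto)
  then show ?thesis using integral_exp_half[of "1/2" C] by (simp add: C_def)
qed

text \<open>Integrals over bounded intervals are holomorphic by differentiation under the integral
  sign, and they converge locally uniformly in a because the tails are exponentially small.\<close>

lemma upper_Gamma_holomorphic: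
  assumes z: "Re z > 0"
  shows "(\<lambda>a. upper_Gamma a z) holomorphic_on UNIV"
proof (rule holomorphic_uniform_sequence)
  show "open (UNIV :: complex set)" by simp
  show "(\<lambda>a. integral (cbox 0 (real n)) (uG_integrand a z)) holomorphic_on UNIV" for n
  proof (rule leibniz_rule_holomorphic)
    fix a :: complex and t :: real assume t: "t \<in> cbox 0 (real n)"
    have nz: "z + of_real t \<noteq> 0" using not_nonpos_shift[OF z, of t] t by auto
    have "((\<lambda>a. exp ((a - 1) * Ln (z + of_real t)) * exp (- (z + of_real t))) has_field_derivative
        Ln (z + of_real t) * (exp ((a - 1) * Ln (z + of_real t)) * exp (- (z + of_real t)))) (at a within UNIV)"
      by (auto intro!: derivative_eq_intros)
    then show "((\<lambda>a. uG_integrand a z t) has_field_derivative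
        Ln (z + of_real t) * (exp ((a - 1) * Ln (z + of_real t)) * exp (- (z + of_real t)))) (at a within UNIV)"
      using nz by (simp add: uG_integrand_def powr_def)
  next
    fix a :: complex
    show "uG_integrand a z integrable_on cbox 0 (real n)"
      using continuous_on_subset[OF continuous_uG_integrand[OF z, of a], of "{0..real n}"]
      by (auto intro: integrable_continuous_interval)
  next
    have L: "continuous_on (UNIV \<times> cbox 0 (real n)) (\<lambda>x :: complex \<times> real. Ln (z + of_real (snd x)))"
      by (intro continuous_on_Ln' continuous_intros) (use z not_nonpos_shift in auto)
    show "continuous_on (UNIV \<times> cbox 0 (real n)) (\<lambda>(a, t). Ln (z + of_real t) * (exp ((a - 1) * Ln (z + of_real t)) * exp (- (z + of_real t))))"
      unfolding case_prod_unfold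
      by (intro continuous_on_mult continuous_on_exp continuous_on_minus continuous_on_add continuous_on_diff L
          continuous_on_const continuous_on_of_real continuous_on_fst continuous_on_snd continuous_on_id)
  qed simp
  fix x :: complex
  define \<kappa> where "\<kappa> = Re z / norm z"
  have zp: "norm z > 0" using less_le_trans[OF z complex_Re_le_cmod[of z]] .
  have \<kappa>: "0 < \<kappa>" "\<kappa> \<le> 1" "\<kappa> * norm z \<le> Re z"
    using z zp complex_Re_le_cmod[of z] by (auto simp: \<kappa>_def)
  define B where "B = norm (x - 1) + 2"
  define C where "C = exp (B * (pi + \<bar>ln \<kappa>\<bar> + ln (2 * B) + \<bar>ln (\<kappa> * norm z)\<bar>)) * exp (- (Re z / 2))"
  have C: "C > 0" by (simp add: C_def)
  have bd: "norm (uG_integrand a z u) \<le> C * exp (- (1/2) * u)" if a: "a \<in> cball x 1" and u: "u \<ge> 0" for a u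
    unfolding C_def
  proof (rule norm_uG_integrand_le[OF \<kappa>(1,2) zp order_refl \<kappa>(3) _ _ u])
    show "B \<ge> 1" by (simp add: B_def)
    have "norm (a - 1) \<le> norm (a - x) + norm (x - 1)" using norm_triangle_ineq[of "a - x" "x - 1"] by simp
    then show "norm (a - 1) \<le> B" using a by (simp add: B_def dist_norm norm_minus_commute)
  qed
  have int: "uG_integrand a z integrable_on {0..}" if "a \<in> cball x 1" for a
    by (rule integrable_halfline[OF continuous_uG_integrand[OF z] bd[OF that]]) auto
  have diff: "norm (integral (cbox 0 (real n)) (uG_integrand a z) - upper_Gamma a z) \<le> 4 * C * exp (- (1/4) * real n)"
    if a: "a \<in> cball x 1" for a n
  proof -
    let ?g = "\<lambda>u. if u \<in> cbox 0 (real n) then uG_integrand a z u else 0"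
    have Int: "cbox 0 (real n) \<inter> {0..} = cbox 0 (real n)" by auto
    have gi: "integral {0..} ?g = integral (cbox 0 (real n)) (uG_integrand a z)"
      using integral_restrict_Int[of "{0..}" "cbox 0 (real n)" "uG_integrand a z"] unfolding Int .
    have "uG_integrand a z integrable_on cbox 0 (real n)"
      using continuous_on_subset[OF continuous_uG_integrand[OF z, of a], of "{0..real n}"]
      by (auto intro: integrable_continuous_interval)
    then have gint: "?g integrable_on {0..}"
      using integrable_restrict_Int[of "cbox 0 (real n)" "uG_integrand a z" "{0..}"] unfolding Int by simp
    have "norm (integral {0..} (\<lambda>u. ?g u - uG_integrand a z u)) \<le> integral {0..} (\<lambda>u. C * exp (- (1/4) * real n) * exp (- (1/4) * u))"
    proof (rule integral_norm_bound_integral)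
      show "(\<lambda>u. ?g u - uG_integrand a z u) integrable_on {0..}" by (intro integrable_diff gint int a)
      show "(\<lambda>u. C * exp (- (1/4) * real n) * exp (- (1/4) * u)) integrable_on {0..}" by (rule exp_half_integrable) simp
      fix u :: real assume u: "u \<in> {0..}"
      show "norm (?g u - uG_integrand a z u) \<le> C * exp (- (1/4) * real n) * exp (- (1/4) * u)"
      proof (cases "u \<le> real n")
        case False
        then have "u \<notin> cbox 0 (real n)" by simp
        then have "norm (?g u - uG_integrand a z u) = norm (uG_integrand a z u)"
          by (simp only: if_False diff_0 norm_minus_cancel)
        also have "\<dots> \<le> C * exp (- (1/2) * u)" by (rule bd[OF a]) (use u in simp)
        \<comment> \<open>Beyond n, half of the decay is spent on smallness in n, and the other half
          keeps the tail integrable.\<close>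
        also have "\<dots> \<le> C * exp (- (1/4) * real n + - (1/4) * u)"
        proof -
          have "- (1/2) * u \<le> - (1/4) * real n + - (1/4) * u" using False by simp
          then show ?thesis using C by (simp only: mult_le_cancel_left_pos exp_le_cancel_iff)
        qed
        finally show ?thesis by (simp only: exp_add mult.assoc)
      next
        case True
        then have "u \<in> cbox 0 (real n)" using u by simp
        then have "norm (?g u - uG_integrand a z u) = 0" by (simp only: if_True diff_self norm_zero)
        then show ?thesis using C by simp
      qed
    qed
    also have "\<dots> = C * exp (- (1/4) * real n) / (1/4)" by (rule integral_exp_half) simp
    finally have 1: "norm (integral {0..} (\<lambda>u. ?g u - uG_integrand a z u)) \<le> C * exp (- (1/4) * real n) / (1/4)" .
    have 2: "integral {0..} (\<lambda>u. ?g u - uG_integrand a z u) =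
        integral (cbox 0 (real n)) (uG_integrand a z) - upper_Gamma a z"
      unfolding integral_diff[OF gint int[OF a]] gi upper_Gamma_alt ..
    show ?thesis using 1 unfolding 2 by simp
  qed
  have "uniform_limit (cball x 1) (\<lambda>n a. integral (cbox 0 (real n)) (uG_integrand a z)) (\<lambda>a. upper_Gamma a z) sequentially"
  proof (rule uniform_limitI)
    fix e :: real assume e: "e > 0"
    have "(\<lambda>n. 4 * C * exp (- (1/4) * real n)) \<longlonglongrightarrow> 0" by real_asymp
    from order_tendstoD(2)[OF this e]
    show "\<forall>\<^sub>F n in sequentially. \<forall>a\<in>cball x 1. dist (integral (cbox 0 (real n)) (uG_integrand a z)) (upper_Gamma a z) < e"
    proof (rule eventually_mono)
      fix n assume "4 * C * exp (- (1/4) * real n) < e"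
      then show "\<forall>a\<in>cball x 1. dist (integral (cbox 0 (real n)) (uG_integrand a z)) (upper_Gamma a z) < e"
        using le_less_trans[OF diff] unfolding dist_norm by blast
    qed
  qed
  then show "\<exists>d>0. cball x d \<subseteq> UNIV \<and> uniform_limit (cball x d)
      (\<lambda>n a. integral (cbox 0 (real n)) (uG_integrand a z)) (\<lambda>a. upper_Gamma a z) sequentially"
    by (intro exI[of _ 1]) auto
qed

section \<open>Coefficients and convergence of the Lavrik series\<close>

text \<open>n is determined by l, m and \<xi>, so there are at most as many summands as pairs of l
  and m, each of modulus at most 1.\<close>

lemma Y_coeff_bound:
  assumes b: "\<And>n. n \<ge> 1 \<Longrightarrow> \<bar>b n\<bar> \<le> 1"
  shows "\<bar>Y_coeff b U \<xi>\<bar> \<le> real ((nat \<lfloor>U\<rfloor>)\<^sup>2)"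
proof -
  define S where "S = {(n, l, m). 1 \<le> n \<and> 1 \<le> l \<and> real l \<le> U \<and> 1 \<le> m \<and> real m \<le> U \<and>
                               (of_nat (n * l) / of_nat m :: rat) = \<xi>}"
  define N where "N = nat \<lfloor>U\<rfloor>"
  have inj: "inj_on snd S"
  proof (rule inj_onI)
    fix x y assume xy: "x \<in> S" "y \<in> S" "snd x = snd y"
    obtain n l m where x: "x = (n, l, m)" by (cases x)
    obtain n' where y: "y = (n', l, m)" using xy(3) x by (cases y) auto
    have "(of_nat (n * l) / of_nat m :: rat) = of_nat (n' * l) / of_nat m" "l \<ge> 1" "m \<ge> 1"
      using xy x y by (auto simp: S_def)
    then have "(of_nat (n * l) :: rat) = of_nat (n' * l)" by simp
    then have "n * l = n' * l" by (simp only: of_nat_eq_iff)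
    then show "x = y" using \<open>l \<ge> 1\<close> x y by simp
  qed
  have sub: "snd ` S \<subseteq> {1..N} \<times> {1..N}"
    unfolding S_def N_def by (auto simp: le_nat_floor le_nat_iff le_floor_iff)
  have "card S = card (snd ` S)" using inj by (simp add: card_image)
  also have "\<dots> \<le> card ({1..N} \<times> {1..N})" using sub by (intro card_mono) auto
  finally have card: "card S \<le> N\<^sup>2" by (simp add: power2_eq_square)
  have "\<bar>Y_coeff b U \<xi>\<bar> \<le> (\<Sum>(n, l, m) \<in> S. \<bar>b l * b m / real m\<bar>)"
    unfolding Y_coeff_def S_def[symmetric] by (rule order_trans[OF sum_abs]) (simp add: case_prod_unfold)
  also have "\<dots> \<le> (\<Sum>x\<in>S. 1)"
  proof (rule sum_mono)
    fix x assume "x \<in> S"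
    obtain n l m where x: "x = (n, l, m)" by (cases x)
    then have lm: "l \<ge> 1" "m \<ge> 1" using \<open>x \<in> S\<close> by (auto simp: S_def)
    have "\<bar>b l\<bar> * \<bar>b m\<bar> \<le> 1 * 1" using b lm by (intro mult_mono) auto
    then have "\<bar>b l\<bar> * \<bar>b m\<bar> / real m \<le> 1" using lm by (simp add: field_simps)
    then show "(case x of (n, l, m) \<Rightarrow> \<bar>b l * b m / real m\<bar>) \<le> 1" by (simp add: x abs_mult)
  qed
  also have "\<dots> \<le> real (N\<^sup>2)" using card by simp
  finally show ?thesis by (simp add: N_def)
qed

text \<open>Each denominator m \<le> U divides the factorial of the integer part of U. The sum over
  all positive rationals therefore runs in effect over the positive multiples of one fixed fraction,
  a discrete set bounded away from 0.\<close>

lemma Y_coeff_support: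
  assumes "Y_coeff b U \<xi> \<noteq> 0"
  shows "\<xi> \<in> (\<lambda>k::nat. of_nat k / of_nat (fact (nat \<lfloor>U\<rfloor>))) ` {1..}"
proof -
  let ?N = "nat \<lfloor>U\<rfloor>"
  obtain n l m where nlm: "1 \<le> n" "1 \<le> l" "1 \<le> m" "real m \<le> U" "(of_nat (n * l) / of_nat m :: rat) = \<xi>"
    using assms sum.neutral unfolding Y_coeff_def by (smt (verit, best) case_prodE mem_Collect_eq)
  have "m \<le> ?N" using nlm by (simp add: le_nat_floor le_nat_iff le_floor_iff)
  then have "m dvd fact ?N" using nlm by (intro dvd_fact) auto
  then obtain d where d: "(fact ?N :: nat) = m * d" by blast
  have "d \<noteq> 0" using d by (metis fact_nonzero mult_0_right)
  then have "\<xi> = of_nat (n * l * d) / of_nat (fact ?N)"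
    unfolding d nlm(5)[symmetric] by simp
  moreover have "n * l * d \<ge> 1" using nlm \<open>d \<noteq> 0\<close> by (simp add: Suc_le_eq)
  ultimately show ?thesis by (intro image_eqI[of _ _ "n * l * d"]) auto
qed

text \<open>The incomplete Gamma function is evaluated at a point of real part
  \<open>sin (1 / T) * pi * \<xi>\<^sup>2 > 0\<close>, so the terms have Gaussian decay in \<xi>,
  uniformly on discs, and the Weierstrass test applies to the unordered sum. Writing 1 / Gamma as
  the entire function \<open>rGamma\<close> settles the remaining factor.\<close>

lemma Lavrik_half_holomorphic:
  assumes b: "\<And>n. n \<ge> 1 \<Longrightarrow> \<bar>b n\<bar> \<le> 1" and T: "T \<ge> 1"
  shows "Lavrik_half b U T holomorphic_on {s. Im s > 0}"
proof -
  let ?H = "{s. Im s > 0}"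
  define \<kappa> where "\<kappa> = sin (1 / T)"
  have "0 < 1 / T" "1 / T \<le> 1" using T by auto
  then have "0 < 1 / T" "1 / T < pi" using pi_gt3 by linarith+
  then have \<kappa>: "0 < \<kappa>" "\<kappa> \<le> 1" by (auto simp: \<kappa>_def intro: sin_gt_zero)
  have Re_rho: "Re (rho T) = \<kappa>" by (simp add: rho_def \<kappa>_def Re_exp cos_diff)
  have n_rho: "norm (rho T) = 1" by (simp add: rho_def)
  have rho0: "rho T \<noteq> 0" by (simp add: rho_def)
  define z where "z \<xi> = of_real pi * rho T * (of_rat \<xi>)\<^sup>2" for \<xi> :: rat
  have X2: "((of_real pi * rho T) powr (1 / 2) * of_rat \<xi>)\<^sup>2 = z \<xi>" for \<xi> :: rat
  proof -
    have "((of_real pi * rho T) powr (1 / 2))\<^sup>2 = of_real pi * rho T"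
      using rho0 by (simp add: power2_eq_square powr_add[symmetric])
    then show ?thesis by (simp add: z_def power_mult_distrib)
  qed
  have of_rat_real: "(of_rat \<xi> :: complex) = of_real (of_rat \<xi>)" for \<xi>
    by (cases \<xi>) (simp add: of_rat_rat)
  have nz: "norm (z \<xi>) = pi * (of_rat \<xi>)\<^sup>2" and Rz: "Re (z \<xi>) = \<kappa> * (pi * (of_rat \<xi>)\<^sup>2)" for \<xi>
    unfolding z_def of_rat_real by (simp_all add: norm_mult n_rho norm_power Re_rho flip: of_real_power)
  define D where "D = real (fact (nat \<lfloor>U\<rfloor>))"
  have D: "D \<ge> 1" by (simp add: D_def)
  define Q where "Q = (\<lambda>k::nat. of_nat k / of_nat (fact (nat \<lfloor>U\<rfloor>)) :: rat) ` {1..}"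
  have fact_rat: "of_rat (fact n) = (fact n :: real)" for n
    by (metis of_nat_fact of_rat_of_nat_eq)
  have Qge: "of_rat \<xi> \<ge> 1 / D" if "\<xi> \<in> Q" for \<xi>
    using that by (auto simp: Q_def D_def of_rat_divide divide_right_mono fact_rat)
  define t where "t \<xi> s = of_real (Y_coeff b U \<xi>) * of_rat \<xi> powr (- s) *
         Lavrik_F s ((of_real pi * rho T) powr (1 / 2) * of_rat \<xi>)" for \<xi> s
  have t_hol: "t \<xi> holomorphic_on ?H" if \<xi>: "\<xi> > 0" for \<xi>
  proof -
    have zp: "Re (z \<xi>) > 0" unfolding Rz using \<kappa> \<xi> by simp
    have h2: "(\<lambda>s. s / 2) holomorphic_on ?H" by (intro holomorphic_intros) auto
    have uh: "(\<lambda>s. upper_Gamma (s / 2) (z \<xi>)) holomorphic_on ?H"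
      using holomorphic_on_compose_gen[OF h2 upper_Gamma_holomorphic[OF zp] subset_UNIV] by (simp add: o_def)
    have G: "(\<lambda>s. rGamma (s / 2)) holomorphic_on ?H" by (intro holomorphic_intros) auto
    have p: "(\<lambda>s. of_rat \<xi> powr (- s)) holomorphic_on ?H"
      by (intro holomorphic_on_powr_right holomorphic_on_minus holomorphic_on_ident)
    have "(\<lambda>s. of_real (Y_coeff b U \<xi>) * of_rat \<xi> powr (- s) * (upper_Gamma (s / 2) (z \<xi>) * rGamma (s / 2))) holomorphic_on ?H"
      by (rule holomorphic_on_mult[OF holomorphic_on_mult[OF holomorphic_on_const p] holomorphic_on_mult[OF uh G]])
    moreover have "Lavrik_F s ((of_real pi * rho T) powr (1 / 2) * of_rat \<xi>) =
        upper_Gamma (s / 2) (z \<xi>) * rGamma (s / 2)" for s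
      unfolding Lavrik_F_def X2 rGamma_inverse_Gamma by (rule divide_inverse)
    then have "t \<xi> = (\<lambda>s. of_real (Y_coeff b U \<xi>) * of_rat \<xi> powr (- s) * (upper_Gamma (s / 2) (z \<xi>) * rGamma (s / 2)))"
      by (intro ext) (simp only: t_def)
    ultimately show ?thesis by simp
  qed
  have sum_hol: "(\<lambda>s. \<Sum>\<^sub>\<infinity>\<xi>\<in>{0<..}. t \<xi> s) holomorphic_on ?H"
  proof -
    have "(\<lambda>s. \<Sum>\<^sub>\<infinity>\<xi>\<in>{0<..}. t \<xi> s) field_differentiable (at s0)" if s0: "s0 \<in> ?H" for s0
    proof -
      define r where "r = Im s0 / 2"
      have r: "r > 0" using s0 by (simp add: r_def)
      have sub: "cball s0 r \<subseteq> ?H"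
      proof
        fix s assume "s \<in> cball s0 r"
        then have "\<bar>Im s0 - Im s\<bar> \<le> r" using abs_Im_le_cmod[of "s0 - s"] by (simp add: dist_norm)
        then have "Im s \<ge> r" unfolding r_def by linarith
        then show "s \<in> ?H" using r by simp
      qed
      define B where "B = norm s0 + r + 2"
      have B: "B \<ge> 1" using r by (simp add: B_def)
      have Bs: "norm s \<le> B" "norm (s / 2 - 1) \<le> B" if "s \<in> cball s0 r" for s
      proof -
        have "norm s \<le> norm s0 + r" using that norm_triangle_ineq2[of s s0] by (simp add: dist_norm norm_minus_commute)
        moreover have "norm (s / 2 - 1) \<le> norm s / 2 + 1" using norm_triangle_ineq4[of "s / 2" 1] by (simp add: norm_divide)
        ultimately show "norm s \<le> B" "norm (s / 2 - 1) \<le> B" using norm_ge_zero[of s] unfolding B_def by linarith+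
      qed
      have "compact ((\<lambda>s. rGamma (s / 2)) ` cball s0 r)"
        by (intro compact_continuous_image holomorphic_on_imp_continuous_on holomorphic_intros) auto
      then obtain g where g: "\<And>s. s \<in> cball s0 r \<Longrightarrow> norm (rGamma (s / 2)) \<le> g"
        using compact_imp_bounded bounded_iff by (metis (no_types, lifting) image_eqI)
      have g0: "g \<ge> 0" using g[of s0] r norm_ge_zero order_trans by (metis centre_in_cball less_imp_le)
      define c0 where "c0 = pi * (1 / D)\<^sup>2"
      have c0: "c0 > 0" using D by (simp add: c0_def)
      define C1 where "C1 = 2 * exp (B * (pi + \<bar>ln \<kappa>\<bar> + ln (2 * B) + \<bar>ln (\<kappa> * c0)\<bar>))"
      define q where "q = \<kappa> * pi / 2"
      have q: "q > 0" using \<kappa> by (simp add: q_def)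
      define K where "K = real ((nat \<lfloor>U\<rfloor>)\<^sup>2) * exp (B * D) * (C1 * g) * exp ((B + 1)\<^sup>2 / (4 * q))"
      have bound: "norm (t \<xi> s) \<le> (if \<xi> \<in> Q then K * exp (- of_rat \<xi>) else 0)" if s: "s \<in> cball s0 r" for \<xi> s
      proof (cases "\<xi> \<in> Q")
        case False
        then have "Y_coeff b U \<xi> = 0" using Y_coeff_support[of b U \<xi>] by (auto simp: Q_def)
        then show ?thesis using False by (simp add: t_def)
      next
        case True
        define x :: real where "x = of_rat \<xi>"
        have x: "x \<ge> 1 / D" using Qge[OF True] by (simp add: x_def)
        have xp: "x > 0" using x D by (smt (verit) divide_pos_pos)
        have lnx: "\<bar>ln x\<bar> \<le> x + D"
        proof -
          have "ln x \<le> x" using ln_le_minus_one[OF xp] by simp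
          moreover have "ln (1 / D) \<le> ln x" using x xp D by (subst ln_le_cancel_iff) auto
          then have "- ln x \<le> ln D" using D by (simp add: ln_div)
          moreover have "ln D \<le> D" using ln_le_minus_one[of D] D by simp
          ultimately show ?thesis using xp D by linarith
        qed
        have 1: "norm (of_real (Y_coeff b U \<xi>) :: complex) \<le> real ((nat \<lfloor>U\<rfloor>)\<^sup>2)"
          using Y_coeff_bound[OF b] by simp
        have 2: "norm (of_rat \<xi> powr (- s) :: complex) \<le> exp (B * (x + D))"
        proof -
          have "norm (of_rat \<xi> powr (- s) :: complex) = exp (- Re s * ln x)"
            unfolding of_rat_real x_def[symmetric] using xp by (simp add: norm_powr_real_powr powr_def)
          also have "- Re s * ln x \<le> \<bar>Re s\<bar> * \<bar>ln x\<bar>" by (metis abs_ge_minus_self abs_mult mult_minus_left)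
          also have "\<dots> \<le> B * (x + D)"
            using Bs(1)[OF s] abs_Re_le_cmod[of s] lnx B by (intro mult_mono) auto
          finally show ?thesis by simp
        qed
        have 3: "norm (upper_Gamma (s / 2) (z \<xi>)) \<le> C1 * exp (- q * x\<^sup>2)"
        proof -
          have "norm (upper_Gamma (s / 2) (z \<xi>)) \<le> C1 * exp (- (Re (z \<xi>) / 2))"
            unfolding C1_def
          proof (rule norm_upper_Gamma_le[OF \<kappa> c0 _ _ B Bs(2)[OF s]])
            show "c0 \<le> norm (z \<xi>)" unfolding nz c0_def x_def[symmetric]
              using x D by (intro mult_left_mono power_mono) auto
            show "\<kappa> * norm (z \<xi>) \<le> Re (z \<xi>)" by (simp add: nz Rz)
          qed
          then show ?thesis by (simp add: Rz q_def x_def mult_ac)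
        qed
        have "norm (t \<xi> s) \<le> real ((nat \<lfloor>U\<rfloor>)\<^sup>2) * exp (B * (x + D)) * (C1 * exp (- q * x\<^sup>2) * g)"
          unfolding t_def Lavrik_F_def X2 norm_mult norm_divide
        proof (intro mult_mono 1 2)
          have "norm (upper_Gamma (s / 2) (z \<xi>)) * norm (rGamma (s / 2)) \<le> C1 * exp (- q * x\<^sup>2) * g"
            using 3 g[OF s] by (intro mult_mono) (auto simp: C1_def)
          then show "norm (upper_Gamma (s / 2) (z \<xi>)) / norm (Gamma (s / 2)) \<le> C1 * exp (- q * x\<^sup>2) * g"
            unfolding divide_inverse[where a = "norm (upper_Gamma (s / 2) (z \<xi>))"] norm_inverse[symmetric]
              rGamma_inverse_Gamma[symmetric] .
        qed auto
        also have "\<dots> = real ((nat \<lfloor>U\<rfloor>)\<^sup>2) * exp (B * D) * (C1 * g) * (exp (B * x + - q * x\<^sup>2))"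
          unfolding distrib_left exp_add by (simp only: mult_ac)
        also have "\<dots> \<le> real ((nat \<lfloor>U\<rfloor>)\<^sup>2) * exp (B * D) * (C1 * g) * (exp ((B + 1)\<^sup>2 / (4 * q) + - x))"
        proof (intro mult_left_mono)
          \<comment> \<open>Completing the square trades the Gaussian for \<open>exp (- x)\<close>,
            which is a geometric sequence along the support of the coefficients.\<close>
          have "0 \<le> (2 * q * x - (B + 1))\<^sup>2 / (4 * q)" using q by simp
          also have "\<dots> = q * x\<^sup>2 - (B + 1) * x + (B + 1)\<^sup>2 / (4 * q)"
            using q by (simp add: field_simps power2_eq_square)
          finally show "exp (B * x + - q * x\<^sup>2) \<le> exp ((B + 1)\<^sup>2 / (4 * q) + - x)"
            by (simp add: algebra_simps)
        qed (use g0 in \<open>auto simp: C1_def\<close>)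
        finally show ?thesis using True unfolding K_def exp_add x_def by (simp add: mult_ac)
      qed
      have summ: "(\<lambda>\<xi>. if \<xi> \<in> Q then K * exp (- of_rat \<xi>) else 0 :: real) summable_on {0<..}"
      proof -
        have Q0: "Q \<subseteq> {0<..}" by (auto simp: Q_def)
        have injQ: "inj_on (\<lambda>k::nat. of_nat k / of_nat (fact (nat \<lfloor>U\<rfloor>)) :: rat) {1..}"
          by (auto simp: inj_on_def)
        have "summable (\<lambda>k. exp (- (1 / D)) ^ k)" using D by (intro summable_geometric) auto
        then have "(\<lambda>k. exp (- (1 / D)) ^ k) summable_on UNIV" by (intro summable_nonneg_imp_summable_on) auto
        then have "(\<lambda>k. K * exp (- (1 / D)) ^ k) summable_on {1..}"
          by (intro summable_on_cmult_right) (rule summable_on_subset_banach, auto)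
        moreover have "K * exp (- (1 / D)) ^ k = K * exp (- of_rat (of_nat k / of_nat (fact (nat \<lfloor>U\<rfloor>))))" for k
          by (simp add: exp_of_nat_mult[symmetric] of_rat_divide D_def fact_rat)
        ultimately have "(\<lambda>\<xi>. K * exp (- of_rat \<xi>)) summable_on Q"
          unfolding Q_def by (subst summable_on_reindex[OF injQ]) (simp add: o_def)
        then show ?thesis by (subst summable_on_cong_neutral[of Q "{0<..}" "\<lambda>\<xi>. K * exp (- of_rat \<xi>)"]) (use Q0 in auto)
      qed
      have ul: "uniform_limit (cball s0 r) (\<lambda>X s. \<Sum>\<xi>\<in>X. t \<xi> s) (\<lambda>s. \<Sum>\<^sub>\<infinity>\<xi>\<in>{0<..}. t \<xi> s) (finite_subsets_at_top {0<..})"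
        by (rule Weierstrass_m_test_general[OF bound summ])
      have "(\<lambda>s. \<Sum>\<^sub>\<infinity>\<xi>\<in>{0<..}. t \<xi> s) holomorphic_on ball s0 r"
      proof (rule holomorphic_uniform_limit[OF _ ul])
        have "continuous_on (cball s0 r) (\<lambda>s. \<Sum>\<xi>\<in>X. t \<xi> s) \<and> (\<lambda>s. \<Sum>\<xi>\<in>X. t \<xi> s) holomorphic_on ball s0 r"
          if "finite X" "X \<subseteq> {0<..}" for X
        proof -
          have "(\<lambda>s. \<Sum>\<xi>\<in>X. t \<xi> s) holomorphic_on cball s0 r"
          proof (rule holomorphic_on_sum)
            fix \<xi> assume "\<xi> \<in> X"
            then have "\<xi> > 0" using that by auto
            then show "t \<xi> holomorphic_on cball s0 r" using sub by (rule holomorphic_on_subset[OF t_hol])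
          qed
          then show ?thesis
            using holomorphic_on_subset[of _ "cball s0 r" "ball s0 r"] by (auto intro: holomorphic_on_imp_continuous_on)
        qed
        then show "\<forall>\<^sub>F X in finite_subsets_at_top {0<..}. continuous_on (cball s0 r) (\<lambda>s. \<Sum>\<xi>\<in>X. t \<xi> s) \<and>
            (\<lambda>s. \<Sum>\<xi>\<in>X. t \<xi> s) holomorphic_on ball s0 r"
          by (intro eventually_finite_subsets_at_top_weakI) auto
      qed auto
      then show ?thesis using r by (intro holomorphic_on_imp_differentiable_at) auto
    qed
    then show ?thesis by (auto simp: holomorphic_on_def intro: field_differentiable_at_within)
  qed
  have "(\<lambda>s. of_real pi powr (1 / 2) * (of_real pi * rho T) powr ((s - 1) / 2) *
       mollifier b U 0 * mollifier b U 1 / (Gamma (s / 2) * (s - 1))) holomorphic_on ?H"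
  proof -
    have "(\<lambda>s. of_real pi powr (1 / 2) * (of_real pi * rho T) powr ((s - 1) / 2) *
       mollifier b U 0 * mollifier b U 1 * rGamma (s / 2) / (s - 1)) holomorphic_on ?H"
      by (intro holomorphic_on_divide holomorphic_on_mult holomorphic_on_const holomorphic_on_powr_right
          holomorphic_on_diff holomorphic_on_ident holomorphic_rGamma') auto
    moreover have "x * rGamma w / y = x / (Gamma w * y)" for x y w :: complex
      by (simp add: rGamma_inverse_Gamma divide_inverse mult_ac)
    ultimately show ?thesis by (simp only:)
  qed
  then show ?thesis
    using sum_hol unfolding Lavrik_half_def[abs_def] t_def[symmetric] by (intro holomorphic_on_add)
qed

lemma mollifier_holomorphic: "mollifier b U holomorphic_on S"
  unfolding mollifier_def[abs_def] by (intro holomorphic_intros) auto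

section \<open>Odd zeros on the critical line\<close>

text \<open>The inequalities are weak so that zeros inside I are allowed and products inherit the
  property.\<close>

definition const_sign :: "real set \<Rightarrow> (real \<Rightarrow> real) \<Rightarrow> bool" where
  "const_sign I f \<longleftrightarrow> (\<forall>t\<in>I. f t \<ge> 0) \<or> (\<forall>t\<in>I. f t \<le> 0)"

lemma const_sign_mult: "const_sign I f \<Longrightarrow> const_sign I g \<Longrightarrow> const_sign I (\<lambda>t. f t * g t)"
  unfolding const_sign_def by (meson mult_nonneg_nonneg mult_nonneg_nonpos mult_nonpos_nonneg mult_nonpos_nonpos)

lemma const_sign_const: "const_sign I (\<lambda>_. c)"
  unfolding const_sign_def using linear by blast

lemma const_sign_power: "const_sign I f \<Longrightarrow> const_sign I (\<lambda>t. f t ^ n)"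
  by (induction n) (auto intro: const_sign_mult const_sign_const)

lemma const_sign_prod:
  assumes "finite Z" "\<And>z. z \<in> Z \<Longrightarrow> const_sign I (f z)"
  shows "const_sign I (\<lambda>t. \<Prod>z\<in>Z. f z t)"
  using assms by (induction Z) (auto intro: const_sign_mult const_sign_const)

lemma const_sign_cong: "(\<And>t. t \<in> I \<Longrightarrow> f t = g t) \<Longrightarrow> const_sign I f \<longleftrightarrow> const_sign I g"
  unfolding const_sign_def by auto

context rect_factorization
begin

text \<open>Off the zeros, reality forces the total phase \<open>vphase x t + \<theta> t\<close> to
  be a multiple of pi; by continuity it is constant, even through the zeros on the line.\<close>

lemma phase_constant:
  assumes x: "a \<le> x" "x \<le> b" and cont: "continuous_on {T1..T2} \<theta>"
    and real: "\<And>t. t \<in> {T1..T2} \<Longrightarrow> Im (cis (\<theta> t) * f (Complex x t)) = 0"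
    and st: "s \<in> {T1..T2}" "t \<in> {T1..T2}"
  shows "vphase x s + \<theta> s = vphase x t + \<theta> t"
proof (rule sin_zero_imp_constant[of T1 T2 "\<lambda>t. vphase x t + \<theta> t" "Im ` Z"])
  show "continuous_on {T1..T2} (\<lambda>t. vphase x t + \<theta> t)"
    by (intro continuous_on_add continuous_vphase x cont)
  fix t assume t: "t \<in> {T1..T2} - Im ` Z"
  then have "Complex x t \<notin> Z" by (metis DiffD2 complex.sel(2) image_eqI)
  then have nz: "vmod x t \<noteq> 0" using vmod_zero_iff[OF x] t by simp
  have "cis (\<theta> t) * f (Complex x t) = of_real (vmod x t) * cis (vphase x t + \<theta> t)"
    using vertical_polar[OF x, of t] t by (simp add: cis_mult[symmetric] mult_ac)
  then have "Im (of_real (vmod x t) * cis (vphase x t + \<theta> t)) = 0" using real[of t] t by simp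
  then have "vmod x t * sin (vphase x t + \<theta> t) = 0" by simp
  then show "sin (vphase x t + \<theta> t) = 0" using nz by simp
qed (use fin st in auto)

text \<open>Only the factor of a zero on the line itself changes sign, at the height of that zero,
  and an even exponent removes the change.\<close>

lemma vmod_const_sign:
  assumes odd: "\<And>z. z \<in> Z \<Longrightarrow> Re z = x \<Longrightarrow> u < Im z \<Longrightarrow> Im z < v \<Longrightarrow> even (m z)"
  shows "const_sign {u<..<v} (vmod x)"
proof -
  have "const_sign {u<..<v} (\<lambda>t. vertical_modulus (x - Re z) (t - Im z) ^ m z)" if z: "z \<in> Z" for z
  proof (cases "Re z = x \<and> u < Im z \<and> Im z < v")
    case True
    then have "even (m z)" using odd z by blast
    then show ?thesis by (auto simp: const_sign_def zero_le_even_power)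
  next
    case False
    have "const_sign {u<..<v} (\<lambda>t. vertical_modulus (x - Re z) (t - Im z))"
    proof (cases "Re z = x")
      case True
      then have "Im z \<le> u \<or> v \<le> Im z" using False by auto
      then show ?thesis using True by (auto simp: const_sign_def vertical_modulus_def)
    next
      case False
      then have "vertical_modulus (x - Re z) (t - Im z) = (x - Re z) * sqrt (1 + ((t - Im z) / (x - Re z))\<^sup>2)" for t
        by (simp add: vertical_modulus_def)
      moreover have "const_sign {u<..<v} (\<lambda>t. sqrt (1 + ((t - Im z) / (x - Re z))\<^sup>2))"
        by (simp add: const_sign_def)
      ultimately show ?thesis using const_sign_mult[OF const_sign_const] by simp
    qed
    then show ?thesis by (rule const_sign_power)
  qed
  then have "const_sign {u<..<v} (\<lambda>t. \<Prod>z\<in>Z. vertical_modulus (x - Re z) (t - Im z) ^ m z)"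
    by (intro const_sign_prod fin)
  moreover have "const_sign {u<..<v} (\<lambda>t. exp (Re (G (Complex x t))))" by (simp add: const_sign_def)
  ultimately show ?thesis unfolding vmod_def[abs_def] by (rule const_sign_mult[rotated])
qed

end

section \<open>Mollifier, aleph and zeta on the critical line\<close>

lemma mollifier_cnj: "mollifier b U (cnj s) = cnj (mollifier b U s)"
  unfolding mollifier_def cnj_sum
proof (intro sum.cong refl)
  fix n :: nat assume n: "n \<in> {n. 1 \<le> n \<and> real n \<le> U}"
  have "cnj (of_nat n powr (- s)) = of_nat n powr (- cnj s)"
    by (subst cnj_powr) (use n in simp_all)
  then show "of_real (b n) * of_nat n powr (- cnj s) = cnj (of_real (b n) * of_nat n powr (- s))" by simp
qed

text \<open>The coefficients have modulus at most 1, so the comparison series is the one used for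
  \<open>zeta\<close>, and \<open>critical_line_log_integral\<close> covers both functions.\<close>

lemma mollifier_minus_1_le:
  assumes b1: "b 1 = 1" and b: "\<And>n. n \<ge> 1 \<Longrightarrow> \<bar>b n\<bar> \<le> 1" and U: "U \<ge> 1" and s: "Re s \<ge> 3"
  shows "norm (mollifier b U s - 1) \<le> 3 * 2 powr (- Re s)"
proof -
  define N where "N = nat \<lfloor>U\<rfloor>"
  have N: "N \<ge> 1" using U unfolding N_def by linarith
  have set: "{n. 1 \<le> n \<and> real n \<le> U} = {1..N}"
    unfolding N_def using U by (auto simp: le_nat_floor le_nat_iff le_floor_iff)
  have "mollifier b U s = (\<Sum>n\<in>{1..N}. of_real (b n) * of_nat n powr (- s))"
    by (simp only: mollifier_def set)
  also have "\<dots> = 1 + (\<Sum>n\<in>{2..N}. of_real (b n) * of_nat n powr (- s))"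
    using N b1 by (subst sum.atLeast_Suc_atMost) (auto simp: numeral_2_eq_2)
  finally have "mollifier b U s - 1 = (\<Sum>n\<in>{2..N}. of_real (b n) * of_nat n powr (- s))" by simp
  also have "\<dots> = (\<Sum>n<N - 1. of_real (b (n + 2)) * of_nat (n + 2) powr (- s))"
  proof -
    have "{2..N} = {0 + 2..<N - 1 + 2}" using N by auto
    then show ?thesis by (simp only: sum.shift_bounds_nat_ivl atLeast0LessThan)
  qed
  also have "norm \<dots> \<le> (\<Sum>n<N - 1. real (n + 2) powr (- Re s))"
  proof (rule sum_norm_le)
    fix n
    have "norm (of_real (b (n + 2)) * of_nat (n + 2) powr (- s)) = \<bar>b (n + 2)\<bar> * real (n + 2) powr (- Re s)"
      by (simp only: norm_mult norm_of_nat_powr norm_of_real)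
    also have "\<dots> \<le> 1 * real (n + 2) powr (- Re s)" using b by (intro mult_right_mono) auto
    finally show "norm (of_real (b (n + 2)) * of_nat (n + 2) powr (- s)) \<le> real (n + 2) powr (- Re s)" by simp
  qed
  also have "\<dots> \<le> (\<Sum>n<N - 1. real (n + 2) powr (- 3) * 2 powr (3 - Re s))"
    by (intro sum_mono nat_powr_le s)
  also have "\<dots> = (\<Sum>n<N - 1. real (n + 2) powr (- 3)) * 2 powr (3 - Re s)" by (simp add: sum_distrib_right)
  also have "\<dots> \<le> (\<Sum>n. real (n + 2) powr (- 3)) * 2 powr (3 - Re s)"
    by (intro mult_right_mono sum_le_suminf summable_nat_powr) auto
  also have "\<dots> \<le> 3 / 8 * 2 powr (3 - Re s)" by (intro mult_right_mono suminf_nat_powr_3_le) auto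
  also have "\<dots> = 3 * 2 powr (- Re s)" by (simp add: powr_diff powr_minus_divide)
  finally show ?thesis .
qed

lemma aleph_norm_critical_line:
  assumes A: "aleph_branch A" and s: "Re s = 1 / 2" "Im s > 0"
  shows "norm (A s) = 1"
proof -
  have "(A s)\<^sup>2 = 1 / chi s" using A s by (simp add: aleph_branch_def)
  then have "(norm (A s))\<^sup>2 = 1" using norm_chi_critical_line[OF s] by (metis norm_divide norm_one norm_power div_by_1)
  then show ?thesis using norm_ge_zero[of "A s"] by (simp add: power2_eq_1_iff)
qed

lemma aleph_critical_line_phase:
  assumes A: "aleph_branch A"
  obtains \<theta> where
    "\<And>t. t > 0 \<Longrightarrow> A (Complex (1/2) t) = cis (\<theta> t)" "continuous_on {0<..} \<theta>"
    "\<And>T1 T2. 1 \<le> T1 \<Longrightarrow> T1 \<le> T2 \<Longrightarrow> \<theta> T2 - \<theta> T1 \<le> T2 * (ln T2 / 2 + 4)"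
proof -
  obtain B where B: "B holomorphic_on {s. Im s > 0}" "\<And>s. Im s > 0 \<Longrightarrow> A s = exp (B s)"
    "\<And>s. Im s > 0 \<Longrightarrow> (B has_field_derivative
       ((Digamma ((1 - s) / 2) + Digamma (s / 2)) / 2 - of_real (ln pi)) / 2) (at s)"
    by (rule aleph_branch_exp[OF A]) (rule that)
  show ?thesis
  proof (rule that)
    show "A (Complex (1/2) t) = cis (Im (B (Complex (1/2) t)))" if "t > 0" for t
    proof -
      have "norm (A (Complex (1/2) t)) = 1" using that by (intro aleph_norm_critical_line[OF A]) auto
      moreover have "A (Complex (1/2) t) = exp (B (Complex (1/2) t))" using that by (intro B) simp
      ultimately show ?thesis by (simp add: exp_eq_polar[of "B (Complex (1/2) t)"] norm_mult)
    qed
    show "continuous_on {0<..} (\<lambda>t. Im (B (Complex (1/2) t)))"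
      by (intro continuous_on_Im continuous_on_compose2[OF holomorphic_on_imp_continuous_on[OF B(1)]])
        (auto intro!: continuous_on_Complex continuous_on_const continuous_on_id)
    show "Im (B (Complex (1/2) T2)) - Im (B (Complex (1/2) T1)) \<le> T2 * (ln T2 / 2 + 4)"
      if "1 \<le> T1" "T1 \<le> T2" for T1 T2
      using B(3) that by (rule aleph_phase_increment_le)
  qed
qed

lemma Y_fun_critical_line:
  assumes "Re s = 1 / 2"
  shows "Y_fun b U s = zeta s * of_real ((norm (mollifier b U s))\<^sup>2)"
proof -
  have "1 - s = cnj s" using assms by (simp add: complex_eq_iff)
  then have "mollifier b U (1 - s) = cnj (mollifier b U s)" using mollifier_cnj by metis
  then show ?thesis unfolding Y_fun_def complex_norm_square by (simp add: mult.assoc)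
qed

lemma aleph_holomorphic: "aleph_branch A \<Longrightarrow> A holomorphic_on {s. Im s > 0}"
proof -
  assume "aleph_branch A"
  then obtain B where B: "B holomorphic_on {s. Im s > 0}" "\<And>s. Im s > 0 \<Longrightarrow> A s = exp (B s)"
    using aleph_branch_exp by blast
  have "(\<lambda>s. exp (B s)) holomorphic_on {s. Im s > 0}" by (intro holomorphic_intros B)
  then show ?thesis by (rule holomorphic_transform) (use B(2) in auto)
qed

lemma aleph_nonzero: "aleph_branch A \<Longrightarrow> Im s > 0 \<Longrightarrow> A s \<noteq> 0"
  using chi_nonzero[of s] by (auto simp: aleph_branch_def)

text \<open>
  The functional equation, from the hypothesis alone: \<open>A * zeta\<close> is real on a segment of the
  critical line, hence invariant under Schwarz reflection.
\<close>

lemma aleph_zeta_reflection: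
  assumes A: "aleph_branch A" and T: "T > 0" and b1: "b 1 = 1" and b: "\<And>n. n \<ge> 1 \<Longrightarrow> \<bar>b n\<bar> \<le> 1" and U: "U \<ge> 1"
    and real: "\<And>s. Re s = 1 / 2 \<Longrightarrow> T \<le> Im s \<Longrightarrow> Im s \<le> 2 * T \<Longrightarrow> A s * Y_fun b U s \<in> \<real>"
    and s: "Im s > 0"
  shows "A s * zeta s = cnj (A (1 - cnj s) * zeta (1 - cnj s))"
proof -
  let ?H = "{s. Im s > 0}"
  define h where "h s = A s * zeta s" for s
  define F where "F s = h s - cnj (h (1 - cnj s))" for s
  have H: "open ?H" "convex ?H" by (simp_all add: open_halfspace_Im_gt convex_halfspace_Im_gt)
  have hh: "h holomorphic_on ?H" unfolding h_def by (intro holomorphic_intros aleph_holomorphic A zeta_holomorphic_upper)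
  have "(\<lambda>s. h (1 - s)) holomorphic_on {s. Im s < 0}"
    by (rule holomorphic_on_compose_gen[OF _ hh, unfolded o_def]) (auto intro!: holomorphic_intros)
  then have "(\<lambda>z. cnj (h (1 - cnj z))) holomorphic_on cnj ` {s. Im s < 0}"
    by (rule holomorphic_on_cnj_cnj) (rule open_halfspace_Im_lt)
  moreover have "?H \<subseteq> cnj ` {s. Im s < 0}"
  proof
    fix z assume "z \<in> ?H"
    then show "z \<in> cnj ` {s. Im s < 0}" by (intro image_eqI[of _ _ "cnj z"]) auto
  qed
  ultimately have hh': "(\<lambda>z. cnj (h (1 - cnj z))) holomorphic_on ?H" by (rule holomorphic_on_subset)
  have FH: "F holomorphic_on ?H" unfolding F_def by (intro holomorphic_on_diff hh hh')
  have Mfin: "finite {t\<in>{T..2*T}. mollifier b U (Complex (1/2) t) = 0}"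
    by (rule critical_line_log_integral(3)[OF mollifier_holomorphic mollifier_holomorphic mollifier_minus_1_le[where b = b and U = U, OF b1 b U] T])
  \<comment> \<open>Off the finitely many zeros of the mollifier the factor
    \<open>(norm (mollifier b U w))\<^sup>2\<close> can be divided out. What is left of the segment
    is infinite inside a compact set, so it has a limit point for the identity theorem.\<close>
  define W where "W = Complex (1/2) ` ({T..2*T} - {t\<in>{T..2*T}. mollifier b U (Complex (1/2) t) = 0})"
  have FW: "F w = 0" if wW: "w \<in> W" for w
  proof -
    obtain t where t: "w = Complex (1/2) t" "t \<in> {T..2*T}" "mollifier b U (Complex (1/2) t) \<noteq> 0"
    proof -
      from wW obtain t where t: "w = Complex (1/2) t"
        "t \<in> {T..2*T} - {t\<in>{T..2*T}. mollifier b U (Complex (1/2) t) = 0}"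
        unfolding W_def by blast
      then have "t \<in> {T..2*T}" "mollifier b U (Complex (1/2) t) \<noteq> 0" by blast+
      with t(1) show thesis by (rule that)
    qed
    have w: "1 - cnj w = w" using t by (simp add: complex_eq_iff)
    have "h w * of_real ((norm (mollifier b U w))\<^sup>2) \<in> \<real>"
      using real[of w] Y_fun_critical_line[of w b U] t by (simp add: h_def mult.assoc)
    then have "h w * of_real ((norm (mollifier b U w))\<^sup>2) / of_real ((norm (mollifier b U w))\<^sup>2) \<in> \<real>"
      by (intro Reals_divide Reals_of_real)
    then have "h w \<in> \<real>" using t by simp
    then show ?thesis unfolding F_def w by (simp add: Reals_cnj_iff)
  qed
  have "infinite ({T..2*T} - {t\<in>{T..2*T}. mollifier b U (Complex (1/2) t) = 0})"
    using T Mfin by (intro Diff_infinite_finite) (auto simp: infinite_Icc)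
  moreover have "inj_on (Complex (1/2)) X" for X by (auto simp: inj_on_def)
  ultimately have "infinite W" unfolding W_def using finite_image_iff by blast
  moreover have "W \<subseteq> Complex (1/2) ` {T..2*T}" by (auto simp: W_def)
  moreover have "compact (Complex (1/2) ` {T..2*T})"
    by (intro compact_continuous_image continuous_on_Complex continuous_intros) auto
  ultimately obtain \<xi> where \<xi>: "\<xi> \<in> Complex (1/2) ` {T..2*T}" "\<xi> islimpt W"
    using Heine_Borel_imp_Bolzano_Weierstrass by blast
  have "F s = 0"
    by (rule analytic_continuation[OF FH H(1) convex_connected[OF H(2)] _ _ \<xi>(2) FW])
      (use T s \<xi> in \<open>auto simp: W_def\<close>)
  then show ?thesis by (simp add: F_def h_def)
qed

text \<open>Reflection carries the local factorisation of \<open>zeta\<close> at p to one at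
  \<open>1 - cnj p\<close>. The factors A have no zeros, so the cofactor K does not vanish and the
  exponent is the same.\<close>

lemma zorder_reflection:
  assumes A: "aleph_branch A"
    and refl: "\<And>s. Im s > 0 \<Longrightarrow> A s * zeta s = cnj (A (1 - cnj s) * zeta (1 - cnj s))"
    and p: "Im p > 0"
  shows "zorder zeta (1 - cnj p) = zorder zeta p"
proof -
  let ?H = "{s. Im s > 0}"
  have H: "open ?H" "connected ?H" by (simp_all add: open_halfspace_Im_gt convex_connected convex_halfspace_Im_gt)
  note nz = zeta_nonzero_upper
  define n where "n = nat (zorder zeta p)"
  define g where "g = zor_poly zeta p"
  obtain r where r: "r > 0" "cball p r \<subseteq> ?H" "g holomorphic_on cball p r"
    "\<And>w. w \<in> cball p r \<Longrightarrow> zeta w = g w * (w - p) ^ n \<and> g w \<noteq> 0" "zorder zeta p \<ge> 0"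
    using zorder_exist_zero[OF zeta_holomorphic_upper H _ nz, of p] p unfolding n_def g_def
    by (smt (verit, best) mem_Collect_eq)
  define q where "q = 1 - cnj p"
  define K where "K w = (-1) ^ n * (cnj (A (1 - cnj w)) * cnj (g (1 - cnj w))) / A w" for w
  have mem: "1 - cnj w \<in> ball p r" if "w \<in> ball q r" for w
  proof -
    have "p - (1 - cnj w) = - cnj (q - w)" by (simp add: q_def)
    then have "dist p (1 - cnj w) = dist q w" by (metis complex_mod_cnj dist_norm norm_minus_cancel)
    then show ?thesis using that by simp
  qed
  have imq: "Im w > 0" if "w \<in> ball q r" for w
  proof -
    have "1 - cnj w \<in> ?H" using mem[OF that] r(2) ball_subset_cball by blast
    then show ?thesis by simp
  qed
  have "zorder zeta q = int n"
  proof (rule zorder_eqI[of "ball q r" q K])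
    have "(\<lambda>s. A (1 - s) * g (1 - s)) holomorphic_on ball (cnj q) r"
    proof (rule holomorphic_on_compose_gen[of "\<lambda>s. 1 - s" _ "\<lambda>s. A s * g s" "ball p r", unfolded o_def])
      have "ball p r \<subseteq> ?H" using r(2) ball_subset_cball by blast
      then show "(\<lambda>s. A s * g s) holomorphic_on ball p r"
        by (intro holomorphic_on_mult holomorphic_on_subset[OF aleph_holomorphic[OF A]] holomorphic_on_subset[OF r(3)]) auto
      show "(\<lambda>s. 1 - s) ` ball (cnj q) r \<subseteq> ball p r"
        by (auto simp: q_def dist_norm norm_minus_commute algebra_simps)
    qed (intro holomorphic_intros)
    then have "(\<lambda>z. cnj (A (1 - cnj z) * g (1 - cnj z))) holomorphic_on cnj ` ball (cnj q) r"
      by (rule holomorphic_on_cnj_cnj) simp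
    moreover have "ball q r \<subseteq> cnj ` ball (cnj q) r"
    proof
      fix w assume "w \<in> ball q r"
      then have "cnj w \<in> ball (cnj q) r" by (simp add: dist_norm flip: complex_cnj_diff)
      then show "w \<in> cnj ` ball (cnj q) r" by (intro image_eqI[of _ _ "cnj w"]) auto
    qed
    ultimately have "(\<lambda>z. cnj (A (1 - cnj z) * g (1 - cnj z))) holomorphic_on ball q r" by (rule holomorphic_on_subset)
    moreover have "A holomorphic_on ball q r" using imq by (intro holomorphic_on_subset[OF aleph_holomorphic[OF A]]) auto
    ultimately have "(\<lambda>w. (-1) ^ n * cnj (A (1 - cnj w) * g (1 - cnj w)) / A w) holomorphic_on ball q r"
      using imq aleph_nonzero[OF A] by (intro holomorphic_on_divide holomorphic_on_mult holomorphic_on_const) auto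
    then show "K holomorphic_on ball q r" by (simp add: K_def[abs_def])
    show "q \<in> ball q r" using r by simp
    have Knz: "K w \<noteq> 0" if w: "w \<in> ball q r" for w
    proof -
      have "Im (1 - cnj w) > 0" using imq[OF w] by simp
      moreover have "g (1 - cnj w) \<noteq> 0" using mem[OF w] r(4) ball_subset_cball by blast
      ultimately show ?thesis using aleph_nonzero[OF A] imq[OF w] by (simp add: K_def)
    qed
    show "K q \<noteq> 0" using r by (intro Knz) simp
    fix w assume w: "w \<in> ball q r" "w \<noteq> q"
    have "zeta (1 - cnj w) = g (1 - cnj w) * (1 - cnj w - p) ^ n"
      using mem[OF w(1)] r(4) ball_subset_cball by blast
    moreover have "1 - cnj w - p = - cnj (w - q)" by (simp add: q_def)
    ultimately have "zeta (1 - cnj w) = g (1 - cnj w) * ((-1) ^ n * cnj (w - q) ^ n)"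
      by (metis power_minus)
    then have "A w * zeta w = cnj (A (1 - cnj w)) * (cnj (g (1 - cnj w)) * ((-1) ^ n * (w - q) ^ n))"
      using refl[OF imq[OF w(1)]] by simp
    then have "zeta w = K w * (w - q) ^ n"
      using aleph_nonzero[OF A imq[OF w(1)]] by (simp add: K_def field_simps)
    then show "zeta w = K w * (w - q) powi int n" by (simp add: power_int_def)
  qed simp
  then show ?thesis using r(5) by (simp add: n_def q_def)
qed

lemma zeta_rect_factorization:
  assumes "0 < T1" "T1 < T2"
  defines "Z \<equiv> {s. 1/2 \<le> Re s \<and> Re s \<le> 3 \<and> T1 \<le> Im s \<and> Im s \<le> T2 \<and> zeta s = 0}"
  obtains \<Omega> G where "rect_factorization zeta G
      Z (\<lambda>z. nat (zorder zeta z)) \<Omega> (1/2) 3 T1 T2"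
    "\<And>z. z \<in> Z \<Longrightarrow> zorder zeta z > 0"
proof -
  let ?H = "{s. Im s > 0}"
  have H: "open ?H" "convex ?H" by (simp_all add: open_halfspace_Im_gt convex_halfspace_Im_gt)
  note nz = zeta_nonzero_upper
  have dom: "{s. 1/2 \<le> Re s \<and> Re s \<le> 3 \<and> T1 \<le> Im s \<and> Im s \<le> T2} \<subseteq> ?H"
    using assms by auto
  have "(1/2 :: real) < 3" by simp
  show ?thesis
    by (rule rect_factorization_exists[OF zeta_holomorphic_upper H nz \<open>(1/2 :: real) < 3\<close> assms(2) dom, folded Z_def])
      (rule that)
qed

text \<open>Since \<open>A * zeta\<close> is real on the segment its total phase is constant, so it
  equals the signed modulus of \<open>zeta\<close> times a constant cosine, and
  \<open>vmod_const_sign\<close> applies.\<close>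

lemma zeta_critical_line_sign:
  assumes A: "aleph_branch A" and T: "0 < T1" "T1 < T2"
    and real: "\<And>t. t \<in> {T1..T2} \<Longrightarrow> A (Complex (1/2) t) * zeta (Complex (1/2) t) \<in> \<real>"
    and uv: "T1 \<le> u" "u < v" "v \<le> T2"
    and odd: "\<And>t. u < t \<Longrightarrow> t < v \<Longrightarrow> zeta (Complex (1/2) t) = 0 \<Longrightarrow> even (zorder zeta (Complex (1/2) t))"
  shows "const_sign {u<..<v} (\<lambda>t. Re (A (Complex (1/2) t) * zeta (Complex (1/2) t)))"
proof -
  obtain \<theta> where Acis: "\<And>t. t > 0 \<Longrightarrow> A (Complex (1/2) t) = cis (\<theta> t)" and \<theta>: "continuous_on {0<..} \<theta>"
    by (rule aleph_critical_line_phase[OF A]) (rule that)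
  define Z where "Z = {s. 1/2 \<le> Re s \<and> Re s \<le> 3 \<and> T1 \<le> Im s \<and> Im s \<le> T2 \<and> zeta s = 0}"
  obtain \<Omega> G where F: "rect_factorization zeta G Z (\<lambda>z. nat (zorder zeta z)) \<Omega> (1/2) 3 T1 T2"
    and zo: "\<And>z. z \<in> Z \<Longrightarrow> zorder zeta z > 0"
    by (rule zeta_rect_factorization[OF T, folded Z_def]) (rule that)
  interpret rect_factorization zeta G Z "\<lambda>z. nat (zorder zeta z)" \<Omega> "1/2" 3 T1 T2 by (rule F)
  have cont: "continuous_on {T1..T2} \<theta>" by (rule continuous_on_subset[OF \<theta>]) (use T in auto)
  have phase: "vphase (1/2) s + \<theta> s = vphase (1/2) T1 + \<theta> T1" if "s \<in> {T1..T2}" for s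
  proof (rule phase_constant[OF _ _ cont _ that])
    show "Im (cis (\<theta> t) * zeta (Complex (1/2) t)) = 0" if "t \<in> {T1..T2}" for t
      using real[OF that] Acis[of t] that T by (simp add: complex_is_Real_iff)
  qed (use T in auto)
  have "const_sign {u<..<v} (\<lambda>t. vmod (1/2) t * cos (vphase (1/2) T1 + \<theta> T1))"
  proof (intro const_sign_mult const_sign_const vmod_const_sign)
    fix z assume z: "z \<in> Z" "Re z = 1/2" "u < Im z" "Im z < v"
    then have "z = Complex (1/2) (Im z)" by (simp add: complex_eq_iff)
    then have "even (zorder zeta z)" using odd[of "Im z"] z by (simp add: Z_def)
    then show "even (nat (zorder zeta z))" using zo[OF z(1)] by (simp add: even_nat_iff)
  qed
  moreover have "Re (A (Complex (1/2) t) * zeta (Complex (1/2) t)) = vmod (1/2) t * cos (vphase (1/2) T1 + \<theta> T1)"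
    if t: "t \<in> {u<..<v}" for t
  proof -
    have tT: "t \<in> {T1..T2}" "t > 0" using t uv T by auto
    have "A (Complex (1/2) t) * zeta (Complex (1/2) t) = of_real (vmod (1/2) t) * cis (vphase (1/2) t + \<theta> t)"
      using vertical_polar[of "1/2" t] tT Acis[OF tT(2)] by (simp add: cis_mult[symmetric] mult_ac)
    then show ?thesis using phase[OF tT(1)] by simp
  qed
  ultimately show ?thesis using const_sign_cong by (smt (verit, best))
qed

lemma finite_zeta_ordinates: "finite {t. T1 \<le> t \<and> t \<le> T2 \<and> zeta (Complex (1/2) t) = 0}"
proof (rule finite_subset)
  define r where "r = 1 + \<bar>T1\<bar> + \<bar>T2\<bar>"
  show "{t. T1 \<le> t \<and> t \<le> T2 \<and> zeta (Complex (1/2) t) = 0} \<subseteq> Im ` {s. zeta s = 0 \<and> s \<noteq> 1 \<and> s \<in> cball 0 r}"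
  proof
    fix t assume t: "t \<in> {t. T1 \<le> t \<and> t \<le> T2 \<and> zeta (Complex (1/2) t) = 0}"
    have "norm (Complex (1/2) t) \<le> \<bar>1/2\<bar> + \<bar>t\<bar>" using cmod_le[of "Complex (1/2) t"] by simp
    also have "\<dots> \<le> r" using t by (auto simp: r_def)
    finally have "Complex (1/2) t \<in> {s. zeta s = 0 \<and> s \<noteq> 1 \<and> s \<in> cball 0 r}"
      using t by (simp add: complex_eq_iff)
    then show "t \<in> Im ` {s. zeta s = 0 \<and> s \<noteq> 1 \<and> s \<in> cball 0 r}" by (rule image_eqI[rotated]) simp
  qed
qed (rule finite_imageI[OF finite_zeta_zeros])

text \<open>The mean logarithms of \<open>zeta\<close> and of the square of the mollifier together
  cost three times 4 and three times \<open>5/2 * pi\<close>. The 1 added to \<open>A_count\<close>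
  reflects that the phase bound counts the intervals between break points, not the points.\<close>

lemma A_count_ge:
  assumes A: "aleph_branch A" and T: "T \<ge> 1" and b1: "b 1 = 1" and b: "\<And>n. n \<ge> 1 \<Longrightarrow> \<bar>b n\<bar> \<le> 1" and U: "U \<ge> 1"
    and c: "c > 0" and \<delta>: "\<delta> < 1/2"
    and line: "\<And>s. Re s = 1 / 2 \<Longrightarrow> T \<le> Im s \<Longrightarrow> Im s \<le> 2 * T \<Longrightarrow>
       A s * Y_fun b U s = of_real (c * Re (beta A b U T s))"
  shows "(\<lambda>t. ln (norm (beta A b U T (Complex \<delta> t)))) integrable_on {T..2*T}" (is ?int)
    "finite {t\<in>{T..2*T}. beta A b U T (Complex \<delta> t) = 0}" (is ?fin)
    "continuous_on {T..2*T} (\<lambda>t. beta A b U T (Complex \<delta> t))" (is ?cont)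
    "pi * (1/2 - \<delta>) * (real (A_count T (2 * T)) + 1) \<ge>
       - integral {T..2*T} (\<lambda>t. ln (norm (beta A b U T (Complex \<delta> t)))) - T * ln c
       - horizontal_contribution (beta A b U T) \<delta> (1/2) T - horizontal_contribution zeta (1/2) 3 T
       - 2 * horizontal_contribution (mollifier b U) (1/2) 3 T - 12 - 15/2 * pi" (is ?ge)
proof -
  let ?H = "{s. Im s > 0}"
  define \<beta> where "\<beta> = beta A b U T"
  define M where "M = mollifier b U"
  define E where "E = {t\<in>{T<..<2*T}. \<beta> (Complex (1/2) t) = 0}"
  define Od where "Od = {t. T \<le> t \<and> t \<le> 2*T \<and> zeta (Complex (1/2) t) = 0 \<and> odd (zorder zeta (Complex (1/2) t))}"
  have H: "open ?H" "convex ?H" by (simp_all add: open_halfspace_Im_gt convex_halfspace_Im_gt)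
  have \<beta>_hol: "\<beta> holomorphic_on ?H"
    unfolding \<beta>_def beta_def[abs_def]
    by (intro holomorphic_on_mult aleph_holomorphic A Lavrik_half_holomorphic b T)
  have M: "(\<lambda>t. ln (norm (M (Complex (1/2) t)))) integrable_on {T..2*T}"
    "integral {T..2*T} (\<lambda>t. ln (norm (M (Complex (1/2) t)))) \<ge> - 4 - horizontal_contribution M (1/2) 3 T - 5/2 * pi"
    "finite {t\<in>{T..2*T}. M (Complex (1/2) t) = 0}"
    using critical_line_log_integral[OF mollifier_holomorphic mollifier_holomorphic mollifier_minus_1_le[where b = b and U = U, OF b1 b U], of T] T
    unfolding M_def by auto
  have "zeta holomorphic_on {s. Re s > 2}" by (rule holomorphic_on_subset[OF zeta_properties(1)]) auto
  from critical_line_log_integral[OF zeta_holomorphic_upper this norm_zeta_minus_1_le, of T]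
  have Z: "(\<lambda>t. ln (norm (zeta (Complex (1/2) t)))) integrable_on {T..2*T}"
    "integral {T..2*T} (\<lambda>t. ln (norm (zeta (Complex (1/2) t)))) \<ge> - 4 - horizontal_contribution zeta (1/2) 3 T - 5/2 * pi"
    "finite {t\<in>{T..2*T}. zeta (Complex (1/2) t) = 0}"
    using T by auto
  have lineM: "A s * zeta s * of_real ((norm (M s))\<^sup>2) = of_real (c * Re (\<beta> s))"
    if "s = Complex (1/2) t" "t \<in> {T..2*T}" for s t
    using line[of s] Y_fun_critical_line[of s b U] that by (simp add: M_def \<beta>_def mult.assoc)
  have infin: "infinite {T..2*T}" using T by (simp add: infinite_Icc)
  have "infinite ({T..2*T} - ({t\<in>{T..2*T}. M (Complex (1/2) t) = 0} \<union> {t\<in>{T..2*T}. zeta (Complex (1/2) t) = 0}))"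
    using infin M(3) Z(3) by (intro Diff_infinite_finite) auto
  \<comment> \<open>At t0 neither \<open>zeta\<close> nor the mollifier vanishes, so the
    critical-line identity shows that \<beta> is not identically zero, as the splitting of its zeros
    requires.\<close>
  from infinite_imp_nonempty[OF this] obtain t0
    where "t0 \<in> {T..2*T} - ({t\<in>{T..2*T}. M (Complex (1/2) t) = 0} \<union> {t\<in>{T..2*T}. zeta (Complex (1/2) t) = 0})"
    by (auto simp only: ex_in_conv[symmetric])
  then have t0: "t0 \<in> {T..2*T}" "M (Complex (1/2) t0) \<noteq> 0" "zeta (Complex (1/2) t0) \<noteq> 0" by simp_all
  have Anz: "A (Complex (1/2) t) \<noteq> 0" if "t \<in> {T..2*T}" for t using that T by (intro aleph_nonzero[OF A]) auto
  have "\<beta> (Complex (1/2) t0) \<noteq> 0"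
    using lineM[OF refl t0(1)] t0 Anz[OF t0(1)] by auto
  then have \<beta>_nz: "\<exists>w\<in>?H. \<beta> w \<noteq> 0" using t0 T by (intro bexI[of _ "Complex (1/2) t0"]) auto
  have Tpos: "T > 0" using T by simp
  have dom: "{s. \<delta> \<le> Re s \<and> Re s \<le> 1/2 \<and> T \<le> Im s \<and> Im s \<le> 2 * T} \<subseteq> ?H" using T by auto
  obtain \<phi> R where L: "continuous_on {T..2*T} \<phi>" "continuous_on {T..2*T} R"
    "\<And>t. t \<in> {T..2*T} \<Longrightarrow> \<beta> (Complex (1/2) t) = of_real (R t) * cis (\<phi> t)"
    "finite {t\<in>{T..2*T}. \<beta> (Complex (1/2) t) = 0}"
    "finite {t\<in>{T..2*T}. \<beta> (Complex \<delta> t) = 0}"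
    "(\<lambda>t. ln (norm (\<beta> (Complex \<delta> t)))) integrable_on {T..2*T}"
    "(\<lambda>t. ln (norm (\<beta> (Complex (1/2) t)))) integrable_on {T..2*T}"
    "0 \<le> integral {T..2*T} (\<lambda>t. ln (norm (\<beta> (Complex \<delta> t)))) - integral {T..2*T} (\<lambda>t. ln (norm (\<beta> (Complex (1/2) t))))
       + horizontal_contribution \<beta> \<delta> (1/2) T
       + (1/2 - \<delta>) * (\<phi> (2*T) - \<phi> T - pi * card E)"
    unfolding E_def
    apply (rule littlewood_inequality[OF \<beta>_hol H \<beta>_nz \<delta> Tpos dom])
    subgoal for \<phi> R by (rule that[of \<phi> R, unfolded E_def])
    done
  show ?int ?fin using L(5,6) by (auto simp: \<beta>_def)
  show ?cont unfolding \<beta>_def[symmetric]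
    by (rule continuous_on_compose2[OF holomorphic_on_imp_continuous_on[OF \<beta>_hol]])
      (use T in \<open>auto intro!: continuous_on_Complex continuous_intros\<close>)
  have Efin: "finite E" by (rule finite_subset[OF _ L(4)]) (auto simp: E_def)
  have Ofin: "finite Od" by (rule finite_subset[OF _ finite_zeta_ordinates[of T "2*T"]]) (auto simp: Od_def)
  have real: "A (Complex (1/2) t) * zeta (Complex (1/2) t) \<in> \<real>" if tT: "t \<in> {T..2*T}" for t
  proof -
    have r: "A s * Y_fun b U s \<in> \<real>" if "Re s = 1/2" "T \<le> Im s" "Im s \<le> 2*T" for s
      unfolding line[OF that] by (rule Reals_of_real)
    have "0 < Im (Complex (1/2) t)" using tT T by simp
    from aleph_zeta_reflection[where b = b and U = U, OF A Tpos b1 b U r this]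
    have "A (Complex (1/2) t) * zeta (Complex (1/2) t) =
        cnj (A (1 - cnj (Complex (1/2) t)) * zeta (1 - cnj (Complex (1/2) t)))" .
    moreover have "1 - cnj (Complex (1/2) t) = Complex (1/2) t" by (simp add: complex_eq_iff)
    ultimately show ?thesis by (simp add: Reals_cnj_iff)
  qed
  \<comment> \<open>Break points are the odd zeros of \<open>zeta\<close> and the zeros of \<beta>
    on the line. The latter cost pi each, which is exactly what Littlewood's inequality subtracts
    for them.\<close>
  have "\<bar>\<phi> (2*T) - \<phi> T\<bar> \<le> pi * (card (E \<union> Od) + 1)"
  proof (rule phase_increment_real_part_le[OF _ L(1,2)])
    show "{t \<in> {T<..<2*T}. R t = 0} \<subseteq> E \<union> Od" using L(3) by (auto simp: E_def)
    fix u v assume uv: "T \<le> u" "u < v" "v \<le> 2*T" "{u<..<v} \<inter> (E \<union> Od) = {}"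
    have "const_sign {u<..<v} (\<lambda>t. Re (A (Complex (1/2) t) * zeta (Complex (1/2) t)))"
    proof (rule zeta_critical_line_sign[OF A _ _ _ uv(1-3)])
      fix t assume t: "u < t" "t < v" "zeta (Complex (1/2) t) = 0"
      then have "t \<notin> Od" using uv(4) by auto
      then show "even (zorder zeta (Complex (1/2) t))" using t uv(1,3) by (simp add: Od_def)
    qed (use T real in auto)
    then have "const_sign {u<..<v} (\<lambda>t. Re (A (Complex (1/2) t) * zeta (Complex (1/2) t)) * ((norm (M (Complex (1/2) t)))\<^sup>2 / c))"
      using c by (intro const_sign_mult) (auto simp: const_sign_def)
    moreover have "Re (A (Complex (1/2) t) * zeta (Complex (1/2) t)) * ((norm (M (Complex (1/2) t)))\<^sup>2 / c) = R t * cos (\<phi> t)"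
      if t: "t \<in> {u<..<v}" for t
    proof -
      have tT: "t \<in> {T..2*T}" using t uv by auto
      have "Re (A (Complex (1/2) t) * zeta (Complex (1/2) t)) * (norm (M (Complex (1/2) t)))\<^sup>2 = c * Re (\<beta> (Complex (1/2) t))"
        using arg_cong[OF lineM[OF refl tT], of Re] by (simp flip: of_real_power)
      then show ?thesis using c L(3)[OF tT] by (simp add: field_simps)
    qed
    ultimately have "const_sign {u<..<v} (\<lambda>t. R t * cos (\<phi> t))" using const_sign_cong by (smt (verit, best))
    then show "(\<forall>t\<in>{u<..<v}. R t * cos (\<phi> t) \<ge> 0) \<or> (\<forall>t\<in>{u<..<v}. R t * cos (\<phi> t) \<le> 0)"
      by (simp add: const_sign_def)
  qed (use T Efin Ofin in auto)
  moreover have "pi * (card (E \<union> Od) + 1) \<le> pi * (real (card E) + real (card Od) + 1)"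
    using card_Un_le[of E Od] by (intro mult_left_mono) auto
  ultimately have "\<phi> (2*T) - \<phi> T - pi * card E \<le> pi * (real (card Od) + 1)"
    by (simp add: distrib_left)
  then have "(1/2 - \<delta>) * (\<phi> (2*T) - \<phi> T - pi * card E) \<le> (1/2 - \<delta>) * (pi * (real (card Od) + 1))"
    using \<delta> by (intro mult_left_mono) auto
  then have 1: "(1/2 - \<delta>) * (\<phi> (2*T) - \<phi> T - pi * card E) \<le> pi * (1/2 - \<delta>) * (real (A_count T (2*T)) + 1)"
    by (simp add: Od_def A_count_def mult_ac)
  have 2: "integral {T..2*T} (\<lambda>t. ln (norm (zeta (Complex (1/2) t)))) + 2 * integral {T..2*T} (\<lambda>t. ln (norm (M (Complex (1/2) t)))) - T * ln c
     \<le> integral {T..2*T} (\<lambda>t. ln (norm (\<beta> (Complex (1/2) t))))"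
  proof -
    have i1: "((\<lambda>t. ln (norm (zeta (Complex (1/2) t))) + 2 * ln (norm (M (Complex (1/2) t))) - ln c) has_integral
       integral {T..2*T} (\<lambda>t. ln (norm (zeta (Complex (1/2) t)))) + 2 * integral {T..2*T} (\<lambda>t. ln (norm (M (Complex (1/2) t)))) - T * ln c) {T..2*T}"
      using has_integral_const_real[of "ln c" T "2*T"] T Z(1) M(1)
      by (intro has_integral_add has_integral_diff has_integral_mult_right integrable_integral) auto
    define N where "N = {t\<in>{T..2*T}. M (Complex (1/2) t) = 0} \<union> {t\<in>{T..2*T}. zeta (Complex (1/2) t) = 0}"
    have Nfin: "finite N" using M(3) Z(3) by (simp add: N_def)
    \<comment> \<open>On the finite set N the integrand is replaced by that of \<beta>: there
      \<open>ln 0\<close> is only a default value and the pointwise comparison could fail.\<close>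
    have "((\<lambda>t. if t \<in> N then ln (norm (\<beta> (Complex (1/2) t))) else ln (norm (zeta (Complex (1/2) t))) + 2 * ln (norm (M (Complex (1/2) t))) - ln c) has_integral
       integral {T..2*T} (\<lambda>t. ln (norm (zeta (Complex (1/2) t)))) + 2 * integral {T..2*T} (\<lambda>t. ln (norm (M (Complex (1/2) t)))) - T * ln c) {T..2*T}"
      by (rule has_integral_spike_finite[OF Nfin _ i1]) simp
    then show ?thesis
    proof (rule has_integral_le[OF _ integrable_integral[OF L(7)]])
      fix t assume t: "t \<in> {T..2*T}"
      show "(if t \<in> N then ln (norm (\<beta> (Complex (1/2) t))) else ln (norm (zeta (Complex (1/2) t))) + 2 * ln (norm (M (Complex (1/2) t))) - ln c)
         \<le> ln (norm (\<beta> (Complex (1/2) t)))"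
      proof (cases "t \<in> N")
        case False
        then have nz: "norm (M (Complex (1/2) t)) > 0" "norm (zeta (Complex (1/2) t)) > 0" using t by (auto simp: N_def)
        have nA: "norm (A (Complex (1/2) t)) = 1" using t T by (intro aleph_norm_critical_line[OF A]) auto
        have "norm (zeta (Complex (1/2) t)) * (norm (M (Complex (1/2) t)))\<^sup>2 = c * \<bar>Re (\<beta> (Complex (1/2) t))\<bar>"
          using arg_cong[OF lineM[OF refl t], of norm] c nA by (simp add: norm_mult norm_power abs_mult)
        also have "\<dots> \<le> c * norm (\<beta> (Complex (1/2) t))" using c abs_Re_le_cmod by (intro mult_left_mono) auto
        finally have le: "norm (zeta (Complex (1/2) t)) * (norm (M (Complex (1/2) t)))\<^sup>2 \<le> c * norm (\<beta> (Complex (1/2) t))" .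
        have pos: "0 < norm (zeta (Complex (1/2) t)) * (norm (M (Complex (1/2) t)))\<^sup>2" using nz by simp
        then have "0 < c * norm (\<beta> (Complex (1/2) t))" using le by linarith
        then have bp: "0 < norm (\<beta> (Complex (1/2) t))" using c by (simp add: zero_less_mult_iff)
        have "ln (norm (zeta (Complex (1/2) t)) * (norm (M (Complex (1/2) t)))\<^sup>2) \<le> ln (c * norm (\<beta> (Complex (1/2) t)))"
          using le pos by (subst ln_le_cancel_iff) auto
        moreover have "ln (norm (zeta (Complex (1/2) t)) * (norm (M (Complex (1/2) t)))\<^sup>2) =
            ln (norm (zeta (Complex (1/2) t))) + 2 * ln (norm (M (Complex (1/2) t)))"
          using nz by (subst ln_mult_pos) (auto simp: ln_realpow)
        moreover have "ln (c * norm (\<beta> (Complex (1/2) t))) = ln c + ln (norm (\<beta> (Complex (1/2) t)))"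
          using c bp by (rule ln_mult_pos)
        ultimately show ?thesis using False by simp
      qed simp
    qed
  qed
  show ?ge
    using L(8) 1 2 M(2) Z(2) unfolding \<beta>_def[symmetric] M_def[symmetric] by argo
qed

section \<open>The number of zeros\<close>

text \<open>On the critical line \<open>A * zeta\<close> is real, so the phase of
  \<open>zeta\<close> loses what the phase of A gains; this is the main term. Zeros on that line
  count half in the argument principle, and the weight 2 of the other zeros makes room for their
  mirror images.\<close>

lemma zeta_zero_sum_le:
  assumes A: "aleph_branch A"
    and refl: "\<And>s. Im s > 0 \<Longrightarrow> A s * zeta s = cnj (A (1 - cnj s) * zeta (1 - cnj s))"
  obtains C where "C > 0"
    "\<And>T1 T2. 4 \<le> T1 \<Longrightarrow> T1 < T2 \<Longrightarrow> (\<And>x. x \<in> {1/2..3} \<Longrightarrow> zeta (Complex x T1) \<noteq> 0 \<and> zeta (Complex x T2) \<noteq> 0) \<Longrightarrow>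
       pi * (\<Sum>z\<in>{s. 1/2 \<le> Re s \<and> Re s \<le> 3 \<and> T1 \<le> Im s \<and> Im s \<le> T2 \<and> zeta s = 0}.
          of_int (zorder zeta z) * (1 + (if Re z = 1/2 then 0 else 1)))
       \<le> 2 * C * T2 + pi + T2 * (ln T2 / 2 + 4)"
proof -
  obtain C where C: "C > 0" "\<And>h. h \<ge> 4 \<Longrightarrow> (\<And>x. x \<in> {1/2..3} \<Longrightarrow> zeta (Complex x h) \<noteq> 0) \<Longrightarrow>
    \<bar>arg_increment zeta (Complex 3 h) (Complex (1/2) h)\<bar> \<le> C * h"
    by (rule zeta_horizontal_increment, rule that, assumption, blast)
  obtain \<theta> where Acis: "\<And>t. t > 0 \<Longrightarrow> A (Complex (1/2) t) = cis (\<theta> t)" and \<theta>: "continuous_on {0<..} \<theta>"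
    and \<theta>_le: "\<And>T1 T2. 1 \<le> T1 \<Longrightarrow> T1 \<le> T2 \<Longrightarrow> \<theta> T2 - \<theta> T1 \<le> T2 * (ln T2 / 2 + 4)"
    by (rule aleph_critical_line_phase[OF A]) (rule that)
  show ?thesis
  proof (rule that[OF C(1)])
    fix T1 T2 :: real
    assume T: "4 \<le> T1" "T1 < T2" and nz: "\<And>x. x \<in> {1/2..3} \<Longrightarrow> zeta (Complex x T1) \<noteq> 0 \<and> zeta (Complex x T2) \<noteq> 0"
    define Z where "Z = {s. 1/2 \<le> Re s \<and> Re s \<le> 3 \<and> T1 \<le> Im s \<and> Im s \<le> T2 \<and> zeta s = 0}"
    have T0: "0 < T1" using T by simp
    obtain \<Omega> G where F: "rect_factorization zeta G Z (\<lambda>z. nat (zorder zeta z)) \<Omega> (1/2) 3 T1 T2"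
      and zo: "\<And>z. z \<in> Z \<Longrightarrow> zorder zeta z > 0"
      by (rule zeta_rect_factorization[OF T0 T(2), folded Z_def]) (rule that)
    interpret rect_factorization zeta G Z "\<lambda>z. nat (zorder zeta z)" \<Omega> "1/2" 3 T1 T2 by (rule F)
    have ZT: "T1 \<notin> Im ` Z" "T2 \<notin> Im ` Z"
    proof -
      have False if z: "z \<in> Z" "Im z = T1 \<or> Im z = T2" for z
      proof -
        have "z = Complex (Re z) (Im z)" by simp
        moreover have "Re z \<in> {1/2..3}" "zeta z = 0" using z by (auto simp: Z_def)
        ultimately show False using nz[of "Re z"] z(2) by metis
      qed
      then show "T1 \<notin> Im ` Z" "T2 \<notin> Im ` Z" by blast+
    qed
    have inc: "\<bar>inc h (1/2)\<bar> \<le> C * h" if "h = T1 \<or> h = T2" for h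
    proof -
      have "arg_increment zeta (Complex 3 h) (Complex (1/2) h) = inc h (1/2)"
        using that ZT T by (intro arg_increment_eq) auto
      then show ?thesis using C(2)[of h] nz that T by force
    qed
    have right: "\<bar>vphase 3 T2 - vphase 3 T1\<bar> \<le> pi"
    proof (rule phase_increment_right_half_plane[OF _ continuous_vphase continuous_vmod vertical_polar])
      show "Re (zeta (Complex 3 t)) > 0" for t
        using Re_zeta_ge[of "Complex 3 t"] by simp
    qed (use T in auto)
    have cont: "continuous_on {T1..T2} \<theta>" by (rule continuous_on_subset[OF \<theta>]) (use T in auto)
    have "vphase (1/2) T2 + \<theta> T2 = vphase (1/2) T1 + \<theta> T1"
    proof (rule phase_constant[OF _ _ cont])
      fix t assume t: "t \<in> {T1..T2}"
      then have t0: "t > 0" using T by simp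
      have "1 - cnj (Complex (1/2) t) = Complex (1/2) t" by (simp add: complex_eq_iff)
      then have "A (Complex (1/2) t) * zeta (Complex (1/2) t) = cnj (A (Complex (1/2) t) * zeta (Complex (1/2) t))"
        using refl[of "Complex (1/2) t"] t0 by simp
      then have "Im (A (Complex (1/2) t) * zeta (Complex (1/2) t)) = 0"
        by (metis Reals_cnj_iff complex_is_Real_iff)
      then show "Im (cis (\<theta> t) * zeta (Complex (1/2) t)) = 0" by (simp only: Acis[OF t0])
    qed (use T in auto)
    moreover have "\<theta> T2 - \<theta> T1 \<le> T2 * (ln T2 / 2 + 4)"
      using T by (intro \<theta>_le) auto
    ultimately have left: "- (vphase (1/2) T2 - vphase (1/2) T1) \<le> T2 * (ln T2 / 2 + 4)" by simp
    have 3: "Re z \<noteq> 3" if "z \<in> Z" for z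
    proof
      assume "Re z = 3"
      then show False using Re_zeta_ge[of z] that by (simp add: Z_def)
    qed
    have "pi * (\<Sum>z\<in>Z. of_int (zorder zeta z) * (1 + (if Re z = 1/2 then 0 else 1))) =
        (\<Sum>z\<in>Z. real (nat (zorder zeta z)) * (pi * ((if Re z = 3 then 0 else 1) + (if Re z = 1/2 then 0 else 1))))"
      unfolding sum_distrib_left
    proof (rule sum.cong[OF HOL.refl])
      fix z assume z: "z \<in> Z"
      have "real (nat (zorder zeta z)) = of_int (zorder zeta z)" using zo[OF z] by simp
      then show "pi * (of_int (zorder zeta z) * (1 + (if Re z = 1/2 then 0 else 1))) =
        real (nat (zorder zeta z)) * (pi * ((if Re z = 3 then 0 else 1) + (if Re z = 1/2 then 0 else 1)))"
        using 3[OF z] by simp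
    qed
    also have "\<dots> = inc T2 (1/2) - inc T1 (1/2) + (vphase 3 T2 - vphase 3 T1) - (vphase (1/2) T2 - vphase (1/2) T1)"
      using argument_principle[OF ZT] by simp
    also have "\<dots> \<le> C * T2 + C * T1 + pi + T2 * (ln T2 / 2 + 4)"
      using inc[of T1] inc[of T2] right left by linarith
    also have "\<dots> \<le> 2 * C * T2 + pi + T2 * (ln T2 / 2 + 4)"
      using C(1) T by simp
    finally show "pi * (\<Sum>z\<in>{s. 1/2 \<le> Re s \<and> Re s \<le> 3 \<and> T1 \<le> Im s \<and> Im s \<le> T2 \<and> zeta s = 0}.
          of_int (zorder zeta z) * (1 + (if Re z = 1/2 then 0 else 1)))
       \<le> 2 * C * T2 + pi + T2 * (ln T2 / 2 + 4)" unfolding Z_def .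
  qed
qed

lemma zeta_zorder_pos:
  assumes "zeta s = 0" "Im s > 0"
  shows "zorder zeta s > 0"
proof -
  let ?H = "{s. Im s > 0}"
  have H: "open ?H" "connected ?H" by (simp_all add: open_halfspace_Im_gt convex_connected convex_halfspace_Im_gt)
  note nz = zeta_nonzero_upper
  have "s \<in> ?H" using assms by simp
  from zorder_exist_zero[OF zeta_holomorphic_upper H this nz] show ?thesis using assms(1) by simp
qed

lemma finite_zeta_zeros_strip:
  "finite {s. zeta s = 0 \<and> 0 < Re s \<and> Re s < 4 \<and> 0 < Im s \<and> Im s \<le> T}"
proof (rule finite_subset[OF _ finite_zeta_zeros[of "4 + \<bar>T\<bar>"]])
  show "{s. zeta s = 0 \<and> 0 < Re s \<and> Re s < 4 \<and> 0 < Im s \<and> Im s \<le> T}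
    \<subseteq> {s. zeta s = 0 \<and> s \<noteq> 1 \<and> s \<in> cball 0 (4 + \<bar>T\<bar>)}"
  proof
    fix s assume s: "s \<in> {s. zeta s = 0 \<and> 0 < Re s \<and> Re s < 4 \<and> 0 < Im s \<and> Im s \<le> T}"
    have "norm s \<le> \<bar>Re s\<bar> + \<bar>Im s\<bar>" by (rule cmod_le)
    also have "\<dots> \<le> 4 + \<bar>T\<bar>" using s by auto
    finally show "s \<in> {s. zeta s = 0 \<and> s \<noteq> 1 \<and> s \<in> cball 0 (4 + \<bar>T\<bar>)}" using s by auto
  qed
qed

text \<open>Only finitely many zeros lie in the strip up to height v, and the argument principle is
  applied with horizontal sides free of zeros.\<close>

lemma generic_height:
  assumes "0 < u" "u < v"
  obtains h where "u < h" "h < v" "\<And>x. x \<in> {1/2..3} \<Longrightarrow> zeta (Complex x h) \<noteq> 0"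
proof -
  define S where "S = Im ` {s. zeta s = 0 \<and> 0 < Re s \<and> Re s < 4 \<and> 0 < Im s \<and> Im s \<le> v}"
  have "finite S" unfolding S_def by (rule finite_imageI[OF finite_zeta_zeros_strip])
  moreover have "infinite {u<..<v}" using assms by (simp add: infinite_Ioo)
  ultimately have "infinite ({u<..<v} - S)" by (rule Diff_infinite_finite)
  from infinite_imp_nonempty[OF this] obtain h where h: "h \<in> {u<..<v} - S"
    by (auto simp only: ex_in_conv[symmetric])
  show ?thesis
  proof (rule that)
    show "zeta (Complex x h) \<noteq> 0" if "x \<in> {1/2..3}" for x
    proof
      assume "zeta (Complex x h) = 0"
      then have "Complex x h \<in> {s. zeta s = 0 \<and> 0 < Re s \<and> Re s < 4 \<and> 0 < Im s \<and> Im s \<le> v}"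
        using that h assms by auto
      then have "h \<in> S" unfolding S_def by (rule image_eqI[rotated]) simp
      then show False using h by simp
    qed
  qed (use h in auto)
qed

text \<open>Zeros to the left of the critical line are reflected to its right with the same
  multiplicity, where they take up the second unit of weight in
  \<open>zeta_zero_sum_le\<close>.\<close>

lemma N_count_le:
  assumes A: "aleph_branch A"
    and refl: "\<And>s. Im s > 0 \<Longrightarrow> A s * zeta s = cnj (A (1 - cnj s) * zeta (1 - cnj s))"
  obtains C where "\<And>T. T \<ge> 5 \<Longrightarrow> N_count T \<le> (T + 1) * ln (T + 1) / (2 * pi) + C * (T + 1)"
proof -
  obtain C where C: "C > 0"
    "\<And>T1 T2. 4 \<le> T1 \<Longrightarrow> T1 < T2 \<Longrightarrow> (\<And>x. x \<in> {1/2..3} \<Longrightarrow> zeta (Complex x T1) \<noteq> 0 \<and> zeta (Complex x T2) \<noteq> 0) \<Longrightarrow>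
       pi * (\<Sum>z\<in>{s. 1/2 \<le> Re s \<and> Re s \<le> 3 \<and> T1 \<le> Im s \<and> Im s \<le> T2 \<and> zeta s = 0}.
          of_int (zorder zeta z) * (1 + (if Re z = 1/2 then 0 else 1)))
       \<le> 2 * C * T2 + pi + T2 * (ln T2 / 2 + 4)"
    by (rule zeta_zero_sum_le[OF A refl], assumption, rule that, assumption, blast)
  \<comment> \<open>The bound for horizontal increments starts at height 4; the zeros up to the
    height chosen here only enter the constant \<open>c0\<close>.\<close>
  obtain T1 :: real where T1: "4 < T1" "T1 < 5" "\<And>x. x \<in> {1/2..3} \<Longrightarrow> zeta (Complex x T1) \<noteq> 0"
    by (rule generic_height[of 4 5]) (simp_all add: that)
  define P where "P u v = {s \<in> nontrivial_zeros. u < Im s \<and> Im s \<le> v}" for u v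
  define c0 where "c0 = \<bar>\<Sum>s\<in>P 0 T1. real_of_int (zorder zeta s)\<bar>"
  show ?thesis
  \<comment> \<open>After division by pi the phase on Re s = 3 gives 1, the horizontal sides give
    \<open>2 * C / pi\<close>, and the lower-order part of the phase of A gives
    \<open>4 / pi\<close>.\<close>
  proof (rule that[of "c0 + 1 + (2 * C + 4) / pi"])
    fix T :: real assume T: "T \<ge> 5"
    obtain T2 where T2: "T < T2" "T2 < T + 1" "\<And>x. x \<in> {1/2..3} \<Longrightarrow> zeta (Complex x T2) \<noteq> 0"
      by (rule generic_height[of T "T + 1"]) (use T in \<open>simp_all add: that\<close>)
    define Z where "Z = {s. 1/2 \<le> Re s \<and> Re s \<le> 3 \<and> T1 \<le> Im s \<and> Im s \<le> T2 \<and> zeta s = 0}"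
    have Pfin: "finite (P u v)" if "0 \<le> u" for u v
      by (rule finite_subset[OF _ finite_zeta_zeros_strip[of v]]) (use that in \<open>auto simp: P_def nontrivial_zeros_def\<close>)
    have Zfin: "finite Z"
      by (rule finite_subset[OF _ finite_zeta_zeros_strip[of T2]]) (use T1 in \<open>auto simp: Z_def\<close>)
    have Zpos: "zorder zeta z > 0" if "z \<in> Z" for z
      using that T1(1) by (intro zeta_zorder_pos) (auto simp: Z_def)
    have "{s. s \<in> nontrivial_zeros \<and> 0 < Im s \<and> Im s \<le> T} = P 0 T1 \<union> P T1 T"
      using T1(1,2) T by (auto simp: P_def)
    then have "N_count T = (\<Sum>s\<in>P 0 T1 \<union> P T1 T. of_int (zorder zeta s))" by (simp only: N_count_def)
    also have "\<dots> = (\<Sum>s\<in>P 0 T1. of_int (zorder zeta s)) + (\<Sum>s\<in>P T1 T. of_int (zorder zeta s))"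
      using T1(1) by (intro sum.union_disjoint Pfin) (auto simp: P_def)
    finally have N: "N_count T \<le> c0 + (\<Sum>s\<in>P T1 T. of_int (zorder zeta s))" by (simp add: c0_def)
    define L R where "L = {s\<in>P T1 T. Re s < 1/2}" and "R = {s\<in>P T1 T. Re s \<ge> 1/2}"
    have LR: "finite L" "finite R" using Pfin[of T1 T] T1(1) by (auto simp: L_def R_def)
    have LP: "P T1 T = L \<union> R" "L \<inter> R = {}" by (auto simp: L_def R_def)
    have Lim: "Im s > 0" "zeta s = 0" "0 < Re s" "Re s < 1/2" "T1 < Im s" "Im s \<le> T" if "s \<in> L" for s
      using that T1(1) by (auto simp: L_def P_def nontrivial_zeros_def)
    have "(\<Sum>s\<in>L. real_of_int (zorder zeta s)) = (\<Sum>s\<in>(\<lambda>s. 1 - cnj s) ` L. of_int (zorder zeta s))"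
    proof (subst sum.reindex)
      show "inj_on (\<lambda>s. 1 - cnj s) L" by (auto simp: inj_on_def)
      show "(\<Sum>s\<in>L. real_of_int (zorder zeta s)) = sum ((\<lambda>s. of_int (zorder zeta s)) \<circ> (\<lambda>s. 1 - cnj s)) L"
        using zorder_reflection[OF A refl Lim(1)] by (intro sum.cong) auto
    qed
    also have "\<dots> \<le> (\<Sum>s\<in>{s\<in>Z. Re s \<noteq> 1/2}. of_int (zorder zeta s))"
    proof (rule sum_mono2)
      show "(\<lambda>s. 1 - cnj s) ` L \<subseteq> {s\<in>Z. Re s \<noteq> 1/2}"
      proof
        fix z assume "z \<in> (\<lambda>s. 1 - cnj s) ` L"
        then obtain s where s: "s \<in> L" "z = 1 - cnj s" by blast
        have "A (1 - cnj s) * zeta (1 - cnj s) = 0"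
          using refl[OF Lim(1)[OF s(1)]] Lim(2)[OF s(1)] by simp
        moreover have "A (1 - cnj s) \<noteq> 0" using Lim(1)[OF s(1)] by (intro aleph_nonzero[OF A]) simp
        ultimately have "zeta z = 0" using s(2) by simp
        then show "z \<in> {s\<in>Z. Re s \<noteq> 1/2}"
          using Lim(3-6)[OF s(1)] s(2) T2(1) by (simp add: Z_def)
      qed
    qed (use Zfin Zpos in \<open>auto intro!: less_imp_le[OF Zpos]\<close>)
    also have "\<dots> = (\<Sum>s\<in>Z. of_int (zorder zeta s) * (if Re s = 1/2 then 0 else 1))"
      by (subst sum.inter_filter[OF Zfin]) (auto intro!: sum.cong)
    finally have 1: "(\<Sum>s\<in>L. real_of_int (zorder zeta s)) \<le> (\<Sum>s\<in>Z. of_int (zorder zeta s) * (if Re s = 1/2 then 0 else 1))" .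
    have 2: "(\<Sum>s\<in>R. real_of_int (zorder zeta s)) \<le> (\<Sum>s\<in>Z. of_int (zorder zeta s))"
    proof (rule sum_mono2[OF Zfin])
      show "R \<subseteq> Z" using T2(1) by (auto simp: R_def P_def Z_def nontrivial_zeros_def)
      show "0 \<le> real_of_int (zorder zeta z)" if "z \<in> Z - R" for z using Zpos[of z] that by simp
    qed
    have "pi * (\<Sum>s\<in>P T1 T. of_int (zorder zeta s)) \<le> pi * (\<Sum>z\<in>Z. of_int (zorder zeta z) * (1 + (if Re z = 1/2 then 0 else 1)))"
    proof (intro mult_left_mono)
      have "(\<Sum>s\<in>P T1 T. real_of_int (zorder zeta s)) = (\<Sum>s\<in>L. of_int (zorder zeta s)) + (\<Sum>s\<in>R. of_int (zorder zeta s))"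
        unfolding LP(1) by (rule sum.union_disjoint[OF LR LP(2)])
      also have "\<dots> \<le> (\<Sum>s\<in>Z. of_int (zorder zeta s) * (if Re s = 1/2 then 0 else 1)) + (\<Sum>s\<in>Z. of_int (zorder zeta s))"
        by (rule add_mono[OF 1 2])
      also have "\<dots> = (\<Sum>z\<in>Z. of_int (zorder zeta z) * (1 + (if Re z = 1/2 then 0 else 1)))"
        by (simp add: sum.distrib[symmetric] algebra_simps)
      finally show "(\<Sum>s\<in>P T1 T. real_of_int (zorder zeta s)) \<le> (\<Sum>z\<in>Z. of_int (zorder zeta z) * (1 + (if Re z = 1/2 then 0 else 1)))" .
    qed simp
    also have "\<dots> \<le> 2 * C * T2 + pi + T2 * (ln T2 / 2 + 4)"
      unfolding Z_def using T1 T2 T by (intro C(2)) auto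
    also have "\<dots> \<le> 2 * C * (T + 1) + pi * (T + 1) + (T + 1) * (ln (T + 1) / 2 + 4)"
    proof (intro add_mono mult_mono)
      show "pi \<le> pi * (T + 1)" using T mult_left_mono[of 1 "T + 1" pi] by simp
      show "0 \<le> ln T2 / 2 + 4" using T2(1) T by (simp add: ln_ge_zero)
    qed (use T T2 C(1) in auto)
    finally have "(\<Sum>s\<in>P T1 T. of_int (zorder zeta s)) \<le> (2 * C * (T + 1) + pi * (T + 1) + (T + 1) * (ln (T + 1) / 2 + 4)) / pi"
      by (simp add: pos_le_divide_eq mult.commute)
    also have "\<dots> = (T + 1) * ln (T + 1) / (2 * pi) + (1 + (2 * C + 4) / pi) * (T + 1)"
      by (simp add: field_simps)
    finally have "N_count T \<le> c0 + ((T + 1) * ln (T + 1) / (2 * pi) + (1 + (2 * C + 4) / pi) * (T + 1))"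
      using N by linarith
    moreover have "c0 \<le> c0 * (T + 1)" using T mult_left_mono[of 1 "T + 1" c0] by (simp add: c0_def)
    ultimately show "N_count T \<le> (T + 1) * ln (T + 1) / (2 * pi) + (c0 + 1 + (2 * C + 4) / pi) * (T + 1)"
      by (simp add: algebra_simps)
  qed
qed

section \<open>The proportion of zeros on the critical line\<close>

text \<open>Concavity enters through the tangent bound ln y \<le> y - 1 with
  \<open>y = (norm (f t))\<^sup>2 / m\<close>. It is enough that m dominates the mean square,
  because the linear terms then have nonpositive integral.\<close>

lemma log_integral_le_ln_mean_square:
  fixes f :: "real \<Rightarrow> complex"
  assumes T: "0 < T" and m: "0 < m" and cont: "continuous_on {T..2*T} f"
    and fin: "finite {t\<in>{T..2*T}. f t = 0}"
    and int: "(\<lambda>t. ln (norm (f t))) integrable_on {T..2*T}"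
    and le: "1 / T * integral {T..2*T} (\<lambda>t. (norm (f t))\<^sup>2) \<le> m"
  shows "integral {T..2*T} (\<lambda>t. ln (norm (f t))) \<le> T / 2 * ln m"
proof -
  define g where "g t = ((norm (f t))\<^sup>2 / m - 1 + ln m) / 2" for t
  have sq: "(\<lambda>t. (norm (f t))\<^sup>2) integrable_on {T..2*T}"
    by (intro integrable_continuous_real continuous_on_power continuous_on_norm cont)
  have gi: "(g has_integral (integral {T..2*T} (\<lambda>t. (norm (f t))\<^sup>2) / m - T + T * ln m) / 2) {T..2*T}"
    unfolding g_def
    using has_integral_const_real[of "1 :: real" T "2*T"] has_integral_const_real[of "ln m" T "2*T"] T
    by (intro has_integral_divide has_integral_add has_integral_diff integrable_integral[OF sq]) auto
  define N where "N = {t\<in>{T..2*T}. f t = 0}"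
  have "((\<lambda>t. if t \<in> N then ln (norm (f t)) else g t) has_integral
      (integral {T..2*T} (\<lambda>t. (norm (f t))\<^sup>2) / m - T + T * ln m) / 2) {T..2*T}"
    by (rule has_integral_spike_finite[OF fin[folded N_def] _ gi]) simp
  then have "integral {T..2*T} (\<lambda>t. ln (norm (f t))) \<le> (integral {T..2*T} (\<lambda>t. (norm (f t))\<^sup>2) / m - T + T * ln m) / 2"
  proof (rule has_integral_le[OF integrable_integral[OF int]])
    fix t assume t: "t \<in> {T..2*T}"
    show "ln (norm (f t)) \<le> (if t \<in> N then ln (norm (f t)) else g t)"
    proof (cases "t \<in> N")
      case False
      then have pos: "norm (f t) > 0" using t by (simp add: N_def)
      have "ln ((norm (f t))\<^sup>2 / m) \<le> (norm (f t))\<^sup>2 / m - 1"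
        using pos m by (intro ln_le_minus_one) simp
      moreover have "ln ((norm (f t))\<^sup>2 / m) = 2 * ln (norm (f t)) - ln m"
        using pos m by (subst ln_div) (auto simp: ln_realpow)
      ultimately show ?thesis using False by (simp add: g_def)
    qed simp
  qed
  moreover have "integral {T..2*T} (\<lambda>t. (norm (f t))\<^sup>2) / m \<le> T"
    using le T m by (simp add: field_simps)
  ultimately show ?thesis by simp
qed

text \<open>The block is closed at T in \<open>A_count\<close> but open there in the difference of
  \<open>N0_count\<close>; an odd zero at height exactly T accounts for the 1.\<close>

lemma A_count_le_N0_count:
  assumes "T > 0"
  shows "real (A_count T (2 * T)) - 1 \<le> N0_count (2 * T) - N0_count T"
proof -
  define S where "S u = {s. s \<in> nontrivial_zeros \<and> 0 < Im s \<and> Im s \<le> u \<and> Re s = 1 / 2}" for u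
  define Od where "Od = {t. T \<le> t \<and> t \<le> 2*T \<and> zeta (Complex (1/2) t) = 0 \<and> odd (zorder zeta (Complex (1/2) t))}"
  have Sfin: "finite (S u)" for u
    by (rule finite_subset[OF _ finite_zeta_zeros_strip[of u]]) (auto simp: S_def nontrivial_zeros_def)
  have "S T \<subseteq> S (2 * T)" using assms by (auto simp: S_def)
  then have eq: "N0_count (2 * T) - N0_count T = (\<Sum>s\<in>S (2*T) - S T. of_int (zorder zeta s))"
    unfolding N0_count_def S_def[symmetric] using Sfin by (simp add: sum_diff)
  have "real (card (S (2*T) - S T)) = (\<Sum>s\<in>S (2*T) - S T. 1)" by simp
  also have "\<dots> \<le> (\<Sum>s\<in>S (2*T) - S T. of_int (zorder zeta s))"
  proof (rule sum_mono)
    fix s assume "s \<in> S (2*T) - S T"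
    then have "zorder zeta s > 0" by (intro zeta_zorder_pos) (auto simp: S_def nontrivial_zeros_def)
    then show "1 \<le> real_of_int (zorder zeta s)" by simp
  qed
  finally have "real (card (S (2*T) - S T)) \<le> N0_count (2 * T) - N0_count T" using eq by simp
  moreover have "card (Od - {T}) \<le> card (S (2*T) - S T)"
  proof (rule card_inj_on_le)
    show "inj_on (Complex (1/2)) (Od - {T})" by (auto simp: inj_on_def)
    show "Complex (1/2) ` (Od - {T}) \<subseteq> S (2*T) - S T"
      using assms by (auto simp: Od_def S_def nontrivial_zeros_def)
  qed (use Sfin in simp)
  moreover have "card Od - 1 \<le> card (Od - {T})"
    using diff_card_le_card_Diff[of "{T}" Od] by simp
  ultimately show ?thesis unfolding A_count_def Od_def[symmetric] by linarith
qed

lemma N0_count_le_N_count: "N0_count T \<le> N_count T"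
  unfolding N0_count_def N_count_def
proof (rule sum_mono2)
  show "finite {s \<in> nontrivial_zeros. 0 < Im s \<and> Im s \<le> T}"
    by (rule finite_subset[OF _ finite_zeta_zeros_strip[of T]]) (auto simp: nontrivial_zeros_def)
  show "0 \<le> real_of_int (zorder zeta s)"
    if "s \<in> {s \<in> nontrivial_zeros. 0 < Im s \<and> Im s \<le> T} - {s \<in> nontrivial_zeros. 0 < Im s \<and> Im s \<le> T \<and> Re s = 1 / 2}" for s
    using zeta_zorder_pos[of s] that by (simp add: nontrivial_zeros_def)
qed auto

lemma N0_count_nonneg: "0 \<le> N0_count T"
  unfolding N0_count_def
proof (rule sum_nonneg)
  show "0 \<le> real_of_int (zorder zeta s)"
    if "s \<in> {s \<in> nontrivial_zeros. 0 < Im s \<and> Im s \<le> T \<and> Re s = 1 / 2}" for s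
    using zeta_zorder_pos[of s] that by (simp add: nontrivial_zeros_def)
qed

text \<open>Adding the J blocks that end at T gives k * T times 1/2 + 1/4 + ..., with a logarithm of
  at least ln T - J ln 2. J is fixed first, so that the geometric sum keeps the constant above
  \<open>k'\<close>; then a large T absorbs the loss J ln 2.\<close>

lemma eventually_ge_of_dyadic_increments:
  fixes F :: "real \<Rightarrow> real"
  assumes nonneg: "\<And>T. F T \<ge> 0" and k: "0 < k" "k' < k"
    and ev: "\<forall>\<^sub>F T in at_top. k * (T * ln T) \<le> F (2 * T) - F T"
  shows "\<forall>\<^sub>F T in at_top. k' * (T * ln T) \<le> F T"
proof -
  from ev obtain T0 where T0: "\<And>T. T \<ge> T0 \<Longrightarrow> k * (T * ln T) \<le> F (2 * T) - F T"
    by (auto simp: eventually_at_top_linorder)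
  define T1 where "T1 = max T0 1"
  have step: "k * (1 - 1 / 2 ^ J) * (T * (ln T - real J * ln 2)) \<le> F T" if "T \<ge> T1 * 2 ^ J" for J T
    using that
  proof (induction J arbitrary: T)
    case 0
    then show ?case using nonneg[of T] by simp
  next
    case (Suc J)
    have T2: "T / 2 \<ge> T1 * 2 ^ J" using Suc.prems by simp
    have "T1 * 1 \<le> T1 * 2 ^ J" by (intro mult_left_mono) (auto simp: T1_def)
    then have T2': "T / 2 \<ge> T0" "T / 2 \<ge> 1" using T2 by (auto simp: T1_def)
    have ln2: "ln (T / 2) = ln T - ln 2" using T2' by (subst ln_div) auto
    define w where "w = ln T - real (Suc J) * ln 2"
    have "k * (1 - 1 / 2 ^ J) * (T / 2 * w) \<le> F (T / 2)"
      using Suc.IH[OF T2] ln2 by (simp add: w_def algebra_simps)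
    moreover have "k * (T / 2 * w) \<le> k * (T / 2 * ln (T / 2))"
      using k T2' unfolding ln2 w_def by (intro mult_left_mono) (auto simp: algebra_simps)
    moreover have "k * (T / 2 * ln (T / 2)) \<le> F T - F (T / 2)"
      using T0[OF T2'(1)] by simp
    ultimately have "k * (1 - 1 / 2 ^ J) * (T / 2 * w) + k * (T / 2 * w) \<le> F T" by linarith
    moreover have "k * (1 - 1 / 2 ^ J) * (T / 2 * w) + k * (T / 2 * w) = k * (1 - 1 / 2 ^ Suc J) * (T * w)"
      by (simp add: field_simps)
    ultimately show ?case by (simp add: w_def)
  qed
  have "(\<lambda>J. k * (1 - (1 / 2) ^ J)) \<longlonglongrightarrow> k * (1 - 0)"
    by (intro tendsto_intros LIMSEQ_power_zero) simp
  then have "\<forall>\<^sub>F J in sequentially. k' < k * (1 - (1 / 2) ^ J)"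
    using k by (intro order_tendstoD) simp_all
  then obtain J where J: "k' < k * (1 - (1 / 2) ^ J)" by (auto simp: eventually_sequentially)
  define k2 where "k2 = k * (1 - 1 / 2 ^ J)"
  have k2: "k' < k2" using J by (simp add: k2_def power_divide)
  have "\<forall>\<^sub>F T in at_top. ln T \<ge> k2 * (real J * ln 2) / (k2 - k')"
    by (rule filterlim_at_top[THEN iffD1, rule_format, OF ln_at_top])
  with eventually_ge_at_top[of "T1 * 2 ^ J"] eventually_ge_at_top[of "0 :: real"]
  show ?thesis
  proof eventually_elim
    case (elim T)
    have "k2 * (real J * ln 2) \<le> ln T * (k2 - k')"
      using elim(3) k2 by (simp add: pos_divide_le_eq)
    then have "k' * ln T \<le> k2 * (ln T - real J * ln 2)" by (simp add: algebra_simps)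
    then have "T * (k' * ln T) \<le> T * (k2 * (ln T - real J * ln 2))"
      using elim(2) by (rule mult_left_mono)
    also have "\<dots> \<le> F T" using step[OF elim(1)] by (simp add: k2_def mult_ac)
    finally show ?case by (simp add: mult_ac)
  qed
qed

text \<open>Only the leading coefficient of the bound for \<open>N_count\<close> survives in the
  limit, since \<open>T * ln T\<close> divided by that bound tends to \<open>2 * pi\<close>.
  Positivity of \<open>N_count\<close>, needed for the quotient, comes from the lower bound for
  \<open>N0_count\<close>.\<close>

lemma kappa0_ge:
  assumes q: "q > 0" and N: "\<And>T. T \<ge> 5 \<Longrightarrow> N_count T \<le> (T + 1) * ln (T + 1) / (2 * pi) + C * (T + 1)"
    and ev: "\<And>k. 0 < k \<Longrightarrow> k < q \<Longrightarrow> \<forall>\<^sub>F T in at_top. k * (T * ln T) \<le> N0_count T"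
  shows "kappa0 \<ge> ereal (2 * pi * q)"
  unfolding kappa0_def le_Liminf_iff
proof (intro allI impI)
  fix y assume "y < ereal (2 * pi * q)"
  then have "max y 0 < ereal (2 * pi * q)" using q by simp
  then obtain z where z: "max y 0 < ereal z" "ereal z < ereal (2 * pi * q)"
    using ereal_dense2 by blast
  then have z': "0 < z" "y < ereal z" "z < 2 * pi * q" by auto
  obtain k where k: "z / (2 * pi) < k" "k < q"
    using dense[of "z / (2 * pi)" q] z'(3) by (auto simp: field_simps)
  have "0 < z / (2 * pi)" using z'(1) by simp
  then have k0: "0 < k" using k(1) by linarith
  define g where "g T = (T + 1) * ln (T + 1) / (2 * pi) + C * (T + 1)" for T
  have "((\<lambda>T. T * ln T / g T) \<longlongrightarrow> 2 * pi) at_top"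
    unfolding g_def by (real_asymp simp: field_simps)
  moreover have "z / k < 2 * pi" using k(1) k0 by (simp add: field_simps)
  ultimately have "\<forall>\<^sub>F T in at_top. z / k < T * ln T / g T" by (rule order_tendstoD)
  with ev[OF k0 k(2)] eventually_ge_at_top[of "5 :: real"]
  show "\<forall>\<^sub>F T in at_top. y < ereal (N0_count T / N_count T)"
  proof eventually_elim
    case (elim T)
    have pos: "0 < T * ln T" using elim(2) by simp
    then have "0 < N0_count T" using elim(1) k0 mult_pos_pos[OF k0 pos] by linarith
    then have Np: "0 < N_count T" using N0_count_le_N_count[of T] by linarith
    then have gp: "0 < g T" using N[OF elim(2)] by (simp add: g_def)
    have "z * N_count T \<le> z * g T" using N[OF elim(2)] z'(1) by (simp add: g_def)
    also have "\<dots> < k * (T * ln T)" using elim(3) k0 gp by (simp add: field_simps)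
    also have "\<dots> \<le> N0_count T" by (rule elim(1))
    finally have "z < N0_count T / N_count T" using Np by (simp add: pos_less_divide_eq)
    then show ?case using z'(2) by (meson ereal_less(3) less_ereal.simps(1) less_trans)
  qed
qed

lemma ln_ratio_tendsto:
  fixes U :: "real \<Rightarrow> real"
  assumes "(\<lambda>T. ln (U T) - \<theta> * ln T) \<in> O(\<lambda>T. 1)"
  shows "((\<lambda>T. ln (U T) / ln T) \<longlongrightarrow> \<theta>) at_top"
proof -
  have "(\<lambda>T :: real. 1) \<in> o(\<lambda>T. ln T :: real)" by real_asymp
  with assms have "(\<lambda>T. ln (U T) - \<theta> * ln T) \<in> o(\<lambda>T. ln T)" by (rule landau_o.big_small_trans)
  then have "((\<lambda>T. (ln (U T) - \<theta> * ln T) / ln T) \<longlongrightarrow> 0) at_top" by (rule smalloD_tendsto)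
  then have "((\<lambda>T. (ln (U T) - \<theta> * ln T) / ln T + \<theta>) \<longlongrightarrow> 0 + \<theta>) at_top"
    by (intro tendsto_add tendsto_const)
  moreover have "\<forall>\<^sub>F T :: real in at_top. (ln (U T) - \<theta> * ln T) / ln T + \<theta> = ln (U T) / ln T"
    using eventually_gt_at_top[of 1] by eventually_elim (simp add: field_simps)
  ultimately show ?thesis by (simp add: tendsto_cong)
qed

section \<open>Optimal width of the rectangle and conclusion\<close>

theorem proposition4p3:
  fixes b :: "real \<Rightarrow> nat \<Rightarrow> real" and U :: "real \<Rightarrow> real"
    and A :: "complex \<Rightarrow> complex" and \<theta> c \<gamma> :: real
  assumes b_1: "\<And>T. b T 1 = 1"
    and b_bound: "\<And>T n. n \<ge> 1 \<Longrightarrow> \<bar>b T n\<bar> \<le> 1"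
    and theta: "0 < \<theta>" "\<theta> < 1 / 4"
    and U_pos: "\<forall>\<^sub>F T in at_top. 0 < U T"
    and U_order: "U \<in> \<Theta>(\<lambda>T. T powr \<theta>)"
    and U_log: "(\<lambda>T. ln (U T) - \<theta> * ln T) \<in> O(\<lambda>T. 1)"
    and aleph: "aleph_branch A"
    and c_pos: "0 < c" and gamma_pos: "0 < \<gamma>"
    and critical_line:
      "\<forall>\<^sub>F T in at_top. \<forall>s. Re s = 1 / 2 \<and> T \<le> Im s \<and> Im s \<le> 2 * T \<longrightarrow>
         A s * Y_fun (b T) (U T) s = of_real (c * Re (beta A (b T) (U T) T s))"
    and horizontal_beta:
      "\<And>k1 k2. 0 < k1 \<Longrightarrow> k1 \<le> k2 \<Longrightarrow>
         \<exists>h. h \<in> o(\<lambda>T. T) \<and>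
           (\<forall>\<^sub>F T in at_top. \<forall>\<delta>\<in>delta_range k1 k2 T.
              \<bar>horizontal_contribution (beta A (b T) (U T) T) \<delta> (1 / 2) T\<bar> \<le> h T)"
    and horizontal_zeta:
      "(\<lambda>T. horizontal_contribution zeta (1 / 2) 3 T) \<in> o(\<lambda>T. T)"
    and horizontal_mollifier:
      "(\<lambda>T. horizontal_contribution (mollifier (b T) (U T)) (1 / 2) 3 T) \<in> o(\<lambda>T. T)"
    and mean_square:
      "\<And>k1 k2. 0 < k1 \<Longrightarrow> k1 \<le> k2 \<Longrightarrow>
         \<exists>r. (r \<longlongrightarrow> 0) at_top \<and>
           (\<forall>\<^sub>F T in at_top. \<forall>\<delta>\<in>delta_range k1 k2 T.
              1 / T * integral {T..2 * T}
                 (\<lambda>t. (norm (beta A (b T) (U T) T (Complex \<delta> t)))\<^sup>2)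
              \<le> \<gamma> / ((1 - 2 * \<delta>) * ln (U T)) * (1 + r T))"
  shows "(\<exists>r. (r \<longlongrightarrow> 0) at_top \<and>
            (\<forall>\<^sub>F T in at_top.
               real (A_count T (2 * T))
                 \<ge> T * ln (U T) / (pi * exp 1 * c\<^sup>2 * \<gamma>) * (1 + r T))) \<and>
         kappa0 \<ge> ereal (2 * \<theta> / (exp 1 * c\<^sup>2 * \<gamma>))"
proof -
  define L where "L T = ln (U T)" for T
  define K where "K = pi * exp 1 * c\<^sup>2 * \<gamma>"
  define e where "e = exp 1 * \<gamma> * c\<^sup>2"
  \<comment> \<open>\<open>x = e / L T\<close> maximises \<open>ln (x * L T / (\<gamma> * c\<^sup>2)) / x\<close>, hence the resulting bound\<close>
  define \<delta> where "\<delta> T = (1 - e / L T) / 2" for T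
  have \<delta>_eq: "1 - 2 * \<delta> T = e / L T" for T
  proof -
    have "1 - 2 * ((1 - y) / 2) = y" for y :: real by (simp add: field_simps)
    then show ?thesis unfolding \<delta>_def .
  qed
  have e: "e > 0" using c_pos gamma_pos by (simp add: e_def)
  have K: "K = pi * e" "K > 0" using c_pos gamma_pos by (simp_all add: e_def K_def)
  have L_lim: "((\<lambda>T. L T / ln T) \<longlongrightarrow> \<theta>) at_top"
    unfolding L_def by (rule ln_ratio_tendsto[OF U_log])
  have L_bounds: "\<forall>\<^sub>F T in at_top. \<theta> / 2 * ln T < L T \<and> L T < 2 * \<theta> * ln T"
  proof -
    have "\<forall>\<^sub>F T in at_top. \<theta> / 2 < L T / ln T" "\<forall>\<^sub>F T in at_top. L T / ln T < 2 * \<theta>"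
      using theta(1) by (intro order_tendstoD[OF L_lim]; simp)+
    with eventually_gt_at_top[of 1] show ?thesis
      by eventually_elim (simp add: pos_less_divide_eq pos_divide_less_eq)
  qed
  have L_top: "filterlim L at_top at_top"
  proof (rule filterlim_at_top_mono)
    show "filterlim (\<lambda>T. \<theta> / 2 * ln T) at_top at_top" using theta(1) by real_asymp
    show "\<forall>\<^sub>F T in at_top. \<theta> / 2 * ln T \<le> L T" using L_bounds by (rule eventually_mono) simp
  qed
  have L_pos: "\<forall>\<^sub>F T in at_top. L T > 0"
    using L_top by (rule eventually_compose_filterlim[OF eventually_gt_at_top])
  \<comment> \<open>\<open>L T\<close> lies between \<theta> / 2 and 2 * \<theta> times
    \<open>ln T\<close>, so these constants enclose \<open>e / L T\<close> times
    \<open>ln T\<close>. The uniform hypotheses can then be used along the moving \<delta>.\<close>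
  define k1 k2 where "k1 = e / (2 * \<theta>)" and "k2 = 2 * e / \<theta>"
  have "2 * e / \<theta> = 4 * (e / (2 * \<theta>))" by simp
  moreover have "e / (2 * \<theta>) > 0" using e theta(1) by simp
  ultimately have k12: "0 < k1" "k1 \<le> k2" by (simp_all only: k1_def k2_def)
  have \<delta>_range: "\<forall>\<^sub>F T in at_top. \<delta> T \<in> delta_range k1 k2 T"
    using L_bounds L_pos eventually_gt_at_top[of 1]
  proof eventually_elim
    case (elim T)
    have lT: "ln T > 0" using elim(3) by simp
    have "k1 / ln T \<le> e / L T" "e / L T \<le> k2 / ln T"
      using elim lT e theta(1) by (simp_all add: k1_def k2_def field_simps)
    then show ?case unfolding delta_range_def \<delta>_eq mem_Collect_eq by simp
  qed
  obtain h where h: "h \<in> o(\<lambda>T. T)"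
    "\<forall>\<^sub>F T in at_top. \<forall>\<delta>\<in>delta_range k1 k2 T.
       \<bar>horizontal_contribution (beta A (b T) (U T) T) \<delta> (1 / 2) T\<bar> \<le> h T"
    using horizontal_beta[OF k12] by (elim exE conjE) (rule that)
  obtain r where r: "(r \<longlongrightarrow> 0) at_top"
    "\<forall>\<^sub>F T in at_top. \<forall>\<delta>\<in>delta_range k1 k2 T.
       1 / T * integral {T..2 * T} (\<lambda>t. (norm (beta A (b T) (U T) T (Complex \<delta> t)))\<^sup>2)
       \<le> \<gamma> / ((1 - 2 * \<delta>) * ln (U T)) * (1 + r T)"
    using mean_square[OF k12] by (elim exE conjE) (rule that)
  define err where "err T = h T + horizontal_contribution zeta (1 / 2) 3 T
    + 2 * horizontal_contribution (mollifier (b T) (U T)) (1 / 2) 3 T + (12 + 15 / 2 * pi)" for T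
  \<comment> \<open>The three terms stem from the mean square, from the horizontal and bounded
    errors, and from the 1 added to \<open>A_count\<close>. The absolute value keeps the argument of
    the logarithm positive.\<close>
  define r' where "r' T = - ln (1 + \<bar>r T\<bar>) - 2 * (err T / T) - K / (T * L T)" for T
  have "err \<in> o(\<lambda>T. T)"
    unfolding err_def
  proof (intro sum_in_smallo h(1) horizontal_zeta)
    show "(\<lambda>T. 2 * horizontal_contribution (mollifier (b T) (U T)) (1 / 2) 3 T) \<in> o(\<lambda>T. T)"
      using horizontal_mollifier by simp
  qed real_asymp+
  then have err_lim: "((\<lambda>T. err T / T) \<longlongrightarrow> 0) at_top" by (rule smalloD_tendsto)
  have TL_lim: "((\<lambda>T. K / (T * L T)) \<longlongrightarrow> 0) at_top"
    by (rule tendsto_divide_0[OF tendsto_const]) (rule filterlim_at_top_imp_at_infinity[OF filterlim_at_top_mult_at_top[OF filterlim_ident L_top]])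
  have "((\<lambda>T. - ln (1 + \<bar>r T\<bar>) - 2 * (err T / T) - K / (T * L T)) \<longlongrightarrow> - ln (1 + \<bar>0\<bar>) - 2 * 0 - 0) at_top"
    by (intro tendsto_diff tendsto_minus tendsto_ln tendsto_add tendsto_const tendsto_rabs r(1) tendsto_mult err_lim TL_lim) simp
  then have r'_lim: "(r' \<longlongrightarrow> 0) at_top" by (simp add: r'_def[abs_def])
  have A_ge: "\<forall>\<^sub>F T in at_top. real (A_count T (2 * T)) \<ge> T * L T / K * (1 + r' T)"
    using U_pos critical_line h(2) r(2) \<delta>_range L_pos eventually_ge_at_top[of 1]
  proof eventually_elim
    case (elim T)
    have U1: "U T \<ge> 1" using elim(1,6) by (simp add: L_def)
    note x = \<delta>_eq[of T]
    have x0: "e / L T > 0" using e elim(6) by simp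
    then have \<delta>: "\<delta> T < 1 / 2" using x by linarith
    have line: "A s * Y_fun (b T) (U T) s = of_real (c * Re (beta A (b T) (U T) T s))"
      if "Re s = 1 / 2" "T \<le> Im s" "Im s \<le> 2 * T" for s
      using elim(2) that by blast
    note ac = A_count_ge[where b = "b T" and U = "U T", OF aleph elim(7) b_1 b_bound U1 c_pos \<delta> line]
    \<comment> \<open>With x * L T = e the bound for the mean square is
      \<open>\<gamma> / e * (1 + r T)\<close>, and \<open>\<gamma> / e\<close> is
      \<open>1 / (exp 1 * c\<^sup>2)\<close>.\<close>
    define m where "m = (1 + \<bar>r T\<bar>) / (exp 1 * c\<^sup>2)"
    have m: "m > 0" using c_pos by (simp add: m_def add_pos_nonneg)
    have Tp: "T > 0" using elim(7) by simp
    have "1 / T * integral {T..2 * T} (\<lambda>t. (norm (beta A (b T) (U T) T (Complex (\<delta> T) t)))\<^sup>2)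
       \<le> \<gamma> / ((1 - 2 * \<delta> T) * ln (U T)) * (1 + r T)"
      using elim(4,5) by blast
    also have "(1 - 2 * \<delta> T) * ln (U T) = e" using elim(6) by (simp add: x L_def)
    also have "\<gamma> / e * (1 + r T) = (1 + r T) / (exp 1 * c\<^sup>2)"
      using gamma_pos by (simp add: e_def)
    also have "\<dots> \<le> m" unfolding m_def by (intro divide_right_mono) auto
    finally have ms: "1 / T * integral {T..2 * T} (\<lambda>t. (norm (beta A (b T) (U T) T (Complex (\<delta> T) t)))\<^sup>2) \<le> m" .
    have "integral {T..2 * T} (\<lambda>t. ln (norm (beta A (b T) (U T) T (Complex (\<delta> T) t)))) \<le> T / 2 * ln m"
      by (rule log_integral_le_ln_mean_square[OF Tp m _ _ _ ms]) (rule ac; assumption)+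
    \<comment> \<open>Multiplied by - T / 2, the last term cancels the cost \<open>T * ln c\<close>
      of the right edge, and the -1 becomes the gain T / 2.\<close>
    also have "ln m = ln (1 + \<bar>r T\<bar>) - 1 - 2 * ln c"
      using c_pos unfolding m_def by (subst ln_div) (auto simp: ln_mult ln_realpow add_pos_nonneg)
    finally have "- integral {T..2 * T} (\<lambda>t. ln (norm (beta A (b T) (U T) T (Complex (\<delta> T) t)))) - T * ln c
        \<ge> T / 2 * (1 - ln (1 + \<bar>r T\<bar>))"
      by (simp add: algebra_simps)
    moreover have "\<bar>horizontal_contribution (beta A (b T) (U T) T) (\<delta> T) (1 / 2) T\<bar> \<le> h T"
      using elim(3,5) by blast
    moreover have "pi * (1 / 2 - \<delta> T) * (real (A_count T (2 * T)) + 1) \<ge>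
       - integral {T..2 * T} (\<lambda>t. ln (norm (beta A (b T) (U T) T (Complex (\<delta> T) t)))) - T * ln c
       - horizontal_contribution (beta A (b T) (U T) T) (\<delta> T) (1 / 2) T - horizontal_contribution zeta (1 / 2) 3 T
       - 2 * horizontal_contribution (mollifier (b T) (U T)) (1 / 2) 3 T - 12 - 15 / 2 * pi"
      by (rule ac; assumption)
    ultimately have "pi * (1 / 2 - \<delta> T) * (real (A_count T (2 * T)) + 1) \<ge> T / 2 * (1 - ln (1 + \<bar>r T\<bar>)) - err T"
      unfolding err_def by linarith
    moreover have "pi * (1 / 2 - \<delta> T) = pi * (1 - 2 * \<delta> T) / 2" by (simp add: algebra_simps)
    then have "pi * (1 / 2 - \<delta> T) = K / (2 * L T)" unfolding x K(1) by simp
    ultimately have "K / (2 * L T) * (real (A_count T (2 * T)) + 1) \<ge> T / 2 * (1 - ln (1 + \<bar>r T\<bar>)) - err T" by simp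
    then have "real (A_count T (2 * T)) + 1 \<ge> (T / 2 * (1 - ln (1 + \<bar>r T\<bar>)) - err T) / (K / (2 * L T))"
      using K(2) elim(6) by (subst pos_divide_le_eq) (simp_all only: mult.commute zero_less_divide_iff zero_less_mult_iff zero_less_numeral simp_thms)
    also have "(T / 2 * (1 - ln (1 + \<bar>r T\<bar>)) - err T) / (K / (2 * L T)) = T * L T / K * (1 + r' T) + 1"
      using K(2) elim(6) Tp by (simp add: r'_def field_simps)
    finally show ?case by simp
  qed
  \<comment> \<open>One height suffices for the reflection: A and \<open>zeta\<close> do not depend
    on T, and reality on a single segment determines the identity in the whole upper
    half-plane.\<close>
  have "\<exists>T>0. U T \<ge> 1 \<and> (\<forall>s. Re s = 1 / 2 \<and> T \<le> Im s \<and> Im s \<le> 2 * T \<longrightarrow>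
         A s * Y_fun (b T) (U T) s = of_real (c * Re (beta A (b T) (U T) T s)))"
  proof -
    have "\<forall>\<^sub>F T in at_top. T > 0 \<and> U T \<ge> 1 \<and> (\<forall>s. Re s = 1 / 2 \<and> T \<le> Im s \<and> Im s \<le> 2 * T \<longrightarrow>
         A s * Y_fun (b T) (U T) s = of_real (c * Re (beta A (b T) (U T) T s)))"
      using U_pos L_pos critical_line eventually_gt_at_top[of 0]
      by eventually_elim (simp add: L_def)
    then show ?thesis by (rule eventually_happens'[rotated]) simp
  qed
  then obtain T0 where T0: "T0 > 0" "U T0 \<ge> 1"
    "\<And>s. Re s = 1 / 2 \<Longrightarrow> T0 \<le> Im s \<Longrightarrow> Im s \<le> 2 * T0 \<Longrightarrow>
       A s * Y_fun (b T0) (U T0) s = of_real (c * Re (beta A (b T0) (U T0) T0 s))"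
    by blast
  have real: "A s * Y_fun (b T0) (U T0) s \<in> \<real>" if "Re s = 1 / 2" "T0 \<le> Im s" "Im s \<le> 2 * T0" for s
    unfolding T0(3)[OF that] by (rule Reals_of_real)
  have reflect: "A s * zeta s = cnj (A (1 - cnj s) * zeta (1 - cnj s))" if "Im s > 0" for s
    by (rule aleph_zeta_reflection[where b = "b T0" and U = "U T0", OF aleph T0(1) b_1 b_bound T0(2) real that])
  obtain C where C: "\<And>T. T \<ge> 5 \<Longrightarrow> N_count T \<le> (T + 1) * ln (T + 1) / (2 * pi) + C * (T + 1)"
    by (rule N_count_le[OF aleph reflect], assumption) (rule that)
  have N0_ge: "\<forall>\<^sub>F T in at_top. k * (T * ln T) \<le> N0_count T" if k: "0 < k" "k < \<theta> / K" for k
  proof -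
    obtain k3 where k3: "k < k3" "k3 < \<theta> / K" using dense[OF k(2)] by blast
    \<comment> \<open>This term pays for the ordinate possibly lost at the lower end of each block
      in \<open>A_count_le_N0_count\<close>.\<close>
    have inv: "((\<lambda>T :: real. 1 / (T * ln T)) \<longlongrightarrow> 0) at_top" by real_asymp
    have "((\<lambda>T. L T / ln T / K * (1 + r' T) - 1 / (T * ln T)) \<longlongrightarrow> \<theta> / K * (1 + 0) - 0) at_top"
      using K(2) by (intro tendsto_diff tendsto_mult tendsto_divide tendsto_add tendsto_const L_lim r'_lim inv) simp
    then have "\<forall>\<^sub>F T in at_top. k3 < L T / ln T / K * (1 + r' T) - 1 / (T * ln T)"
      using k3(2) by (intro order_tendstoD) simp_all
    with A_ge eventually_gt_at_top[of 1]
    have "\<forall>\<^sub>F T in at_top. k3 * (T * ln T) \<le> N0_count (2 * T) - N0_count T"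
    proof eventually_elim
      case (elim T)
      have pos: "0 < T * ln T" using elim(2) by simp
      have "k3 * (T * ln T) \<le> (L T / ln T / K * (1 + r' T) - 1 / (T * ln T)) * (T * ln T)"
        using elim(3) pos by (intro mult_right_mono) auto
      also have "\<dots> = T * L T / K * (1 + r' T) - 1"
        using elim(2) by (simp add: left_diff_distrib)
      also have "\<dots> \<le> N0_count (2 * T) - N0_count T"
        using A_count_le_N0_count[of T] elim(1,2) by linarith
      finally show ?case .
    qed
    then show ?thesis
      using k(1) k3(1) by (intro eventually_ge_of_dyadic_increments[OF N0_count_nonneg, of k3]) auto
  qed
  have "kappa0 \<ge> ereal (2 * pi * (\<theta> / K))"
    by (rule kappa0_ge[OF _ C N0_ge]) (use theta(1) K(2) in auto)
  moreover have "2 * pi * (\<theta> / K) = 2 * \<theta> / (exp 1 * c\<^sup>2 * \<gamma>)" by (simp add: K_def)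
  ultimately have "kappa0 \<ge> ereal (2 * \<theta> / (exp 1 * c\<^sup>2 * \<gamma>))" by simp
  moreover have "\<exists>r. (r \<longlongrightarrow> 0) at_top \<and> (\<forall>\<^sub>F T in at_top. real (A_count T (2 * T))
      \<ge> T * ln (U T) / (pi * exp 1 * c\<^sup>2 * \<gamma>) * (1 + r T))"
    using r'_lim A_ge unfolding L_def K_def by blast
  ultimately show ?thesis by blast
qed

end
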